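(* Consider the Gaussian sequence model with $n\to\infty$, $s_n\to\infty$, $n/s_n\to\infty$. Let $a_b=\sqrt{2\log(n/s_n)}+b$ and $$\Theta_b=\{\theta\in\mathbb{R}^n:\ |S_\theta|=s_n,\ |\theta_i|\ge a_b\ \text{for all } i\in S_\theta\},$$ where $b$ is either a fixed real number or a sequence $b=b_n\to+\infty$. There exists a multiple testing procedure $\varphi$, not depending on $s_n$ or $b$, such that $$\sup_{\theta\in\Theta_b}\mathfrak R(\theta,\varphi)=\overline\Phi(b)+o(1).$$ In particular this holds for the empirical Bayes $\ell$-value procedure $\varphi^{\hat\ell}$ taken at any fixed threshold $t\in(0,1)$. In addition, if $s_n\lesssim n^c$ for some $c<1$, this also holds for the Benjamini–Hochberg procedure $\varphi^{BH}_{\alpha}$ taken at a vanishing level $\alpha=\alpha_n=o(1)$ that satisfies $-\log(\alpha_n)=o(\sqrt{\log n})$.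
   Context: Model: for each $n$, one observes $X_i=\theta_i+\varepsilon_i$, $1\le i\le n$, $\varepsilon_i$ i.i.d. $\mathcal N(0,1)$, $\theta\in\mathbb R^n$ deterministic; $P_\theta,E_\theta$ denote the law of $X$ and its expectation; $S_\theta=\{i:\theta_i\neq0\}$; $(s_n)$ integers. $\phi$ is the standard normal density and $\overline\Phi(x)=P(\mathcal N(0,1)>x)$, with $\overline\Phi(+\infty)=0$. A multiple testing procedure is a measurable $\varphi:\mathbb R^n\to\{0,1\}^n$ (depending on $n$). $\mathrm{FDR}(\theta,\varphi)=E_\theta\left[\frac{\sum_i\mathbf 1\{\theta_i=0\}\varphi_i(X)}{1\vee\sum_i\varphi_i(X)}\right]$, $\mathrm{FNR}(\theta,\varphi)=E_\theta\left[\frac{\sum_i\mathbf 1\{\theta_i\ne0\}(1-\varphi_i(X))}{1\vee|S_\theta|}\right]$, $\mathfrak R=\mathrm{FDR}+\mathrm{FNR}$. $\ell$-value procedure: let $g(x)=(2\pi)^{-1/2}x^{-2}(1-e^{-x^2/2})$ (extended by continuity at $0$), $\beta(x)=g(x)/\phi(x)-1$, and let $\hat w$ be a maximiser over $w\in[1/n,1]$ of $\sum_{i=1}^n\log(1+w\beta(X_i))$. Put $\ell_{i,w}(X)=\frac{(1-w)\phi(X_i)}{(1-w)\phi(X_i)+w g(X_i)}$ and $\varphi^{\hat\ell}_i(X)=\mathbf 1\{\ell_{i,\hat w}(X)<t\}$. BH procedure at level $\alpha$: $\varphi^{BH}_{\alpha,i}(X)=\mathbf 1\{|X_i|\ge\hat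 t\}$, with $\hat t=\min\{t\in\mathbb R\cup\{+\infty\}:\ n^{-1}\sum_{i=1}^n\mathbf 1\{|X_i|\ge t\}\ge 2\overline\Phi(t)/\alpha\}$. *)

theory Defs
  imports
    "HOL-Probability.Probability"
    "HOL-Library.Landau_Symbols"
    "HOL-Real_Asymp.Real_Asymp"
begin

(* Vectors in R^n are functions nat => real that are extensional on {1..n}, that is,
   points of space (PiM {1..n} (\<lambda>_. borel)). *)

abbreviation sample_space :: "nat \<Rightarrow> (nat \<Rightarrow> real) measure" where
  "sample_space n \<equiv> PiM {1..n} (\<lambda>_. borel)"

definition std_gaussian :: "real measure" where
  "std_gaussian = density lborel std_normal_density"

(* The argument is extended real so that the value at +infinity is 0 by definition. *)
definition gauss_tail :: "ereal \<Rightarrow> real" where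
  "gauss_tail t = measure std_gaussian {z. t < ereal z}"

definition noise :: "nat \<Rightarrow> (nat \<Rightarrow> real) measure" where
  "noise n = PiM {1..n} (\<lambda>_. std_gaussian)"

definition obs_law :: "nat \<Rightarrow> (nat \<Rightarrow> real) \<Rightarrow> (nat \<Rightarrow> real) measure" where
  "obs_law n \<theta> = distr (noise n) (sample_space n) (\<lambda>\<epsilon>. \<lambda>i\<in>{1..n}. \<theta> i + \<epsilon> i)"

definition support :: "nat \<Rightarrow> (nat \<Rightarrow> real) \<Rightarrow> nat set" where
  "support n \<theta> = {i\<in>{1..n}. \<theta> i \<noteq> 0}"


type_synonym testing_procedure = "(nat \<Rightarrow> real) \<Rightarrow> nat \<Rightarrow> nat"

(* A measurable map from R^n to {0,1}^n. *)
definition multiple_testing_procedure :: "nat \<Rightarrow> testing_procedure \<Rightarrow> bool" where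
  "multiple_testing_procedure n \<phi> \<longleftrightarrow>
     \<phi> \<in> sample_space n \<rightarrow>\<^sub>M PiM {1..n} (\<lambda>_. count_space {0, 1})"

definition FDR :: "nat \<Rightarrow> (nat \<Rightarrow> real) \<Rightarrow> testing_procedure \<Rightarrow> real" where
  "FDR n \<theta> \<phi> = (LINT x|obs_law n \<theta>.
     (\<Sum>i=1..n. of_bool (\<theta> i = 0) * real (\<phi> x i)) / max 1 (\<Sum>i=1..n. real (\<phi> x i)))"

definition FNR :: "nat \<Rightarrow> (nat \<Rightarrow> real) \<Rightarrow> testing_procedure \<Rightarrow> real" where
  "FNR n \<theta> \<phi> = (LINT x|obs_law n \<theta>.
     (\<Sum>i=1..n. of_bool (\<theta> i \<noteq> 0) * (1 - real (\<phi> x i))) / max 1 (real (card (support n \<theta>))))"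

definition risk :: "nat \<Rightarrow> (nat \<Rightarrow> real) \<Rightarrow> testing_procedure \<Rightarrow> real" where
  "risk n \<theta> \<phi> = FDR n \<theta> \<phi> + FNR n \<theta> \<phi>"


definition signal_class :: "nat \<Rightarrow> nat \<Rightarrow> real \<Rightarrow> (nat \<Rightarrow> real) set" where
  "signal_class n s b =
     {\<theta> \<in> space (sample_space n). card (support n \<theta>) = s \<and>
        (\<forall>i\<in>support n \<theta>. \<bar>\<theta> i\<bar> \<ge> sqrt (2 * ln (real n / real s)) + b)}"

definition sparse_regime :: "(nat \<Rightarrow> nat) \<Rightarrow> bool" where
  "sparse_regime s \<longleftrightarrow>
     filterlim s at_top sequentially \<and>
     filterlim (\<lambda>n. real n / real (s n)) at_top sequentially"

definition boundary_regime :: "(nat \<Rightarrow> real) \<Rightarrow> bool" where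
  "boundary_regime b \<longleftrightarrow> (\<exists>c. \<forall>n. b n = c) \<or> filterlim b at_top sequentially"

(* The supremum is over a set of reals contained in [0, 2] for measurable procedures; in the
   sparse regime s n \<le> n eventually, so that it is nonempty for all large n. *)
definition achieves_boundary_risk ::
    "(nat \<Rightarrow> testing_procedure) \<Rightarrow> (nat \<Rightarrow> nat) \<Rightarrow> (nat \<Rightarrow> real) \<Rightarrow> bool" where
  "achieves_boundary_risk \<phi> s b \<longleftrightarrow>
     (\<lambda>n. (SUP \<theta>\<in>signal_class n (s n) (b n). risk n \<theta> (\<phi> n)) - gauss_tail (ereal (b n)))
       \<longlonglongrightarrow> 0"


definition slab :: "real \<Rightarrow> real" where
  "slab x = (if x = 0 then 1 / (2 * sqrt (2 * pi))
             else 1 / sqrt (2 * pi) * (1 - exp (- x\<^sup>2 / 2)) / x\<^sup>2)"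

lemma isCont_slab_0: "isCont slab 0"
proof -
  have "((\<lambda>x::real. 1 / sqrt (2 * pi) * (1 - exp (- x\<^sup>2 / 2)) / x\<^sup>2)
          \<longlongrightarrow> 1 / (2 * sqrt (2 * pi))) (at 0)"
    unfolding filterlim_split_at_real
    by (intro filterlim_split_at; real_asymp simp: field_simps sqrt_def)
  then have "(slab \<longlongrightarrow> 1 / (2 * sqrt (2 * pi))) (at 0)"
    by (rule Lim_transform_eventually) (auto simp: slab_def eventually_at_filter)
  then show ?thesis
    by (simp add: isCont_def slab_def)
qed

definition beta :: "real \<Rightarrow> real" where
  "beta x = slab x / std_normal_density x - 1"

definition marginal_loglik :: "nat \<Rightarrow> (nat \<Rightarrow> real) \<Rightarrow> real \<Rightarrow> real" where
  "marginal_loglik n x w = (\<Sum>i=1..n. ln (1 + w * beta (x i)))"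

(* what is any choice of a maximiser of the marginal likelihood, for every n and every
   data point; no measurability of the choice is assumed. *)
definition mmle_weight :: "(nat \<Rightarrow> (nat \<Rightarrow> real) \<Rightarrow> real) \<Rightarrow> bool" where
  "mmle_weight what \<longleftrightarrow>
     (\<forall>n. \<forall>x\<in>space (sample_space n).
        is_arg_max (marginal_loglik n x) (\<lambda>w. w \<in> {1 / real n..1}) (what n x))"

definition l_value :: "real \<Rightarrow> real \<Rightarrow> real" where
  "l_value w x =
     (1 - w) * std_normal_density x / ((1 - w) * std_normal_density x + w * slab x)"

definition l_value_procedure ::
    "(nat \<Rightarrow> (nat \<Rightarrow> real) \<Rightarrow> real) \<Rightarrow> real \<Rightarrow> nat \<Rightarrow> testing_procedure" where
  "l_value_procedure what t n x = (\<lambda>i\<in>{1..n}. of_bool (l_value (what n x) (x i) < t))"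


(* For levels 0 < \<alpha> < 1 the minimum exists: every admissible t is positive, +infinity is
   admissible, and t \<mapsto> card {i. \<bar>x i\<bar> \<ge> t} is upper semicontinuous. *)
definition BH_threshold :: "nat \<Rightarrow> real \<Rightarrow> (nat \<Rightarrow> real) \<Rightarrow> ereal" where
  "BH_threshold n \<alpha> x =
     (LEAST t::ereal. t \<noteq> -\<infinity> \<and>
        real (card {i\<in>{1..n}. ereal \<bar>x i\<bar> \<ge> t}) / real n \<ge> 2 * gauss_tail t / \<alpha>)"

definition BH_procedure :: "real \<Rightarrow> nat \<Rightarrow> testing_procedure" where
  "BH_procedure \<alpha> n x = (\<lambda>i\<in>{1..n}. of_bool (ereal \<bar>x i\<bar> \<ge> BH_threshold n \<alpha> x))"

definition slowly_vanishing_level :: "(nat \<Rightarrow> real) \<Rightarrow> bool" where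
  "slowly_vanishing_level \<alpha> \<longleftrightarrow>
     (\<forall>n. 0 < \<alpha> n \<and> \<alpha> n < 1) \<and> \<alpha> \<longlonglongrightarrow> 0 \<and>
     (\<lambda>n. - ln (\<alpha> n)) \<in> o(\<lambda>n. sqrt (ln (real n)))"

end

theory Submission
  imports Defs
begin

text \<open>
  Both procedures reject exactly the coordinates whose absolute value exceeds a data-driven threshold. Let
  \<open>a = sqrt (2 ln (n / s))\<close>. It suffices that this threshold concentrates: for every \<open>\<delta> > 0\<close>, uniformly over
  the class, it lies with high probability between some \<open>u\<close> with \<open>n P(N(0,1) > u) = o(s)\<close> and \<open>a + \<delta>\<close>.
  Indeed a signal of size at least \<open>a + b\<close> is then missed with probability at most \<open>P(N(0,1) > b - \<delta>)\<close>, a fixed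
  proportion of the \<open>s\<close> signals is detected, and there are only \<open>o(s)\<close> false discoveries. Moreover
  \<open>u \<ge> a - \<delta>\<close> holds automatically, so that signals of size exactly \<open>a + b\<close> give the lower bound.

  For the \<open>\<ell>\<close>-value procedure, the threshold is controlled through the sign of the derivative of the
  marginal log-likelihood (the score). It is positive at \<open>w = (s / n) exp (- a \<delta> / 2)\<close>, since each
  detected signal contributes at least \<open>1 / (2 w)\<close> and every other coordinate at least \<open>- 1\<close>. At \<open>w = a\<^sup>2 s / n\<close> the
  signals contribute at most \<open>s / w = n / a\<^sup>2\<close> whereas the nulls have expected contribution at most \<open>- c n / a\<close>
  and variance at most \<open>2 n / w\<close>, so it is negative by Chebyshev's inequality.

  For BH with \<open>u\<close> defined by \<open>n P(N(0,1) > u) = \<eta> s\<close>, a threshold below \<open>u\<close> would require about \<open>1 / \<alpha>\<close> times as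
  many exceedances as the nulls produce on average; Chebyshev's inequality excludes this on a dyadic grid of levels.
\<close>

section \<open>The standard Gaussian tail\<close>

text \<open>A bracket for the weight becomes one for the threshold because a coordinate is rejected
  iff \<open>(1 - w) * (1 - t) < t * w * (1 + beta x)\<close>, where \<open>1 + beta x\<close> is
  about exp(x^2/2) / x^2. The slab decays like 1/x^2, so the drift obtained for the null score is
  only c/a per coordinate, and the upper end of the bracket exceeds s/n by the factor a^2. That
  factor cancels against the 1/x^2 in \<open>1 + beta x\<close>: the threshold stays above sqrt(a^2
  - 2M) with M depending on t alone. The expected number of nulls beyond it is at most a constant
  times s divided by the threshold, and this last factor, from the Mills bound, makes it o(s).
  Upwards there is exponential room: passing a by \<delta> multiplies \<open>beta\<close> by about
  exp(a \<delta>), half of which pays for the smaller weight. For BH the division by the level must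
  fit into the same room, that is, exp(- a \<delta> / 2) \<le> \<alpha> eventually for every
  \<delta>; polynomial sparsity makes a comparable to sqrt(log n), whence the condition on log
  \<alpha>. All failure probabilities are at most constants times 1/s, so second moments
  suffice.\<close>

lemma sets_std_gaussian [simp, measurable_cong]: "sets std_gaussian = sets borel"
  by (simp add: std_gaussian_def)

lemma space_std_gaussian [simp]: "space std_gaussian = UNIV"
  by (simp add: std_gaussian_def)

lemma prob_space_std_gaussian: "prob_space std_gaussian"
  unfolding std_gaussian_def by (rule prob_space_normal_density) simp

interpretation std_gaussian: prob_space std_gaussian
  by (rule prob_space_std_gaussian)

lemma emeasure_std_gaussian:
  "A \<in> sets borel \<Longrightarrow>
     emeasure std_gaussian A = (\<integral>\<^sup>+x. ennreal (std_normal_density x) * indicator A x \<partial>lborel)"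
  unfolding std_gaussian_def by (subst emeasure_density) auto

lemma integral_std_gaussian:
  fixes f :: "real \<Rightarrow> real"
  assumes [measurable]: "f \<in> borel_measurable borel"
  shows "(LINT z|std_gaussian. f z) = (LINT z|lborel. std_normal_density z * f z)"
  unfolding std_gaussian_def by (subst integral_density) auto

lemma integrable_std_gaussian_iff:
  fixes f :: "real \<Rightarrow> real"
  assumes [measurable]: "f \<in> borel_measurable borel"
  shows "integrable std_gaussian f \<longleftrightarrow> integrable lborel (\<lambda>z. std_normal_density z * f z)"
  unfolding std_gaussian_def by (subst integrable_density) auto

lemma std_normal_density_le_1: "std_normal_density x \<le> 1"
proof -
  have "1 / sqrt (2 * pi) \<le> 1"
    using pi_gt3 by simp
  then have "1 / sqrt (2 * pi) * exp (- x\<^sup>2 / 2) \<le> 1 * 1"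
    by (intro mult_mono) auto
  then show ?thesis
    by (simp add: std_normal_density_def)
qed

lemma std_normal_density_le_exp: "std_normal_density x \<le> exp (- x\<^sup>2 / 2)"
proof -
  have "1 / sqrt (2 * pi) \<le> 1"
    using pi_gt3 by simp
  then have "1 / sqrt (2 * pi) * exp (- x\<^sup>2 / 2) \<le> 1 * exp (- x\<^sup>2 / 2)"
    by (intro mult_right_mono) auto
  then show ?thesis
    by (simp add: std_normal_density_def)
qed

lemma measure_std_gaussian_interval_le:
  assumes "x \<le> y"
  shows "measure std_gaussian {x..y} \<le> y - x"
proof -
  have "emeasure std_gaussian {x..y}
      = (\<integral>\<^sup>+z. ennreal (std_normal_density z) * indicator {x..y} z \<partial>lborel)"
    by (simp add: emeasure_std_gaussian)
  also have "\<dots> \<le> (\<integral>\<^sup>+z. indicator {x..y} z \<partial>lborel)"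
    by (intro nn_integral_mono) (auto simp: indicator_def std_normal_density_le_1)
  also have "\<dots> = ennreal (y - x)"
    using assms by simp
  finally show ?thesis
    using assms by (simp add: std_gaussian.emeasure_eq_measure)
qed

lemma measure_std_gaussian_interval_ge:
  assumes "x \<le> y" "\<And>z. z \<in> {x..y} \<Longrightarrow> c \<le> std_normal_density z" "0 \<le> c"
  shows "c * (y - x) \<le> measure std_gaussian {x..y}"
proof -
  have "ennreal (c * (y - x)) = (\<integral>\<^sup>+z. ennreal c * indicator {x..y} z \<partial>lborel)"
    using assms by (simp add: nn_integral_cmult ennreal_mult)
  also have "\<dots> \<le> (\<integral>\<^sup>+z. ennreal (std_normal_density z) * indicator {x..y} z \<partial>lborel)"
    using assms by (intro nn_integral_mono) (auto simp: indicator_def intro: ennreal_leI)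
  also have "\<dots> = emeasure std_gaussian {x..y}"
    by (simp add: emeasure_std_gaussian)
  finally show ?thesis
    by (simp add: std_gaussian.emeasure_eq_measure)
qed

lemma measure_std_gaussian_singleton [simp]: "measure std_gaussian {x} = 0"
proof -
  have "measure std_gaussian {x} \<le> x - x"
    using measure_std_gaussian_interval_le[of x x] by simp
  then show ?thesis
    using measure_nonneg[of std_gaussian "{x}"] by linarith
qed

lemma measure_std_gaussian_uminus:
  assumes [measurable]: "A \<in> sets borel"
  shows "measure std_gaussian {z. - z \<in> A} = measure std_gaussian A"
proof -
  have [measurable]: "{z::real. - z \<in> A} \<in> sets borel"
    by measurable
  have "emeasure std_gaussian A
      = (\<integral>\<^sup>+x. ennreal (std_normal_density x) * indicator A x \<partial>distr lborel borel uminus)"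
    by (simp add: emeasure_std_gaussian lborel_distr_uminus)
  also have "\<dots> = (\<integral>\<^sup>+x. ennreal (std_normal_density (- x)) * indicator A (- x) \<partial>lborel)"
    by (subst nn_integral_distr) auto
  also have "\<dots> = (\<integral>\<^sup>+x. ennreal (std_normal_density x) * indicator {z. - z \<in> A} x \<partial>lborel)"
    by (simp add: std_normal_density_def indicator_def)
  also have "\<dots> = emeasure std_gaussian {z. - z \<in> A}"
    by (simp add: emeasure_std_gaussian)
  finally show ?thesis
    by (simp add: measure_def)
qed

lemma gauss_tail_greaterThan: "gauss_tail (ereal t) = measure std_gaussian {t<..}"
  by (simp add: gauss_tail_def greaterThan_def)

lemma gauss_tail_atLeast: "gauss_tail (ereal t) = measure std_gaussian {t..}"
proof -
  have "{t..} = {t} \<union> {t<..}"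
    by auto
  then have "measure std_gaussian {t..} = measure std_gaussian {t} + measure std_gaussian {t<..}"
    by (simp only:) (subst std_gaussian.finite_measure_Union, auto)
  then show ?thesis
    by (simp add: gauss_tail_greaterThan)
qed

lemma gauss_tail_atMost: "gauss_tail (ereal t) = measure std_gaussian {..- t}"
  using measure_std_gaussian_uminus[of "{t..}"]
  by (simp add: gauss_tail_atLeast atMost_def le_minus_iff)

lemma gauss_tail_lessThan: "gauss_tail (ereal t) = measure std_gaussian {..<- t}"
  using measure_std_gaussian_uminus[of "{t<..}"]
  by (simp add: gauss_tail_greaterThan lessThan_def less_minus_iff)

lemma gauss_tail_uminus: "gauss_tail (ereal (- t)) = 1 - gauss_tail (ereal t)"
proof -
  have "{..t} = UNIV - {t<..}"
    by auto
  then have "measure std_gaussian {..t} = 1 - measure std_gaussian {t<..}"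
    using std_gaussian.prob_compl[of "{t<..}"] by simp
  then show ?thesis
    by (simp add: gauss_tail_atMost gauss_tail_greaterThan[symmetric])
qed

lemma gauss_tail_infinity [simp]: "gauss_tail \<infinity> = 0"
  by (simp add: gauss_tail_def)

lemma gauss_tail_nonneg [simp]: "0 \<le> gauss_tail t"
  by (simp add: gauss_tail_def)

lemma gauss_tail_le_1 [simp]: "gauss_tail t \<le> 1"
  by (simp add: gauss_tail_def)

lemma gauss_tail_antimono: "t \<le> t' \<Longrightarrow> gauss_tail t' \<le> gauss_tail t"
  unfolding gauss_tail_def
  by (intro std_gaussian.finite_measure_mono) (auto intro: le_less_trans)

text \<open>The density is at most 1, so the tail is Lipschitz with constant 1: moving a threshold
  by \<delta> changes a miss probability by at most \<delta>, uniformly in \<open>b\<close>.\<close>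

lemma gauss_tail_diff_le:
  assumes "x \<le> y"
  shows "gauss_tail (ereal x) - gauss_tail (ereal y) \<le> y - x"
proof -
  have "gauss_tail (ereal x) \<le> measure std_gaussian ({x..y} \<union> {y<..})"
    unfolding gauss_tail_greaterThan by (intro std_gaussian.finite_measure_mono) auto
  also have "\<dots> \<le> measure std_gaussian {x..y} + measure std_gaussian {y<..}"
    by (rule measure_Un_le) auto
  also have "\<dots> \<le> (y - x) + gauss_tail (ereal y)"
    using measure_std_gaussian_interval_le[OF assms] by (simp add: gauss_tail_greaterThan)
  finally show ?thesis
    by simp
qed

lemma gauss_tail_lipschitz: "\<bar>gauss_tail (ereal x) - gauss_tail (ereal y)\<bar> \<le> \<bar>x - y\<bar>"
  using gauss_tail_diff_le[of x y] gauss_tail_diff_le[of y x]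
    gauss_tail_antimono[of "ereal x" "ereal y"] gauss_tail_antimono[of "ereal y" "ereal x"]
  by (cases "x \<le> y") auto

lemma continuous_gauss_tail: "continuous_on A (\<lambda>x. gauss_tail (ereal x))"
proof (rule lipschitz_on_continuous_on)
  show "1-lipschitz_on A (\<lambda>x. gauss_tail (ereal x))"
    by (rule lipschitz_onI) (use gauss_tail_lipschitz in \<open>auto simp: dist_real_def\<close>)
qed

text \<open>Only the interval from \<open>t\<close> to \<open>t + h\<close> is counted, at its
  smallest density. The loss is affordable: at distance \<delta> below the boundary a factor
  exponential in the boundary is to spare.\<close>

lemma gauss_tail_ge:
  assumes "0 \<le> t" "0 \<le> h"
  shows "std_normal_density (t + h) * h \<le> gauss_tail (ereal t)"
proof -
  have "std_normal_density (t + h) * ((t + h) - t) \<le> measure std_gaussian {t..t + h}"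
  proof (rule measure_std_gaussian_interval_ge)
    fix z assume "z \<in> {t..t + h}"
    then have "z\<^sup>2 \<le> (t + h)\<^sup>2"
      using assms by (intro power_mono) auto
    then show "std_normal_density (t + h) \<le> std_normal_density z"
      by (simp add: std_normal_density_def divide_right_mono)
  qed (use assms in auto)
  also have "\<dots> \<le> gauss_tail (ereal t)"
    unfolding gauss_tail_atLeast by (intro std_gaussian.finite_measure_mono) auto
  finally show ?thesis
    by simp
qed

lemma gauss_tail_pos: "0 < gauss_tail (ereal t)"
proof -
  have "0 < std_normal_density (max t 0 + 1) * 1"
    by (simp add: normal_density_pos)
  also have "\<dots> \<le> gauss_tail (ereal (max t 0))"
    by (rule gauss_tail_ge) auto
  also have "\<dots> \<le> gauss_tail (ereal t)"
    by (rule gauss_tail_antimono) simp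
  finally show ?thesis .
qed

text \<open>Beyond \<open>t\<close> the density is at most \<open>x / t\<close> times itself, and
  that product has the explicit antiderivative \<open>- std_normal_density x / t\<close>.\<close>

lemma gauss_tail_le_mills:
  assumes "0 < t"
  shows "gauss_tail (ereal t) \<le> std_normal_density t / t"
proof -
  have lim: "((\<lambda>x. - std_normal_density x / t) \<longlongrightarrow> 0) at_top"
    unfolding std_normal_density_def using assms by real_asymp
  have "emeasure std_gaussian {t..}
      = (\<integral>\<^sup>+x. ennreal (std_normal_density x) * indicator {t..} x \<partial>lborel)"
    by (simp add: emeasure_std_gaussian)
  also have "\<dots> \<le> (\<integral>\<^sup>+x. ennreal (x / t * std_normal_density x) * indicator {t..} x \<partial>lborel)"
  proof (intro nn_integral_mono)
    fix x :: real
    show "ennreal (std_normal_density x) * indicator {t..} x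
        \<le> ennreal (x / t * std_normal_density x) * indicator {t..} x"
    proof (cases "t \<le> x")
      case True
      then have "1 * std_normal_density x \<le> x / t * std_normal_density x"
        using assms by (intro mult_right_mono) auto
      then show ?thesis
        using True by (auto intro: ennreal_leI)
    qed auto
  qed
  also have "\<dots> = ennreal (0 - (- std_normal_density t / t))"
  proof (rule nn_integral_FTC_atLeast[where F = "\<lambda>x. - std_normal_density x / t"])
    fix x assume "t \<le> x"
    show "((\<lambda>x. - std_normal_density x / t) has_real_derivative x / t * std_normal_density x) (at x)"
      unfolding std_normal_density_def
      using assms by (auto intro!: derivative_eq_intros simp: power2_eq_square field_simps)
    show "0 \<le> x / t * std_normal_density x"
      using \<open>t \<le> x\<close> assms by simp
  qed (use lim in auto)
  finally show ?thesis
    using assms by (simp add: std_gaussian.emeasure_eq_measure gauss_tail_atLeast)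
qed

lemma gauss_tail_at_top: "((\<lambda>x. gauss_tail (ereal x)) \<longlongrightarrow> 0) at_top"
proof (rule tendsto_sandwich[OF _ _ tendsto_const])
  show "\<forall>\<^sub>F x in at_top. 0 \<le> gauss_tail (ereal x)"
    by simp
  show "\<forall>\<^sub>F x in at_top. gauss_tail (ereal x) \<le> std_normal_density x / x"
    using eventually_gt_at_top[of 0] by eventually_elim (rule gauss_tail_le_mills)
  show "((\<lambda>x. std_normal_density x / x) \<longlongrightarrow> 0) at_top"
    unfolding std_normal_density_def by real_asymp
qed

lemma ex_gauss_tail_eq:
  assumes "0 < p" "p < 1 / 2"
  shows "\<exists>t>0. gauss_tail (ereal t) = p"
proof -
  have half: "gauss_tail (ereal 0) = 1 / 2"
    using gauss_tail_uminus[of 0] by simp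
  obtain T where "gauss_tail (ereal T) < p"
    using order_tendstoD(2)[OF gauss_tail_at_top \<open>0 < p\<close>] eventually_happens'[OF trivial_limit_at_top_linorder]
    by blast
  moreover have "0 \<le> T"
    using calculation gauss_tail_antimono[of "ereal T" "ereal 0"] assms half by (cases "0 \<le> T") auto
  ultimately obtain t where "0 \<le> t" "gauss_tail (ereal t) = p"
    using IVT2'[of "\<lambda>x. gauss_tail (ereal x)" T p 0] assms half continuous_gauss_tail by auto
  moreover have "t \<noteq> 0"
    using calculation assms half by auto
  ultimately show ?thesis
    by (intro exI[of _ t]) auto
qed

lemma gauss_tail_two_sided: "measure std_gaussian {z. u \<le> \<bar>z\<bar>} \<le> 2 * gauss_tail (ereal u)"
proof -
  have "measure std_gaussian {z. u \<le> \<bar>z\<bar>} \<le> measure std_gaussian ({u..} \<union> {..- u})"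
    by (intro std_gaussian.finite_measure_mono) auto
  also have "\<dots> \<le> measure std_gaussian {u..} + measure std_gaussian {..- u}"
    by (rule measure_Un_le) auto
  finally show ?thesis
    by (simp add: gauss_tail_atLeast[symmetric] gauss_tail_atMost[symmetric])
qed

text \<open>Only the tail on the side given by the sign of \<theta> is kept.\<close>

lemma gauss_tail_shift_le:
  "gauss_tail (ereal (u - \<bar>\<theta>\<bar>)) \<le> measure std_gaussian {z. u \<le> \<bar>\<theta> + z\<bar>}"
proof (cases "0 \<le> \<theta>")
  case True
  then show ?thesis
    unfolding gauss_tail_atLeast by (intro std_gaussian.finite_measure_mono) auto
next
  case False
  then show ?thesis
    unfolding gauss_tail_atMost by (intro std_gaussian.finite_measure_mono) auto
qed

section \<open>The law of the observations\<close>

text \<open>Keeps the simplifier from turning the index set \<open>{1..n}\<close> into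
  \<open>{Suc 0..n}\<close>, where rules stated for \<open>{1..n}\<close> would no longer
  match.\<close>

declare One_nat_def [simp del]

lemma prob_space_noise: "prob_space (noise n)"
  unfolding noise_def by (intro prob_space_PiM prob_space_std_gaussian)

lemma sets_noise [simp, measurable_cong]: "sets (noise n) = sets (sample_space n)"
  unfolding noise_def by (intro sets_PiM_cong) auto

lemma measurable_shift [measurable]:
  "(\<lambda>\<epsilon>. \<lambda>i\<in>{1..n}. \<theta> i + \<epsilon> i) \<in> noise n \<rightarrow>\<^sub>M sample_space n"
  by measurable

lemma sets_obs_law [simp, measurable_cong]: "sets (obs_law n \<theta>) = sets (sample_space n)"
  by (simp add: obs_law_def)

lemma space_obs_law [simp]: "space (obs_law n \<theta>) = space (sample_space n)"
  by (simp add: obs_law_def)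

lemma prob_space_obs_law: "prob_space (obs_law n \<theta>)"
  unfolding obs_law_def by (intro prob_space.prob_space_distr prob_space_noise measurable_shift)

lemma measurable_obs_law_component:
  "i \<in> {1..n} \<Longrightarrow> (\<lambda>x. x i) \<in> obs_law n \<theta> \<rightarrow>\<^sub>M borel"
  by (subst measurable_cong_sets[OF sets_obs_law refl]) (rule measurable_component_singleton)

lemma measurable_std_gaussian_plus: "(\<lambda>z. c + z) \<in> std_gaussian \<rightarrow>\<^sub>M borel"
  by measurable

lemma distr_obs_law_component:
  assumes "i \<in> {1..n}"
  shows "distr (obs_law n \<theta>) borel (\<lambda>x. x i) = distr std_gaussian borel (\<lambda>z. \<theta> i + z)"
proof -
  have noise_comp: "(\<lambda>\<epsilon>. \<epsilon> i) \<in> noise n \<rightarrow>\<^sub>M std_gaussian"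
    unfolding noise_def using assms by (rule measurable_component_singleton)
  have "distr (obs_law n \<theta>) borel (\<lambda>x. x i)
      = distr (noise n) borel ((\<lambda>x. x i) \<circ> (\<lambda>\<epsilon>. \<lambda>i\<in>{1..n}. \<theta> i + \<epsilon> i))"
    unfolding obs_law_def
    using measurable_component_singleton[OF assms, of "\<lambda>_. borel"] measurable_shift by (rule distr_distr)
  also have "(\<lambda>x. x i) \<circ> (\<lambda>\<epsilon>. \<lambda>i\<in>{1..n}. \<theta> i + \<epsilon> i) = (\<lambda>z. \<theta> i + z) \<circ> (\<lambda>\<epsilon>. \<epsilon> i)"
    using assms by (simp add: fun_eq_iff)
  also have "distr (noise n) borel \<dots> = distr (distr (noise n) std_gaussian (\<lambda>\<epsilon>. \<epsilon> i)) borel (\<lambda>z. \<theta> i + z)"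
    using measurable_std_gaussian_plus noise_comp by (rule distr_distr[symmetric])
  also have "distr (noise n) std_gaussian (\<lambda>\<epsilon>. \<epsilon> i) = std_gaussian"
    unfolding noise_def using prob_space_std_gaussian assms by (rule distr_PiM_component)
  finally show ?thesis .
qed

lemma integral_obs_law_component:
  fixes f :: "real \<Rightarrow> real"
  assumes "i \<in> {1..n}" and f: "f \<in> borel_measurable borel"
  shows "(LINT x|obs_law n \<theta>. f (x i)) = (LINT z|std_gaussian. f (\<theta> i + z))"
  using integral_distr[OF measurable_obs_law_component[OF assms(1)] f, of \<theta>]
    integral_distr[OF measurable_std_gaussian_plus f, of "\<theta> i"]
  by (simp only: distr_obs_law_component[OF assms(1)])

lemma integrable_obs_law_component_iff:
  fixes f :: "real \<Rightarrow> real"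
  assumes "i \<in> {1..n}" and f: "f \<in> borel_measurable borel"
  shows "integrable (obs_law n \<theta>) (\<lambda>x. f (x i)) \<longleftrightarrow> integrable std_gaussian (\<lambda>z. f (\<theta> i + z))"
  using integrable_distr_eq[OF measurable_obs_law_component[OF assms(1)] f, of \<theta>]
    integrable_distr_eq[OF measurable_std_gaussian_plus f, of "\<theta> i"]
  by (simp only: distr_obs_law_component[OF assms(1)])

text \<open>The integrand is a product over all coordinates, with \<open>f\<close> at
  \<open>i\<close>, \<open>g\<close> at \<open>j\<close> and the constant 1 elsewhere, so the
  product formula for the noise measure applies.\<close>

lemma obs_law_pair:
  fixes f g :: "real \<Rightarrow> real"
  assumes "i \<in> {1..n}" "j \<in> {1..n}" "i \<noteq> j"
    and [measurable]: "f \<in> borel_measurable borel" "g \<in> borel_measurable borel"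
    and int: "integrable std_gaussian (\<lambda>z. f (\<theta> i + z))" "integrable std_gaussian (\<lambda>z. g (\<theta> j + z))"
  shows "integrable (obs_law n \<theta>) (\<lambda>x. f (x i) * g (x j))"
    and "(LINT x|obs_law n \<theta>. f (x i) * g (x j))
       = (LINT z|std_gaussian. f (\<theta> i + z)) * (LINT z|std_gaussian. g (\<theta> j + z))"
proof -
  have [measurable]: "(\<lambda>x. x i) \<in> sample_space n \<rightarrow>\<^sub>M borel" "(\<lambda>x. x j) \<in> sample_space n \<rightarrow>\<^sub>M borel"
    by (rule measurable_component_singleton[OF assms(1)], rule measurable_component_singleton[OF assms(2)])
  have fg: "(\<lambda>x. f (x i) * g (x j)) \<in> borel_measurable (sample_space n)"
    by measurable
  define h where "h k z = (if k = i then f (\<theta> i + z) else if k = j then g (\<theta> j + z) else 1)" for k z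
  have h_i: "h i = (\<lambda>z. f (\<theta> i + z))" and h_j: "h j = (\<lambda>z. g (\<theta> j + z))"
    using assms(3) by (simp_all add: h_def fun_eq_iff)
  have h_else: "h k = (\<lambda>_. 1)" if "k \<noteq> i" "k \<noteq> j" for k
    using that by (simp add: h_def fun_eq_iff)
  interpret P: product_sigma_finite "\<lambda>_::nat. std_gaussian"
    by standard
  have h_int: "integrable std_gaussian (h k)" for k
  proof -
    consider "k = i" | "k = j" | "k \<noteq> i" "k \<noteq> j"
      by blast
    then show ?thesis
      using int by cases (simp_all add: h_i h_j h_else)
  qed
  have prod_split: "(\<Prod>k\<in>{1..n}. r k) = r i * r j"
    if "\<And>k. k \<noteq> i \<Longrightarrow> k \<noteq> j \<Longrightarrow> r k = 1" for r :: "nat \<Rightarrow> real"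
  proof -
    have "(\<Prod>k\<in>{1..n}. r k) = (\<Prod>k\<in>{i, j}. r k)"
      by (rule prod.mono_neutral_right) (use assms(1,2) that in auto)
    then show ?thesis
      using assms(3) by simp
  qed
  have h_prod: "(\<Prod>k\<in>{1..n}. h k (\<epsilon> k)) = f (\<theta> i + \<epsilon> i) * g (\<theta> j + \<epsilon> j)" for \<epsilon> :: "nat \<Rightarrow> real"
    using assms(3) by (subst prod_split) (auto simp: h_def)
  have "integrable (noise n) (\<lambda>\<epsilon>. f (\<theta> i + \<epsilon> i) * g (\<theta> j + \<epsilon> j))"
    unfolding noise_def h_prod[symmetric] by (rule P.product_integrable_prod) (auto intro: h_int)
  then show "integrable (obs_law n \<theta>) (\<lambda>x. f (x i) * g (x j))"
    unfolding obs_law_def using assms(1,2)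
    by (simp add: integrable_distr_eq[OF measurable_shift fg])
  have "(LINT x|obs_law n \<theta>. f (x i) * g (x j)) = (LINT \<epsilon>|noise n. f (\<theta> i + \<epsilon> i) * g (\<theta> j + \<epsilon> j))"
    unfolding obs_law_def using assms(1,2)
    by (simp add: integral_distr[OF measurable_shift fg])
  also have "\<dots> = (\<Prod>k\<in>{1..n}. integral\<^sup>L std_gaussian (h k))"
    unfolding noise_def h_prod[symmetric] by (rule P.product_integral_prod) (auto intro: h_int)
  also have "\<dots> = (LINT z|std_gaussian. f (\<theta> i + z)) * (LINT z|std_gaussian. g (\<theta> j + z))"
    unfolding h_i[symmetric] h_j[symmetric]
    by (rule prod_split) (use h_else std_gaussian.prob_space in simp)
  finally show "(LINT x|obs_law n \<theta>. f (x i) * g (x j)) = \<dots>" .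
qed

text \<open>Pairwise independence of the coordinates makes the variance of the sum the sum of the variances.\<close>

lemma obs_law_Chebyshev:
  fixes f :: "nat \<Rightarrow> real \<Rightarrow> real"
  assumes I: "I \<subseteq> {1..n}" and [measurable]: "\<And>i. i \<in> I \<Longrightarrow> f i \<in> borel_measurable borel"
    and bdd: "\<And>i z. i \<in> I \<Longrightarrow> \<bar>f i z\<bar> \<le> B"
    and m: "\<And>i. i \<in> I \<Longrightarrow> (LINT z|std_gaussian. f i (\<theta> i + z)) = \<mu> i"
    and v: "\<And>i. i \<in> I \<Longrightarrow> (LINT z|std_gaussian. (f i (\<theta> i + z))\<^sup>2) \<le> v i"
    and "0 < d"
  shows "measure (obs_law n \<theta>)
           {x\<in>space (sample_space n). d \<le> \<bar>(\<Sum>i\<in>I. f i (x i)) - (\<Sum>i\<in>I. \<mu> i)\<bar>}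
         \<le> (\<Sum>i\<in>I. v i) / d\<^sup>2"
proof -
  interpret prob_space "obs_law n \<theta>"
    by (rule prob_space_obs_law)
  have fin: "finite I"
    using I finite_subset by blast
  have comp [measurable]: "(\<lambda>x. x k) \<in> sample_space n \<rightarrow>\<^sub>M borel" if "k \<in> I" for k
    using that I by (intro measurable_component_singleton) auto
  define g where "g i z = f i z - \<mu> i" for i z
  have g_meas [measurable]: "g i \<in> borel_measurable borel" if "i \<in> I" for i
    using that unfolding g_def by measurable
  have int_bdd: "integrable std_gaussian h"
    if "h \<in> borel_measurable borel" "\<And>z. \<bar>h z\<bar> \<le> C" for h :: "real \<Rightarrow> real" and C
    using that by (intro std_gaussian.integrable_const_bound[of _ C]) (auto cong: measurable_cong_sets)
  have g_bdd: "\<bar>g i z\<bar> \<le> B + \<bar>\<mu> i\<bar>" if "i \<in> I" for i z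
    using bdd[OF that, of z] unfolding g_def by linarith
  have f_int: "integrable std_gaussian (\<lambda>z. f i (\<theta> i + z))" if "i \<in> I" for i
    using that bdd by (intro int_bdd[of _ B]) auto
  have f2_int: "integrable std_gaussian (\<lambda>z. (f i (\<theta> i + z))\<^sup>2)" if "i \<in> I" for i
  proof (rule int_bdd)
    show "\<bar>(f i (\<theta> i + z))\<^sup>2\<bar> \<le> B\<^sup>2" for z
      using power_mono[OF bdd[OF that, of "\<theta> i + z"], of 2] by simp
  qed (use that in auto)
  have g_int: "integrable std_gaussian (\<lambda>z. g i (\<theta> i + z))" if "i \<in> I" for i
    unfolding g_def using f_int[OF that] by simp
  have g_mean: "(LINT z|std_gaussian. g i (\<theta> i + z)) = 0" if "i \<in> I" for i
    unfolding g_def using f_int[OF that] m[OF that] std_gaussian.prob_space by simp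
  have g_var: "(LINT z|std_gaussian. (g i (\<theta> i + z))\<^sup>2) \<le> v i" if "i \<in> I" for i
  proof -
    have "(LINT z|std_gaussian. (g i (\<theta> i + z))\<^sup>2)
        = (LINT z|std_gaussian. (f i (\<theta> i + z))\<^sup>2 - 2 * \<mu> i * f i (\<theta> i + z) + (\<mu> i)\<^sup>2)"
      unfolding g_def by (intro Bochner_Integration.integral_cong) (auto simp: power2_eq_square algebra_simps)
    also have "\<dots> = (LINT z|std_gaussian. (f i (\<theta> i + z))\<^sup>2) - (\<mu> i)\<^sup>2"
      using f_int[OF that] f2_int[OF that] m[OF that] std_gaussian.prob_space
      by (simp add: power2_eq_square)
    also have "\<dots> \<le> v i"
      using v[OF that] by (smt (verit) zero_le_power2)
    finally show ?thesis .
  qed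
  have pair_int: "integrable (obs_law n \<theta>) (\<lambda>x. g i (x i) * g j (x j))" if "i \<in> I" "j \<in> I" for i j
  proof (rule integrable_const_bound)
    show "AE x in obs_law n \<theta>. norm (g i (x i) * g j (x j)) \<le> (B + \<bar>\<mu> i\<bar>) * (B + \<bar>\<mu> j\<bar>)"
      using g_bdd[OF that(1)] g_bdd[OF that(2)] order_trans[OF abs_ge_zero g_bdd[OF that(1)]]
      by (intro AE_I2) (simp add: abs_mult mult_mono)
  qed (use that in measurable)
  have pair_0: "expectation (\<lambda>x. g i (x i) * g j (x j)) = 0" if "i \<in> I" "j \<in> I" "i \<noteq> j" for i j
    using obs_law_pair(2)[OF subsetD[OF I that(1)] subsetD[OF I that(2)] that(3)
        g_meas[OF that(1)] g_meas[OF that(2)] g_int[OF that(1)] g_int[OF that(2)]]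
    by (simp add: g_mean that)
  have sq: "(\<Sum>i\<in>I. g i (x i))\<^sup>2 = (\<Sum>i\<in>I. \<Sum>j\<in>I. g i (x i) * g j (x j))" for x :: "nat \<Rightarrow> real"
    by (simp add: power2_eq_square sum_product)
  have "expectation (\<lambda>x. (\<Sum>i\<in>I. g i (x i))\<^sup>2) = (\<Sum>i\<in>I. \<Sum>j\<in>I. expectation (\<lambda>x. g i (x i) * g j (x j)))"
    unfolding sq using pair_int by (simp add: Bochner_Integration.integral_sum)
  also have "\<dots> = (\<Sum>i\<in>I. expectation (\<lambda>x. (g i (x i))\<^sup>2))"
  proof (rule sum.cong[OF refl])
    fix i assume i: "i \<in> I"
    have "(\<Sum>j\<in>I. expectation (\<lambda>x. g i (x i) * g j (x j))) = (\<Sum>j\<in>{i}. expectation (\<lambda>x. g i (x i) * g j (x j)))"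
      by (rule sum.mono_neutral_right) (use i fin pair_0 in auto)
    then show "(\<Sum>j\<in>I. expectation (\<lambda>x. g i (x i) * g j (x j))) = expectation (\<lambda>x. (g i (x i))\<^sup>2)"
      by (simp add: power2_eq_square)
  qed
  also have "\<dots> \<le> (\<Sum>i\<in>I. v i)"
  proof (rule sum_mono)
    fix i assume i: "i \<in> I"
    then show "expectation (\<lambda>x. (g i (x i))\<^sup>2) \<le> v i"
      using integral_obs_law_component[OF subsetD[OF I i], of "\<lambda>z. (g i z)\<^sup>2" \<theta>] g_var[OF i] by simp
  qed
  finally have E2: "expectation (\<lambda>x. (\<Sum>i\<in>I. g i (x i))\<^sup>2) \<le> (\<Sum>i\<in>I. v i)" .
  have "prob {x\<in>space (obs_law n \<theta>). d \<le> \<bar>\<Sum>i\<in>I. g i (x i)\<bar>} \<le> expectation (\<lambda>x. (\<Sum>i\<in>I. g i (x i))\<^sup>2) / d\<^sup>2"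
  proof (rule second_moment_method)
    show "integrable (obs_law n \<theta>) (\<lambda>x. (\<Sum>i\<in>I. g i (x i))\<^sup>2)"
      unfolding sq using pair_int by (intro Bochner_Integration.integrable_sum)
    show "random_variable borel (\<lambda>x. \<Sum>i\<in>I. g i (x i))"
      by measurable
  qed (rule \<open>0 < d\<close>)
  also have "\<dots> \<le> (\<Sum>i\<in>I. v i) / d\<^sup>2"
    using E2 by (intro divide_right_mono) auto
  finally show ?thesis
    by (simp add: g_def sum_subtractf)
qed

section \<open>Procedures with a concentrated threshold\<close>

abbreviation boundary :: "nat \<Rightarrow> nat \<Rightarrow> real" where
  "boundary n s \<equiv> sqrt (2 * ln (real n / real s))"

lemma boundary_sq:
  assumes "0 < s" "s \<le> n"
  shows "(boundary n s)\<^sup>2 = 2 * ln (real n / real s)"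
  using assms by simp

text \<open>The form in which the boundary enters the estimates: up to the normalising constant, the
  Gaussian density there is \<open>s / n\<close>.\<close>

lemma exp_boundary_sq:
  assumes "0 < s" "s \<le> n"
  shows "exp ((boundary n s)\<^sup>2 / 2) = real n / real s"
  using assms by (simp only: boundary_sq) simp

lemma sparse_regimeD:
  assumes "sparse_regime s"
  shows "filterlim (\<lambda>n. real (s n)) at_top sequentially"
    and "filterlim (\<lambda>n. real n / real (s n)) at_top sequentially"
    and "filterlim (\<lambda>n. boundary n (s n)) at_top sequentially"
    and "eventually (\<lambda>n. 0 < s n \<and> s n \<le> n) sequentially"
proof -
  show s: "filterlim (\<lambda>n. real (s n)) at_top sequentially"
    using assms filterlim_compose[OF filterlim_real_sequentially, of s sequentially]
    by (simp add: sparse_regime_def)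
  show ns: "filterlim (\<lambda>n. real n / real (s n)) at_top sequentially"
    using assms by (simp add: sparse_regime_def)
  have "filterlim (\<lambda>x::real. sqrt (2 * ln x)) at_top at_top"
    by real_asymp
  then show "filterlim (\<lambda>n. boundary n (s n)) at_top sequentially"
    using ns by (rule filterlim_compose)
  have "eventually (\<lambda>n. 0 < real (s n)) sequentially"
    using s by (rule filterlim_at_top_dense[THEN iffD1, rule_format])
  moreover have "eventually (\<lambda>n. 1 < real n / real (s n)) sequentially"
    using ns by (rule filterlim_at_top_dense[THEN iffD1, rule_format])
  ultimately show "eventually (\<lambda>n. 0 < s n \<and> s n \<le> n) sequentially"
    by eventually_elim (auto simp: field_simps)
qed

lemma signal_classD:
  assumes "\<theta> \<in> signal_class n s b"
  shows "card (support n \<theta>) = s" "\<And>i. i \<in> support n \<theta> \<Longrightarrow> boundary n s + b \<le> \<bar>\<theta> i\<bar>"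
  using assms by (auto simp: signal_class_def)

lemma support_subset: "support n \<theta> \<subseteq> {1..n}"
  by (auto simp: support_def)

lemma finite_support [simp]: "finite (support n \<theta>)"
  by (rule finite_subset[OF support_subset]) simp

section \<open>Counting the coordinates beyond a level\<close>

definition hits :: "nat set \<Rightarrow> real \<Rightarrow> (nat \<Rightarrow> real) \<Rightarrow> real" where
  "hits I u x = (\<Sum>i\<in>I. of_bool (u \<le> \<bar>x i\<bar>))"

lemma hits_nonneg [simp]: "0 \<le> hits I u x"
  unfolding hits_def by (intro sum_nonneg) auto

lemma measurable_hits:
  assumes "I \<subseteq> {1..n}"
  shows "hits I u \<in> borel_measurable (sample_space n)"
proof -
  have [measurable]: "(\<lambda>x. x i) \<in> sample_space n \<rightarrow>\<^sub>M borel" if "i \<in> I" for i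
    using that assms by (intro measurable_component_singleton) auto
  show ?thesis
    unfolding hits_def[abs_def] by measurable
qed

lemma sets_hits_ge:
  assumes "I \<subseteq> {1..n}"
  shows "{x\<in>space (sample_space n). c \<le> hits I u x} \<in> sets (sample_space n)"
  using measurable_hits[OF assms, of u, measurable] by measurable

lemma expectation_of_bool_component:
  assumes "i \<in> {1..n}" "A \<in> sets borel"
  shows "(LINT x|obs_law n \<theta>. of_bool (x i \<in> A)) = measure std_gaussian {z. \<theta> i + z \<in> A}"
    and "integrable (obs_law n \<theta>) (\<lambda>x. of_bool (x i \<in> A) :: real)"
proof -
  have shift: "{z. \<theta> i + z \<in> A} \<in> sets borel"
    using assms(2) by measurable
  have ind: "(\<lambda>x. of_bool (x i \<in> A) :: real) = (\<lambda>x. indicator A (x i))" "(\<lambda>z. indicator A (\<theta> i + z) :: real) = indicator {z. \<theta> i + z \<in> A}"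
    for x :: "nat \<Rightarrow> real"
    by (auto simp: indicator_def)
  have meas: "(indicator A :: real \<Rightarrow> real) \<in> borel_measurable borel"
    using assms(2) by measurable
  show "(LINT x|obs_law n \<theta>. of_bool (x i \<in> A)) = measure std_gaussian {z. \<theta> i + z \<in> A}"
    using integral_obs_law_component[OF assms(1) meas, of \<theta>] shift
    by (simp only: ind) simp
  show "integrable (obs_law n \<theta>) (\<lambda>x. of_bool (x i \<in> A) :: real)"
    using integrable_obs_law_component_iff[OF assms(1) meas, of \<theta>] shift
    by (simp only: ind) (simp add: std_gaussian.emeasure_eq_measure)
qed

lemma sets_abs_ge: "{z::real. u \<le> \<bar>z\<bar>} \<in> sets borel"
  by measurable

lemma expectation_hits:
  assumes "I \<subseteq> {1..n}"
  shows "(LINT x|obs_law n \<theta>. hits I u x) = (\<Sum>i\<in>I. measure std_gaussian {z. u \<le> \<bar>\<theta> i + z\<bar>})"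
    and "integrable (obs_law n \<theta>) (hits I u)"
proof -
  have int: "integrable (obs_law n \<theta>) (\<lambda>x. of_bool (u \<le> \<bar>x i\<bar>) :: real)" if "i \<in> I" for i
    using expectation_of_bool_component(2)[OF subsetD[OF assms that] sets_abs_ge] by simp
  show "integrable (obs_law n \<theta>) (hits I u)"
    unfolding hits_def[abs_def] by (intro Bochner_Integration.integrable_sum int)
  have "(LINT x|obs_law n \<theta>. hits I u x) = (\<Sum>i\<in>I. LINT x|obs_law n \<theta>. of_bool (u \<le> \<bar>x i\<bar>))"
    unfolding hits_def by (intro Bochner_Integration.integral_sum int)
  also have "\<dots> = (\<Sum>i\<in>I. measure std_gaussian {z. u \<le> \<bar>\<theta> i + z\<bar>})"
    using expectation_of_bool_component(1)[OF subsetD[OF assms] sets_abs_ge] by (intro sum.cong) auto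
  finally show "(LINT x|obs_law n \<theta>. hits I u x) = \<dots>" .
qed

lemma hits_Chebyshev:
  fixes \<theta> :: "nat \<Rightarrow> real" and u :: real
  assumes "I \<subseteq> {1..n}" "0 < d"
  defines "\<mu> \<equiv> (\<Sum>i\<in>I. measure std_gaussian {z. u \<le> \<bar>\<theta> i + z\<bar>})"
  shows "measure (obs_law n \<theta>) {x\<in>space (sample_space n). d \<le> \<bar>hits I u x - \<mu>\<bar>} \<le> \<mu> / d\<^sup>2"
proof -
  have mean: "(LINT z|std_gaussian. of_bool (u \<le> \<bar>\<theta> i + z\<bar>)) = measure std_gaussian {z. u \<le> \<bar>\<theta> i + z\<bar>}" for i
  proof -
    have "(\<lambda>z. of_bool (u \<le> \<bar>\<theta> i + z\<bar>) :: real) = indicator {z. u \<le> \<bar>\<theta> i + z\<bar>}"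
      by (auto simp: indicator_def)
    then show ?thesis
      by simp
  qed
  have "measure (obs_law n \<theta>) {x\<in>space (sample_space n). d \<le>
      \<bar>(\<Sum>i\<in>I. of_bool (u \<le> \<bar>x i\<bar>)) - (\<Sum>i\<in>I. measure std_gaussian {z. u \<le> \<bar>\<theta> i + z\<bar>})\<bar>}
      \<le> (\<Sum>i\<in>I. measure std_gaussian {z. u \<le> \<bar>\<theta> i + z\<bar>}) / d\<^sup>2"
    by (rule obs_law_Chebyshev[where f = "\<lambda>_ z. of_bool (u \<le> \<bar>z\<bar>)" and B = 1])
      (use assms mean in \<open>auto simp: power2_eq_square simp flip: of_bool_conj\<close>)
  then show ?thesis
    by (simp add: hits_def \<mu>_def)
qed

lemma detection_prob_ge:
  assumes \<theta>: "\<theta> \<in> signal_class n s b" and "B \<le> b" and i: "i \<in> support n \<theta>"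
  shows "gauss_tail (ereal (\<delta> - B)) \<le> measure std_gaussian {z. boundary n s + \<delta> \<le> \<bar>\<theta> i + z\<bar>}"
proof -
  have "gauss_tail (ereal (\<delta> - B)) \<le> gauss_tail (ereal (boundary n s + \<delta> - \<bar>\<theta> i\<bar>))"
    using signal_classD(2)[OF \<theta> i] \<open>B \<le> b\<close> by (intro gauss_tail_antimono) simp
  also have "\<dots> \<le> measure std_gaussian {z. boundary n s + \<delta> \<le> \<bar>\<theta> i + z\<bar>}"
    by (rule gauss_tail_shift_le)
  finally show ?thesis .
qed

text \<open>The number of detections has mean between \<open>\<kappa> * s\<close> and
  \<open>s\<close>, and its variance is at most its mean; Chebyshev with deviation
  \<open>\<kappa> * s / 2\<close> gives the failure probability. Since \<kappa> depends only on
  \<delta> and the lower bound \<open>B\<close>, the estimate is uniform over the class.\<close>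

lemma detections_whp:
  fixes \<delta> B :: real
  defines "\<kappa> \<equiv> gauss_tail (ereal (\<delta> - B))"
  assumes \<theta>: "\<theta> \<in> signal_class n s b" and "B \<le> b" "0 < s"
  shows "1 - 4 / (\<kappa>\<^sup>2 * real s) \<le> measure (obs_law n \<theta>)
           {x\<in>space (sample_space n). \<kappa> * real s / 2 \<le> hits (support n \<theta>) (boundary n s + \<delta>) x}"
    (is "_ \<le> measure _ ?D")
proof -
  interpret prob_space "obs_law n \<theta>"
    by (rule prob_space_obs_law)
  let ?u = "boundary n s + \<delta>" and ?S = "support n \<theta>"
  let ?\<mu> = "\<Sum>i\<in>?S. measure std_gaussian {z. ?u \<le> \<bar>\<theta> i + z\<bar>}"
  let ?d = "\<kappa> * real s / 2"
  have "0 < \<kappa>"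
    unfolding \<kappa>_def by (rule gauss_tail_pos)
  then have d: "0 < ?d"
    using \<open>0 < s\<close> by simp
  have card: "card ?S = s"
    using \<theta> by (rule signal_classD)
  have "(\<Sum>i\<in>?S. \<kappa>) \<le> ?\<mu>"
    unfolding \<kappa>_def by (intro sum_mono detection_prob_ge[OF \<theta> \<open>B \<le> b\<close>])
  then have \<mu>_ge: "\<kappa> * real s \<le> ?\<mu>"
    by (simp add: card mult.commute)
  have "?\<mu> \<le> (\<Sum>i\<in>?S. 1)"
    by (intro sum_mono) simp
  then have \<mu>_le: "?\<mu> \<le> real s"
    by (simp add: card)
  have sD: "?D \<in> events"
    using sets_hits_ge[OF support_subset[of n \<theta>], where c = ?d and u = ?u] by (simp only: sets_obs_law)
  have "1 - prob ?D = prob (space (obs_law n \<theta>) - ?D)"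
    using prob_compl[OF sD] by (rule sym)
  also have "\<dots> \<le> prob {x\<in>space (sample_space n). ?d \<le> \<bar>hits ?S ?u x - ?\<mu>\<bar>}"
  proof (rule finite_measure_mono)
    show "space (obs_law n \<theta>) - ?D \<subseteq> {x\<in>space (sample_space n). ?d \<le> \<bar>hits ?S ?u x - ?\<mu>\<bar>}"
    proof
      fix x assume x: "x \<in> space (obs_law n \<theta>) - ?D"
      then have "hits ?S ?u x < ?d"
        by auto
      then have "?d \<le> \<bar>hits ?S ?u x - ?\<mu>\<bar>"
        using \<mu>_ge by linarith
      then show "x \<in> {x\<in>space (sample_space n). ?d \<le> \<bar>hits ?S ?u x - ?\<mu>\<bar>}"
        using x by simp
    qed
    show "{x\<in>space (sample_space n). ?d \<le> \<bar>hits ?S ?u x - ?\<mu>\<bar>} \<in> events"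
      using measurable_hits[OF support_subset[of n \<theta>], of ?u, measurable] by measurable
  qed
  also have "\<dots> \<le> ?\<mu> / ?d\<^sup>2"
    using hits_Chebyshev[OF support_subset d] .
  also have "\<dots> \<le> real s / ?d\<^sup>2"
    using \<mu>_le by (intro divide_right_mono) auto
  also have "\<dots> = 4 / (\<kappa>\<^sup>2 * real s)"
    using \<open>0 < s\<close> \<open>0 < \<kappa>\<close> by (simp add: power2_eq_square field_simps)
  finally show ?thesis
    by simp
qed


section \<open>Elementary properties of procedures and of their risk\<close>

lemma procedure_values:
  assumes "multiple_testing_procedure n \<phi>" "x \<in> space (sample_space n)" "i \<in> {1..n}"
  shows "\<phi> x i = 0 \<or> \<phi> x i = 1"
proof -
  have "\<phi> x \<in> space (PiM {1..n} (\<lambda>_. count_space {0, 1 :: nat}))"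
    using assms(1,2) unfolding multiple_testing_procedure_def by (rule measurable_space)
  then show ?thesis
    using assms(3) by (auto simp: space_PiM)
qed

lemma measurable_procedure:
  assumes "multiple_testing_procedure n \<phi>" "i \<in> {1..n}"
  shows "(\<lambda>x. real (\<phi> x i)) \<in> borel_measurable (sample_space n)"
proof -
  have "(\<lambda>x. \<phi> x i) \<in> sample_space n \<rightarrow>\<^sub>M count_space {0, 1}"
    using measurable_compose[OF assms(1)[unfolded multiple_testing_procedure_def]
        measurable_component_singleton[OF assms(2)]] .
  then show ?thesis
    by (rule measurable_compose) simp
qed

abbreviation false_discoveries :: "nat \<Rightarrow> (nat \<Rightarrow> real) \<Rightarrow> (nat \<Rightarrow> nat) \<Rightarrow> real" where
  "false_discoveries n \<theta> r \<equiv> (\<Sum>i=1..n. of_bool (\<theta> i = 0) * real (r i))"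

abbreviation misses :: "nat \<Rightarrow> (nat \<Rightarrow> real) \<Rightarrow> (nat \<Rightarrow> nat) \<Rightarrow> real" where
  "misses n \<theta> r \<equiv> (\<Sum>i=1..n. of_bool (\<theta> i \<noteq> 0) * (1 - real (r i)))"

lemma FDP_bounds:
  "0 \<le> false_discoveries n \<theta> r / max 1 (\<Sum>i=1..n. real (r i))"
  "false_discoveries n \<theta> r / max 1 (\<Sum>i=1..n. real (r i)) \<le> 1"
proof -
  have "false_discoveries n \<theta> r \<le> (\<Sum>i=1..n. real (r i))"
    by (intro sum_mono) auto
  then show "false_discoveries n \<theta> r / max 1 (\<Sum>i=1..n. real (r i)) \<le> 1"
    by (intro divide_le_eq_1_pos[THEN iffD2]) linarith+
  show "0 \<le> false_discoveries n \<theta> r / max 1 (\<Sum>i=1..n. real (r i))"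
    by (intro divide_nonneg_nonneg sum_nonneg) auto
qed

lemma misses_eq: "misses n \<theta> r = (\<Sum>i\<in>support n \<theta>. 1 - real (r i))"
proof -
  have "misses n \<theta> r = (\<Sum>i\<in>support n \<theta>. of_bool (\<theta> i \<noteq> 0) * (1 - real (r i)))"
    by (rule sum.mono_neutral_right) (auto simp: support_def)
  also have "\<dots> = (\<Sum>i\<in>support n \<theta>. 1 - real (r i))"
    by (intro sum.cong) (auto simp: support_def)
  finally show ?thesis .
qed

lemma false_discoveries_eq:
  "false_discoveries n \<theta> r = (\<Sum>i\<in>{1..n} - support n \<theta>. real (r i))"
proof -
  have "false_discoveries n \<theta> r = (\<Sum>i\<in>{1..n} - support n \<theta>. of_bool (\<theta> i = 0) * real (r i))"
    by (rule sum.mono_neutral_right) (auto simp: support_def)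
  also have "\<dots> = (\<Sum>i\<in>{1..n} - support n \<theta>. real (r i))"
    by (intro sum.cong) (auto simp: support_def)
  finally show ?thesis .
qed

lemma missing_proportion_bounds:
  assumes "multiple_testing_procedure n \<phi>" "x \<in> space (sample_space n)"
  shows "0 \<le> misses n \<theta> (\<phi> x) / max 1 (real (card (support n \<theta>)))"
    and "misses n \<theta> (\<phi> x) / max 1 (real (card (support n \<theta>))) \<le> 1"
proof -
  have v: "\<phi> x i = 0 \<or> \<phi> x i = 1" if "i \<in> support n \<theta>" for i
    using that support_subset procedure_values[OF assms] by blast
  have "misses n \<theta> (\<phi> x) \<le> (\<Sum>i\<in>support n \<theta>. 1)"
    unfolding misses_eq by (intro sum_mono) simp
  also have "\<dots> = real (card (support n \<theta>))"
    by simp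
  finally show "misses n \<theta> (\<phi> x) / max 1 (real (card (support n \<theta>))) \<le> 1"
    by (intro divide_le_eq_1_pos[THEN iffD2]) linarith+
  have "0 \<le> misses n \<theta> (\<phi> x)"
    unfolding misses_eq using v by (intro sum_nonneg) fastforce
  then show "0 \<le> misses n \<theta> (\<phi> x) / max 1 (real (card (support n \<theta>)))"
    by simp
qed

lemma measurable_risk_terms:
  assumes "multiple_testing_procedure n \<phi>"
  shows "(\<lambda>x. false_discoveries n \<theta> (\<phi> x) / max 1 (\<Sum>i=1..n. real (\<phi> x i))) \<in> borel_measurable (sample_space n)"
    and "(\<lambda>x. misses n \<theta> (\<phi> x) / max 1 (real (card (support n \<theta>)))) \<in> borel_measurable (sample_space n)"
proof -
  note [measurable] = measurable_procedure[OF assms]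
  show "(\<lambda>x. false_discoveries n \<theta> (\<phi> x) / max 1 (\<Sum>i=1..n. real (\<phi> x i))) \<in> borel_measurable (sample_space n)"
    and "(\<lambda>x. misses n \<theta> (\<phi> x) / max 1 (real (card (support n \<theta>)))) \<in> borel_measurable (sample_space n)"
    by measurable
qed

lemma integrable_risk_terms:
  assumes "multiple_testing_procedure n \<phi>"
  shows "integrable (obs_law n \<theta>) (\<lambda>x. false_discoveries n \<theta> (\<phi> x) / max 1 (\<Sum>i=1..n. real (\<phi> x i)))"
    and "integrable (obs_law n \<theta>) (\<lambda>x. misses n \<theta> (\<phi> x) / max 1 (real (card (support n \<theta>))))"
proof -
  interpret prob_space "obs_law n \<theta>"
    by (rule prob_space_obs_law)
  note m = measurable_risk_terms[OF assms, of \<theta>]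
  show "integrable (obs_law n \<theta>) (\<lambda>x. false_discoveries n \<theta> (\<phi> x) / max 1 (\<Sum>i=1..n. real (\<phi> x i)))"
    using FDP_bounds[where n = n and \<theta> = \<theta>] m(1)
    by (intro integrable_const_bound[of _ 1] AE_I2)
      (simp_all only: measurable_cong_sets[OF sets_obs_law refl] real_norm_def abs_of_nonneg)
  show "integrable (obs_law n \<theta>) (\<lambda>x. misses n \<theta> (\<phi> x) / max 1 (real (card (support n \<theta>))))"
    using missing_proportion_bounds[OF assms, of _ \<theta>] m(2)
    by (intro integrable_const_bound[of _ 1] AE_I2)
      (simp_all only: measurable_cong_sets[OF sets_obs_law refl] real_norm_def abs_of_nonneg space_obs_law)
qed

lemma risk_bounds:
  assumes "multiple_testing_procedure n \<phi>"
  shows "0 \<le> FDR n \<theta> \<phi>" "FDR n \<theta> \<phi> \<le> 1" "0 \<le> FNR n \<theta> \<phi>" "FNR n \<theta> \<phi> \<le> 1"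
proof -
  interpret prob_space "obs_law n \<theta>"
    by (rule prob_space_obs_law)
  note i = integrable_risk_terms[OF assms, of \<theta>]
  show "0 \<le> FDR n \<theta> \<phi>"
    unfolding FDR_def by (intro integral_nonneg_AE AE_I2 FDP_bounds)
  show "0 \<le> FNR n \<theta> \<phi>"
    unfolding FNR_def by (intro integral_nonneg_AE AE_I2 missing_proportion_bounds[OF assms]) simp
  show "FDR n \<theta> \<phi> \<le> 1"
    unfolding FDR_def by (intro integral_le_const AE_I2 FDP_bounds i)
  show "FNR n \<theta> \<phi> \<le> 1"
    unfolding FNR_def by (intro integral_le_const AE_I2 missing_proportion_bounds[OF assms] i) simp
qed

lemma measure_abs_less_compl:
  "measure std_gaussian {z. \<bar>\<theta> + z\<bar> < u} = 1 - measure std_gaussian {z. u \<le> \<bar>\<theta> + z\<bar>}"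
proof -
  have "{z. \<bar>\<theta> + z\<bar> < u} = UNIV - {z. u \<le> \<bar>\<theta> + z\<bar>}"
    by auto
  moreover have "{z::real. u \<le> \<bar>\<theta> + z\<bar>} \<in> sets borel"
    by measurable
  ultimately show ?thesis
    using std_gaussian.prob_compl[of "{z. u \<le> \<bar>\<theta> + z\<bar>}"] by simp
qed

text \<open>
  \<^term>\<open>A\<close> is an event on which the random rejection threshold lies between \<^term>\<open>u\<close> and
  \<^term>\<open>v\<close>.
\<close>

definition threshold_event ::
    "nat \<Rightarrow> testing_procedure \<Rightarrow> real \<Rightarrow> real \<Rightarrow> (nat \<Rightarrow> real) set \<Rightarrow> bool" where
  "threshold_event n \<phi> u v A \<longleftrightarrow> A \<in> sets (sample_space n) \<and>
     (\<forall>x\<in>A. \<forall>i\<in>{1..n}. (v \<le> \<bar>x i\<bar> \<longrightarrow> \<phi> x i = 1) \<and> (\<phi> x i = 1 \<longrightarrow> u \<le> \<bar>x i\<bar>))"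

text \<open>On \<open>A\<close> every signal beyond the upper threshold is rejected, so the missed
  proportion is at most one minus the detected proportion; off \<open>A\<close> it is bounded by 1.
  In expectation this is \<eta> plus the miss probability of a single signal of least size.\<close>

lemma FNR_le:
  assumes \<phi>: "multiple_testing_procedure n \<phi>" and \<theta>: "\<theta> \<in> signal_class n s b" and "0 < s"
    and A: "threshold_event n \<phi> u (boundary n s + \<delta>) A" "1 - \<eta> \<le> measure (obs_law n \<theta>) A"
  shows "FNR n \<theta> \<phi> \<le> gauss_tail (ereal (b - \<delta>)) + \<eta>"
proof -
  interpret prob_space "obs_law n \<theta>"
    by (rule prob_space_obs_law)
  let ?S = "support n \<theta>" and ?v = "boundary n s + \<delta>"
  have sA: "A \<in> events"
    using A(1) by (simp add: threshold_event_def)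
  have card: "card ?S = s"
    using \<theta> by (rule signal_classD)
  have hits_le: "hits ?S ?v x \<le> real s" for x
    using sum_mono[of ?S "\<lambda>i. of_bool (?v \<le> \<bar>x i\<bar>)" "\<lambda>_. 1::real"] by (simp add: hits_def card)
  have int: "integrable (obs_law n \<theta>) (\<lambda>x. indicator (space (obs_law n \<theta>) - A) x + (1 - hits ?S ?v x / real s))"
    using sA expectation_hits(2)[OF support_subset, where u = ?v and \<theta> = \<theta>] by (auto simp: emeasure_eq_measure less_top[symmetric])
  have "FNR n \<theta> \<phi> \<le> expectation (\<lambda>x. indicator (space (obs_law n \<theta>) - A) x + (1 - hits ?S ?v x / real s))"
    unfolding FNR_def
  proof (rule integral_mono[OF integrable_risk_terms(2)[OF \<phi>] int])
    fix x assume x: "x \<in> space (obs_law n \<theta>)"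
    show "misses n \<theta> (\<phi> x) / max 1 (real (card ?S))
        \<le> indicator (space (obs_law n \<theta>) - A) x + (1 - hits ?S ?v x / real s)"
    proof (cases "x \<in> A")
      case True
      have "hits ?S ?v x \<le> (\<Sum>i\<in>?S. real (\<phi> x i))"
        unfolding hits_def
      proof (rule sum_mono)
        fix i assume "i \<in> ?S"
        then have "i \<in> {1..n}"
          using support_subset by blast
        then show "of_bool (?v \<le> \<bar>x i\<bar>) \<le> real (\<phi> x i)"
          using A(1) True by (auto simp: threshold_event_def of_bool_def)
      qed
      then have "misses n \<theta> (\<phi> x) \<le> real s - hits ?S ?v x"
        by (simp add: misses_eq sum_subtractf card)
      then have "misses n \<theta> (\<phi> x) / real s \<le> (real s - hits ?S ?v x) / real s"
        by (intro divide_right_mono) auto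
      also have "\<dots> = 1 - hits ?S ?v x / real s"
        using \<open>0 < s\<close> by (simp add: diff_divide_distrib)
      finally show ?thesis
        using True \<open>0 < s\<close> by (simp add: card max_def)
    next
      case False
      have "hits ?S ?v x / real s \<le> 1"
        using hits_le[of x] \<open>0 < s\<close> by simp
      moreover have "indicator (space (obs_law n \<theta>) - A) x = (1 :: real)"
        using False x by simp
      moreover have "misses n \<theta> (\<phi> x) / max 1 (real (card ?S)) \<le> 1"
        using missing_proportion_bounds(2)[OF \<phi>] x by simp
      ultimately show ?thesis
        by linarith
    qed
  qed
  also have "\<dots> = prob (space (obs_law n \<theta>) - A) + (1 - expectation (hits ?S ?v) / real s)"
    using sA expectation_hits(2)[OF support_subset, where u = ?v and \<theta> = \<theta>] prob_space
    by (simp add: emeasure_eq_measure less_top[symmetric])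
  also have "prob (space (obs_law n \<theta>) - A) \<le> \<eta>"
    using prob_compl[OF sA] A(2) by simp
  also have "1 - expectation (hits ?S ?v) / real s \<le> gauss_tail (ereal (b - \<delta>))"
  proof -
    have "(\<Sum>i\<in>?S. gauss_tail (ereal (\<delta> - b))) \<le> expectation (hits ?S ?v)"
      unfolding expectation_hits(1)[OF support_subset]
      by (intro sum_mono detection_prob_ge[OF \<theta>]) auto
    then have "gauss_tail (ereal (\<delta> - b)) \<le> expectation (hits ?S ?v) / real s"
      using \<open>0 < s\<close> by (simp add: card field_simps)
    then show ?thesis
      using gauss_tail_uminus[of "\<delta> - b"] by simp
  qed
  finally show ?thesis
    by simp
qed

text \<open>On \<open>A\<close> and on the detection event \<open>D\<close> at least
  \<open>\<kappa> * s / 2\<close> rejections are made, which bounds the denominator from below,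
  while the false discoveries are nulls beyond \<open>u\<close>, at most
  \<open>2 * \<eta> * s\<close> in expectation. The complements of \<open>A\<close> and
  \<open>D\<close> cost at most \<eta> and \<open>4 / (\<kappa>\<^sup>2 * s)\<close>.\<close>

lemma FDR_le:
  fixes B \<delta> :: real
  defines "\<kappa> \<equiv> gauss_tail (ereal (\<delta> - B))"
  assumes \<phi>: "multiple_testing_procedure n \<phi>" and \<theta>: "\<theta> \<in> signal_class n s b" and "0 < s" "B \<le> b"
    and A: "threshold_event n \<phi> u (boundary n s + \<delta>) A" "1 - \<eta> \<le> measure (obs_law n \<theta>) A"
    and u: "real n * gauss_tail (ereal u) \<le> \<eta> * real s"
  shows "FDR n \<theta> \<phi> \<le> \<eta> + 4 / (\<kappa>\<^sup>2 * real s) + 4 * \<eta> / \<kappa>"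
proof -
  interpret prob_space "obs_law n \<theta>"
    by (rule prob_space_obs_law)
  let ?S = "support n \<theta>" and ?v = "boundary n s + \<delta>" and ?\<Omega> = "space (obs_law n \<theta>)"
  let ?N = "{1..n} - ?S"
  define D where "D = {x\<in>space (sample_space n). \<kappa> * real s / 2 \<le> hits ?S ?v x}"
  have "0 < \<kappa>"
    unfolding \<kappa>_def by (rule gauss_tail_pos)
  then have pos: "0 < \<kappa> * real s / 2"
    using \<open>0 < s\<close> by simp
  have sA: "A \<in> events"
    using A(1) by (simp add: threshold_event_def)
  have sD: "D \<in> events"
    unfolding D_def using sets_hits_ge[OF support_subset[of n \<theta>], where c = "\<kappa> * real s / 2" and u = ?v]
    by (simp only: sets_obs_law)
  have N: "?N \<subseteq> {1..n}"
    by auto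
  let ?f = "\<lambda>x. indicator (?\<Omega> - A) x + indicator (?\<Omega> - D) x + 2 / (\<kappa> * real s) * hits ?N u x"
  have int: "integrable (obs_law n \<theta>) ?f"
    using sA sD expectation_hits(2)[OF N, where u = u and \<theta> = \<theta>]
    by (intro Bochner_Integration.integrable_add integrable_mult_right) (auto simp: emeasure_eq_measure less_top[symmetric])
  have "FDR n \<theta> \<phi> \<le> expectation ?f"
    unfolding FDR_def
  proof (rule integral_mono[OF integrable_risk_terms(1)[OF \<phi>] int])
    fix x assume x: "x \<in> ?\<Omega>"
    let ?R = "\<Sum>i=1..n. real (\<phi> x i)"
    show "false_discoveries n \<theta> (\<phi> x) / max 1 ?R \<le> ?f x"
    proof (cases "x \<in> A \<and> x \<in> D")
      case True
      have V: "false_discoveries n \<theta> (\<phi> x) \<le> hits ?N u x"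
        unfolding false_discoveries_eq hits_def
      proof (rule sum_mono)
        fix i assume "i \<in> ?N"
        then show "real (\<phi> x i) \<le> of_bool (u \<le> \<bar>x i\<bar>)"
          using A(1) True procedure_values[OF \<phi>, of x i] x by (auto simp: threshold_event_def)
      qed
      have "hits ?S ?v x \<le> (\<Sum>i\<in>?S. real (\<phi> x i))"
        unfolding hits_def
      proof (rule sum_mono)
        fix i assume "i \<in> ?S"
        then have "i \<in> {1..n}"
          using support_subset by blast
        then show "of_bool (?v \<le> \<bar>x i\<bar>) \<le> real (\<phi> x i)"
          using A(1) True by (auto simp: threshold_event_def of_bool_def)
      qed
      also have "\<dots> \<le> ?R"
        by (rule sum_mono2) (use support_subset in auto)
      finally have "\<kappa> * real s / 2 \<le> max 1 ?R"
        using True by (auto simp: D_def)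
      then have "false_discoveries n \<theta> (\<phi> x) / max 1 ?R \<le> hits ?N u x / (\<kappa> * real s / 2)"
        using V pos by (intro frac_le) auto
      moreover have "hits ?N u x / (\<kappa> * real s / 2) = 2 / (\<kappa> * real s) * hits ?N u x"
        by simp
      moreover have "0 \<le> indicator (?\<Omega> - A) x + (indicator (?\<Omega> - D) x :: real)"
        by simp
      ultimately show ?thesis
        by linarith
    next
      case False
      then have "1 \<le> indicator (?\<Omega> - A) x + (indicator (?\<Omega> - D) x :: real)"
        using x by (auto simp: indicator_def)
      moreover have "0 \<le> 2 / (\<kappa> * real s) * hits ?N u x"
        using \<open>0 < \<kappa>\<close> by simp
      ultimately show ?thesis
        using FDP_bounds(2)[where n = n and \<theta> = \<theta> and r = "\<phi> x"] by linarith
    qed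
  qed
  also have "\<dots> = prob (?\<Omega> - A) + prob (?\<Omega> - D) + 2 / (\<kappa> * real s) * expectation (hits ?N u)"
    using sA sD expectation_hits(2)[OF N, where u = u and \<theta> = \<theta>]
    by (simp add: emeasure_eq_measure less_top[symmetric])
  also have "prob (?\<Omega> - A) \<le> \<eta>"
    using prob_compl[OF sA] A(2) by simp
  also have "prob (?\<Omega> - D) \<le> 4 / (\<kappa>\<^sup>2 * real s)"
    using prob_compl[OF sD] detections_whp[OF \<theta> \<open>B \<le> b\<close> \<open>0 < s\<close>, of \<delta>] by (simp add: D_def \<kappa>_def)
  also have "2 / (\<kappa> * real s) * expectation (hits ?N u) \<le> 2 / (\<kappa> * real s) * (2 * \<eta> * real s)"
  proof (rule mult_left_mono)
    have "expectation (hits ?N u) \<le> (\<Sum>i\<in>?N. 2 * gauss_tail (ereal u))"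
      unfolding expectation_hits(1)[OF N]
    proof (rule sum_mono)
      fix i assume "i \<in> ?N"
      then have "\<theta> i = 0"
        by (auto simp: support_def)
      then show "measure std_gaussian {z. u \<le> \<bar>\<theta> i + z\<bar>} \<le> 2 * gauss_tail (ereal u)"
        using gauss_tail_two_sided[of u] by simp
    qed
    also have "\<dots> \<le> real n * (2 * gauss_tail (ereal u))"
      using card_mono[OF _ N] by (simp add: mult_right_mono)
    finally show "expectation (hits ?N u) \<le> 2 * \<eta> * real s"
      using u by simp
  qed (use \<open>0 < \<kappa>\<close> in simp)
  also have "2 / (\<kappa> * real s) * (2 * \<eta> * real s) = 4 * \<eta> / \<kappa>"
    using \<open>0 < s\<close> by (simp add: field_simps)
  finally show ?thesis
    by simp
qed

text \<open>Counterpart of \<open>FNR_le\<close>: on \<open>A\<close> nothing below \<open>u\<close>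
  is rejected, and off \<open>A\<close> the missed proportion is bounded below by 0.\<close>

lemma FNR_ge:
  assumes \<phi>: "multiple_testing_procedure n \<phi>" and \<theta>: "\<theta> \<in> signal_class n s b" and "0 < s"
    and A: "threshold_event n \<phi> u v A" "1 - \<eta> \<le> measure (obs_law n \<theta>) A"
    and p: "\<And>i. i \<in> support n \<theta> \<Longrightarrow> p \<le> measure std_gaussian {z. \<bar>\<theta> i + z\<bar> < u}"
  shows "p - \<eta> \<le> FNR n \<theta> \<phi>"
proof -
  interpret prob_space "obs_law n \<theta>"
    by (rule prob_space_obs_law)
  let ?S = "support n \<theta>"
  have sA: "A \<in> events"
    using A(1) by (simp add: threshold_event_def)
  have card: "card ?S = s"
    using \<theta> by (rule signal_classD)
  let ?f = "\<lambda>x. 1 - hits ?S u x / real s - indicator (space (obs_law n \<theta>) - A) x"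
  have int: "integrable (obs_law n \<theta>) ?f"
    using sA expectation_hits(2)[OF support_subset, where u = u and \<theta> = \<theta>] by (auto simp: emeasure_eq_measure less_top[symmetric])
  have "(\<Sum>i\<in>?S. p) \<le> (\<Sum>i\<in>?S. measure std_gaussian {z. \<bar>\<theta> i + z\<bar> < u})"
    by (intro sum_mono p)
  also have "\<dots> = real s - expectation (hits ?S u)"
    by (simp add: measure_abs_less_compl sum_subtractf card expectation_hits(1)[OF support_subset])
  finally have "p \<le> 1 - expectation (hits ?S u) / real s"
    using \<open>0 < s\<close> by (simp add: card field_simps)
  then have "p - \<eta> \<le> 1 - expectation (hits ?S u) / real s - prob (space (obs_law n \<theta>) - A)"
    using prob_compl[OF sA] A(2) by simp
  also have "\<dots> = expectation ?f"
    using sA expectation_hits(2)[OF support_subset, where u = u and \<theta> = \<theta>] prob_space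
    by (simp add: emeasure_eq_measure less_top[symmetric])
  also have "\<dots> \<le> FNR n \<theta> \<phi>"
    unfolding FNR_def
  proof (rule integral_mono[OF int integrable_risk_terms(2)[OF \<phi>]])
    fix x assume x: "x \<in> space (obs_law n \<theta>)"
    show "?f x \<le> misses n \<theta> (\<phi> x) / max 1 (real (card ?S))"
    proof (cases "x \<in> A")
      case True
      have "(\<Sum>i\<in>?S. real (\<phi> x i)) \<le> hits ?S u x"
        unfolding hits_def
      proof (rule sum_mono)
        fix i assume "i \<in> ?S"
        then have "i \<in> {1..n}"
          using support_subset by blast
        then show "real (\<phi> x i) \<le> of_bool (u \<le> \<bar>x i\<bar>)"
          using A(1) True procedure_values[OF \<phi>, of x i] x by (auto simp: threshold_event_def)
      qed
      then have "real s - hits ?S u x \<le> misses n \<theta> (\<phi> x)"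
        by (simp add: misses_eq sum_subtractf card)
      then have "(real s - hits ?S u x) / real s \<le> misses n \<theta> (\<phi> x) / real s"
        by (intro divide_right_mono) auto
      moreover have "(real s - hits ?S u x) / real s = 1 - hits ?S u x / real s"
        using \<open>0 < s\<close> by (simp add: diff_divide_distrib)
      ultimately show ?thesis
        using True \<open>0 < s\<close> by (simp add: card max_def)
    next
      case False
      have "0 \<le> hits ?S u x / real s"
        by simp
      moreover have "0 \<le> misses n \<theta> (\<phi> x) / max 1 (real (card ?S))"
        using missing_proportion_bounds(1)[OF \<phi>] x by simp
      moreover have "indicator (space (obs_law n \<theta>) - A) x = (1 :: real)"
        using False x by simp
      ultimately show ?thesis
        by linarith
    qed
  qed
  finally show ?thesis .
qed


section \<open>Least favourable signals and the position of the lower threshold\<close>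

lemma ex_least_favourable:
  assumes "0 < s" "s \<le> n" "0 < boundary n s + b"
  shows "\<exists>\<theta>\<in>signal_class n s b. \<forall>i\<in>support n \<theta>. \<theta> i = boundary n s + b"
proof -
  define \<theta> where "\<theta> = (\<lambda>i\<in>{1..n}. if i \<le> s then boundary n s + b else 0)"
  have "support n \<theta> = {1..s}"
    using assms by (auto simp: support_def \<theta>_def)
  then have "\<theta> \<in> signal_class n s b" "\<forall>i\<in>support n \<theta>. \<theta> i = boundary n s + b"
    using assms by (auto simp: signal_class_def space_PiM \<theta>_def)
  then show ?thesis
    by blast
qed

text \<open>A signal is missed when the noise is below \<open>- (b + \<delta>)\<close>, unless the
  noise is so negative that the observation passes \<open>- u\<close>. The subtracted tail accounts
  for this second event and vanishes as the boundary grows.\<close>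

lemma least_favourable_miss_prob:
  assumes "boundary n s - \<delta> \<le> u"
  shows "gauss_tail (ereal (b + \<delta>)) - gauss_tail (ereal (2 * boundary n s - \<delta> + b))
      \<le> measure std_gaussian {z. \<bar>boundary n s + b + z\<bar> < u}"
proof -
  let ?a = "boundary n s"
  have "{z. \<bar>?a + b + z\<bar> < u} \<in> sets borel"
    by measurable
  then have "measure std_gaussian {..<- (b + \<delta>)}
      \<le> measure std_gaussian ({z. \<bar>?a + b + z\<bar> < u} \<union> {..- (2 * ?a - \<delta> + b)})"
    using assms by (intro std_gaussian.finite_measure_mono) auto
  also have "\<dots> \<le> measure std_gaussian {z. \<bar>?a + b + z\<bar> < u} + measure std_gaussian {..- (2 * ?a - \<delta> + b)}"
    using \<open>{z. _} \<in> sets borel\<close> by (intro measure_Un_le) auto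
  finally show ?thesis
    by (simp only: gauss_tail_atMost[symmetric] gauss_tail_lessThan[symmetric])
qed

text \<open>
  The number of null coordinates beyond \<^term>\<open>boundary n s - \<delta>\<close> is of larger order than
  \<^term>\<open>s\<close>, so a threshold with few false discoveries cannot lie below it.
\<close>

lemma eventually_threshold_ge:
  assumes s: "sparse_regime s" and "0 < \<delta>"
  shows "eventually (\<lambda>n. \<forall>u. real n * gauss_tail (ereal u) \<le> \<eta> * real (s n) \<longrightarrow>
           boundary n (s n) - \<delta> \<le> u) sequentially"
proof -
  \<comment> \<open>This function is \<open>n / s\<close> times the bound of
    \<open>gauss_tail_ge\<close> at \<open>a - \<delta>\<close> with
    \<open>h = \<delta> / 2\<close>, after completing the square. One half of \<delta> is spent on
    the interval, the other survives in the exponent and beats the constant \<eta>.\<close>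
  have "filterlim (\<lambda>a. \<delta> / 2 / sqrt (2 * pi) * exp (a * \<delta> / 2 - \<delta>\<^sup>2 / 8)) at_top at_top"
    using \<open>0 < \<delta>\<close> by real_asymp
  then have "filterlim (\<lambda>n. \<delta> / 2 / sqrt (2 * pi) * exp (boundary n (s n) * \<delta> / 2 - \<delta>\<^sup>2 / 8)) at_top sequentially"
    using sparse_regimeD(3)[OF s] by (rule filterlim_compose)
  then have "eventually (\<lambda>n. \<eta> < \<delta> / 2 / sqrt (2 * pi) * exp (boundary n (s n) * \<delta> / 2 - \<delta>\<^sup>2 / 8)) sequentially"
    by (rule filterlim_at_top_dense[THEN iffD1, rule_format])
  moreover have "eventually (\<lambda>n. \<delta> < boundary n (s n)) sequentially"
    using sparse_regimeD(3)[OF s] by (rule filterlim_at_top_dense[THEN iffD1, rule_format])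
  ultimately show ?thesis
    using sparse_regimeD(4)[OF s]
  proof eventually_elim
    case (elim n)
    let ?a = "boundary n (s n)"
    show ?case
    proof (intro allI impI, rule ccontr)
      fix u assume u: "real n * gauss_tail (ereal u) \<le> \<eta> * real (s n)" and "\<not> ?a - \<delta> \<le> u"
      have "\<eta> * real (s n) < \<delta> / 2 / sqrt (2 * pi) * exp (?a * \<delta> / 2 - \<delta>\<^sup>2 / 8) * real (s n)"
        using elim by (intro mult_strict_right_mono) auto
      also have "\<dots> = real n * (std_normal_density (?a - \<delta> + \<delta> / 2) * (\<delta> / 2))"
      proof -
        have "- (x - \<delta> + \<delta> / 2)\<^sup>2 / 2 = x * \<delta> / 2 - \<delta>\<^sup>2 / 8 - x\<^sup>2 / 2" for x :: real
          by (simp add: power2_eq_square field_simps)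
        then have "exp (- (?a - \<delta> + \<delta> / 2)\<^sup>2 / 2) = exp (?a * \<delta> / 2 - \<delta>\<^sup>2 / 8) / exp (?a\<^sup>2 / 2)"
          by (simp only: exp_diff)
        also have "\<dots> = exp (?a * \<delta> / 2 - \<delta>\<^sup>2 / 8) * (real (s n) / real n)"
          using elim by (subst exp_boundary_sq) auto
        finally show ?thesis
          using elim unfolding std_normal_density_def by (simp add: mult_ac)
      qed
      also have "\<dots> \<le> real n * gauss_tail (ereal (?a - \<delta>))"
        using elim \<open>0 < \<delta>\<close> by (intro mult_left_mono gauss_tail_ge) auto
      also have "\<dots> \<le> real n * gauss_tail (ereal u)"
        using \<open>\<not> ?a - \<delta> \<le> u\<close> by (intro mult_left_mono gauss_tail_antimono) auto
      finally show False
        using u by simp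
    qed
  qed
qed

text \<open>The order of quantifiers gives the uniformity: \<open>u\<close> is deterministic and
  common to the whole class, and only the event \<open>A\<close> may depend on \<theta>. The same
  \<eta> bounds the null exceedances relative to \<open>s\<close> and the failure probability; it is
  independent of \<delta>, so it can be chosen small compared with the detection rate that \<delta>
  determines.\<close>

definition concentrated_thresholds :: "(nat \<Rightarrow> testing_procedure) \<Rightarrow> (nat \<Rightarrow> nat) \<Rightarrow> (nat \<Rightarrow> real) \<Rightarrow> bool" where
  "concentrated_thresholds \<phi> s b \<longleftrightarrow> (\<forall>\<delta>>0. \<forall>\<eta>>0. eventually (\<lambda>n.
     \<exists>u. real n * gauss_tail (ereal u) \<le> \<eta> * real (s n) \<and>
       (\<forall>\<theta>\<in>signal_class n (s n) (b n). \<exists>A.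
          threshold_event n (\<phi> n) u (boundary n (s n) + \<delta>) A \<and> 1 - \<eta> \<le> measure (obs_law n \<theta>) A)) sequentially)"

text \<open>The common consequence of the two regimes on which the estimates rest; the lower bound
  fixes a positive detection rate.\<close>

lemma boundary_regime_bounded_below:
  assumes "boundary_regime b"
  obtains B where "eventually (\<lambda>n. B \<le> b n) sequentially"
  using assms unfolding boundary_regime_def filterlim_at_top
  by (metis (no_types, lifting) always_eventually order_refl)

lemma concentrated_thresholds_risk_le:
  assumes \<phi>: "\<And>n. multiple_testing_procedure n (\<phi> n)" and s: "sparse_regime s"
    and B: "eventually (\<lambda>n. B \<le> b n) sequentially"
    and conc: "concentrated_thresholds \<phi> s b" and "0 < e"
  shows "eventually (\<lambda>n. \<forall>\<theta>\<in>signal_class n (s n) (b n).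
           risk n \<theta> (\<phi> n) \<le> gauss_tail (ereal (b n)) + e) sequentially"
proof -
  \<comment> \<open>Budget: FNR exceeds the target by at most \<open>\<delta> + \<eta>\<close>, and
    FDR is at most \<open>\<eta> + e / 4 + 4 * \<eta> / \<kappa>\<close> once \<open>s\<close> is
    large. As \<open>\<kappa> \<le> 1\<close>, these add up to at most 11/16 of
    \<open>e\<close>.\<close>
  define \<delta> where "\<delta> = e / 4"
  define \<kappa> where "\<kappa> = gauss_tail (ereal (\<delta> - B))"
  define \<eta> where "\<eta> = \<kappa> * e / 32"
  have \<kappa>: "0 < \<kappa>" "\<kappa> \<le> 1"
    by (simp_all add: \<kappa>_def gauss_tail_pos)
  have pos: "0 < \<delta>" "0 < \<eta>"
    using \<open>0 < e\<close> \<kappa> by (simp_all add: \<delta>_def \<eta>_def)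
  have "eventually (\<lambda>n. 16 / (\<kappa>\<^sup>2 * e) < real (s n)) sequentially"
    using sparse_regimeD(1)[OF s] by (rule filterlim_at_top_dense[THEN iffD1, rule_format])
  then show ?thesis
    using conc[unfolded concentrated_thresholds_def, rule_format, OF pos] sparse_regimeD(4)[OF s] B
  proof eventually_elim
    case (elim n)
    then obtain u where u: "real n * gauss_tail (ereal u) \<le> \<eta> * real (s n)"
      and ex: "\<And>\<theta>. \<theta> \<in> signal_class n (s n) (b n) \<Longrightarrow> \<exists>A.
          threshold_event n (\<phi> n) u (boundary n (s n) + \<delta>) A \<and> 1 - \<eta> \<le> measure (obs_law n \<theta>) A"
      by blast
    show ?case
    proof
      fix \<theta> assume \<theta>: "\<theta> \<in> signal_class n (s n) (b n)"
      from ex[OF \<theta>] obtain A where A: "threshold_event n (\<phi> n) u (boundary n (s n) + \<delta>) A"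
          "1 - \<eta> \<le> measure (obs_law n \<theta>) A"
        by blast
      have sn: "0 < s n"
        using elim by simp
      have "FNR n \<theta> (\<phi> n) \<le> gauss_tail (ereal (b n - \<delta>)) + \<eta>"
        by (rule FNR_le[OF \<phi> \<theta> sn A])
      moreover have "gauss_tail (ereal (b n - \<delta>)) \<le> gauss_tail (ereal (b n)) + \<delta>"
        using gauss_tail_diff_le[of "b n - \<delta>" "b n"] pos by simp
      moreover have "FDR n \<theta> (\<phi> n) \<le> \<eta> + 4 / (\<kappa>\<^sup>2 * real (s n)) + 4 * \<eta> / \<kappa>"
        unfolding \<kappa>_def by (rule FDR_le[OF \<phi> \<theta> sn _ A u]) (use elim in simp)
      moreover have "4 / (\<kappa>\<^sup>2 * real (s n)) \<le> e / 4"
        using elim \<open>0 < e\<close> \<kappa> by (simp add: field_simps)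
      moreover have "4 * \<eta> / \<kappa> = e / 8"
        using \<kappa> by (simp add: \<eta>_def)
      moreover have "\<eta> \<le> e / 32"
        using \<kappa> \<open>0 < e\<close> by (simp add: \<eta>_def)
      ultimately show "risk n \<theta> (\<phi> n) \<le> gauss_tail (ereal (b n)) + e"
        using \<open>0 < e\<close> unfolding risk_def \<delta>_def by linarith
    qed
  qed
qed

lemma concentrated_thresholds_risk_ge:
  assumes \<phi>: "\<And>n. multiple_testing_procedure n (\<phi> n)" and s: "sparse_regime s"
    and b: "boundary_regime b"
    and conc: "concentrated_thresholds \<phi> s b" and "0 < e"
  shows "eventually (\<lambda>n. \<exists>\<theta>\<in>signal_class n (s n) (b n).
           gauss_tail (ereal (b n)) - e \<le> risk n \<theta> (\<phi> n)) sequentially"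
proof -
  obtain B where B: "eventually (\<lambda>n. B \<le> b n) sequentially"
    using boundary_regime_bounded_below[OF b] .
  \<comment> \<open>Here \<delta> serves as shift and as error probability. Three losses of at most
    \<delta> occur: shifting the tail, the far tail of \<open>least_favourable_miss_prob\<close>,
    and the failure of \<open>A\<close>.\<close>
  define \<delta> where "\<delta> = e / 4"
  have pos: "0 < \<delta>"
    using \<open>0 < e\<close> by (simp add: \<delta>_def)
  have "((\<lambda>x. gauss_tail (ereal (2 * x - \<delta> + B))) \<longlongrightarrow> 0) at_top"
    by (rule filterlim_compose[OF gauss_tail_at_top]) real_asymp
  then have "(\<lambda>n. gauss_tail (ereal (2 * boundary n (s n) - \<delta> + B))) \<longlonglongrightarrow> 0"
    using sparse_regimeD(3)[OF s] by (rule filterlim_compose)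
  then have "eventually (\<lambda>n. gauss_tail (ereal (2 * boundary n (s n) - \<delta> + B)) < \<delta>) sequentially"
    using pos by (rule order_tendstoD)
  moreover have "eventually (\<lambda>n. - B < boundary n (s n)) sequentially"
    using sparse_regimeD(3)[OF s] by (rule filterlim_at_top_dense[THEN iffD1, rule_format])
  ultimately show ?thesis
    using conc[unfolded concentrated_thresholds_def, rule_format, OF pos pos] sparse_regimeD(4)[OF s] B
      eventually_threshold_ge[OF s pos, of \<delta>]
  proof eventually_elim
    case (elim n)
    have sn: "0 < s n" "s n \<le> n" "0 < boundary n (s n) + b n"
      using elim by auto
    obtain \<theta> where \<theta>: "\<theta> \<in> signal_class n (s n) (b n)"
      and eq: "\<And>i. i \<in> support n \<theta> \<Longrightarrow> \<theta> i = boundary n (s n) + b n"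
      using ex_least_favourable[OF sn] by blast
    obtain u A where u: "real n * gauss_tail (ereal u) \<le> \<delta> * real (s n)"
      and A: "threshold_event n (\<phi> n) u (boundary n (s n) + \<delta>) A" "1 - \<delta> \<le> measure (obs_law n \<theta>) A"
      using elim(3) \<theta> by blast
    have "boundary n (s n) - \<delta> \<le> u"
      using elim(6) u by blast
    note least_favourable_miss_prob[OF this, of "b n"]
    then have "gauss_tail (ereal (b n + \<delta>)) - gauss_tail (ereal (2 * boundary n (s n) - \<delta> + b n)) - \<delta>
        \<le> FNR n \<theta> (\<phi> n)"
      by (intro FNR_ge[OF \<phi> \<theta> sn(1) A]) (simp add: eq)
    moreover have "gauss_tail (ereal (2 * boundary n (s n) - \<delta> + b n)) \<le> gauss_tail (ereal (2 * boundary n (s n) - \<delta> + B))"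
      using elim by (intro gauss_tail_antimono) simp
    moreover have "gauss_tail (ereal (b n)) \<le> gauss_tail (ereal (b n + \<delta>)) + \<delta>"
      using gauss_tail_diff_le[of "b n" "b n + \<delta>"] pos by simp
    moreover have "0 \<le> FDR n \<theta> (\<phi> n)"
      by (rule risk_bounds[OF \<phi>])
    ultimately have "gauss_tail (ereal (b n)) - e \<le> risk n \<theta> (\<phi> n)"
      using elim(1) \<open>0 < e\<close> unfolding risk_def \<delta>_def by linarith
    then show ?case
      using \<theta> by blast
  qed
qed

lemma achieves_boundary_riskI:
  assumes \<phi>: "\<And>n. multiple_testing_procedure n (\<phi> n)" and s: "sparse_regime s"
    and b: "boundary_regime b" and conc: "concentrated_thresholds \<phi> s b"
  shows "achieves_boundary_risk \<phi> s b"
  unfolding achieves_boundary_risk_def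
proof (rule LIMSEQ_I)
  fix e :: real assume "0 < e"
  then have e: "0 < e / 2"
    by simp
  obtain B where B: "eventually (\<lambda>n. B \<le> b n) sequentially"
    using boundary_regime_bounded_below[OF b] .
  have "eventually (\<lambda>n. \<bar>(SUP \<theta>\<in>signal_class n (s n) (b n). risk n \<theta> (\<phi> n)) - gauss_tail (ereal (b n))\<bar> < e) sequentially"
    using concentrated_thresholds_risk_le[OF \<phi> s B conc e] concentrated_thresholds_risk_ge[OF \<phi> s b conc e]
  proof eventually_elim
    case (elim n)
    let ?R = "\<lambda>\<theta>. risk n \<theta> (\<phi> n)" and ?\<Theta> = "signal_class n (s n) (b n)"
    \<comment> \<open>The witness of the lower bound also shows that the class is nonempty, without
      which a supremum of reals cannot be bounded above termwise.\<close>
    obtain \<theta> where \<theta>: "\<theta> \<in> ?\<Theta>" "gauss_tail (ereal (b n)) - e / 2 \<le> ?R \<theta>"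
      using elim by blast
    have "(SUP \<theta>\<in>?\<Theta>. ?R \<theta>) \<le> gauss_tail (ereal (b n)) + e / 2"
      using \<theta> elim by (intro cSUP_least) auto
    moreover have "?R \<theta> \<le> (SUP \<theta>\<in>?\<Theta>. ?R \<theta>)"
      using \<theta> elim by (intro cSUP_upper bdd_aboveI2[of _ _ "gauss_tail (ereal (b n)) + e / 2"]) auto
    ultimately show ?case
      using \<theta>(2) \<open>0 < e\<close> by linarith
  qed
  then show "\<exists>N. \<forall>n\<ge>N. norm ((SUP \<theta>\<in>signal_class n (s n) (b n). risk n \<theta> (\<phi> n)) - gauss_tail (ereal (b n)) - 0) < e"
    by (simp add: eventually_sequentially)
qed

section \<open>The slab density and the score\<close>

lemma slab_nonzero: "x \<noteq> 0 \<Longrightarrow> slab x = 1 / sqrt (2 * pi) * (1 - exp (- x\<^sup>2 / 2)) / x\<^sup>2"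
  by (simp add: slab_def)

lemma slab_pos: "0 < slab x"
  by (auto simp: slab_def)

lemma slab_uminus [simp]: "slab (- x) = slab x"
  by (simp add: slab_def)

lemma slab_measurable [measurable]: "slab \<in> borel_measurable borel"
  unfolding slab_def[abs_def] by measurable

lemma beta_measurable [measurable]: "beta \<in> borel_measurable borel"
  unfolding beta_def[abs_def] by measurable

lemma isCont_slab: "isCont slab x"
proof (cases "x = 0")
  case False
  have "isCont (\<lambda>x. 1 / sqrt (2 * pi) * (1 - exp (- x\<^sup>2 / 2)) / x\<^sup>2) x"
    using False by (intro continuous_intros) auto
  moreover have "eventually (\<lambda>y. slab y = 1 / sqrt (2 * pi) * (1 - exp (- y\<^sup>2 / 2)) / y\<^sup>2) (nhds x)"
    using t1_space_nhds[OF False] by eventually_elim (rule slab_nonzero)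
  ultimately show ?thesis
    by (simp add: isCont_cong)
qed (simp add: isCont_slab_0)

lemma isCont_std_normal_density: "isCont std_normal_density x"
  unfolding std_normal_density_def by (intro continuous_intros) auto

text \<open>
  Since \<^term>\<open>- (x * slab x)\<close> is an antiderivative of \<^term>\<open>slab x - std_normal_density x\<close>, the slab
  has total mass at most one.
\<close>

lemma DERIV_slab: "((\<lambda>x. - (x * slab x)) has_real_derivative slab x - std_normal_density x) (at x)"
proof (cases "x = 0")
  case True
  \<comment> \<open>At 0 the difference quotient is \<open>- slab h\<close> itself, so continuity of
    the slab gives the derivative; the value fits because \<open>slab 0\<close> is half of
    \<open>std_normal_density 0\<close>.\<close>
  have "(\<lambda>h. (- ((0 + h) * slab (0 + h)) - - (0 * slab 0)) / h) \<midarrow>0\<rightarrow> - slab 0"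
  proof (rule Lim_transform_eventually)
    show "(\<lambda>h. - slab h) \<midarrow>0\<rightarrow> - slab 0"
      using isCont_slab_0 by (intro tendsto_minus) (simp add: isCont_def)
    show "\<forall>\<^sub>F h in at 0. - slab h = (- ((0 + h) * slab (0 + h)) - - (0 * slab 0)) / h"
      by (auto simp: eventually_at_filter)
  qed
  moreover have "slab 0 - std_normal_density 0 = - slab 0"
    by (simp add: slab_def std_normal_density_def)
  ultimately have "((\<lambda>x. - (x * slab x)) has_real_derivative slab 0 - std_normal_density 0) (at 0)"
    by (simp only: DERIV_def)
  then show ?thesis
    using True by simp
next
  case False
  have "((\<lambda>x. 1 / sqrt (2 * pi) * (exp (- x\<^sup>2 / 2) - 1) / x) has_real_derivative
      slab x - std_normal_density x) (at x)"
    using False unfolding slab_nonzero[OF False] std_normal_density_def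
    by (auto intro!: derivative_eq_intros simp: power2_eq_square field_simps)
  then show ?thesis
  proof (rule has_field_derivative_transform_within_open[of _ _ _ "- {0}"])
    fix y :: real assume "y \<in> - {0}"
    then have "y \<noteq> 0"
      by simp
    then show "1 / sqrt (2 * pi) * (exp (- y\<^sup>2 / 2) - 1) / y = - (y * slab y)"
      by (simp add: slab_nonzero power2_eq_square field_simps)
  qed (use False in auto)
qed

text \<open>On the interval from \<open>- k\<close> to \<open>k\<close> the antiderivative shows
  that the slab has the Gaussian mass minus \<open>2 * k * slab k\<close>, hence at most 1; monotone
  convergence in \<open>k\<close> does the rest.\<close>

lemma nn_integral_slab_le: "(\<integral>\<^sup>+x. ennreal (slab x) \<partial>lborel) \<le> 1"
proof -
  have le: "(\<integral>\<^sup>+x. ennreal (slab x) * indicator {- real k..real k} x \<partial>lborel) \<le> 1" for k :: nat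
  proof -
    let ?I = "{- real k..real k}"
    have diff: "has_bochner_integral lborel (\<lambda>x. (slab x - std_normal_density x) * indicator ?I x)
        (- (real k * slab k) - - (- real k * slab (- real k)))"
      by (rule has_bochner_integral_FTC_Icc_real)
        (simp_all add: DERIV_slab continuous_diff isCont_slab isCont_std_normal_density)
    have dens: "integrable lborel (\<lambda>x. std_normal_density x * indicator ?I x)"
      by (rule integrable_real_mult_indicator) auto
    have eq: "slab x * indicator ?I x
        = (slab x - std_normal_density x) * indicator ?I x + std_normal_density x * indicator ?I x" for x
      by (simp add: algebra_simps)
    have int: "integrable lborel (\<lambda>x. slab x * indicator ?I x)"
      unfolding eq using diff dens by (auto simp: has_bochner_integral_iff)
    have "(LINT x|lborel. slab x * indicator ?I x)
        = - (real k * slab k) - - (- real k * slab (- real k)) + (LINT x|lborel. std_normal_density x * indicator ?I x)"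
      unfolding eq using diff dens by (auto simp: has_bochner_integral_iff)
    also have "\<dots> \<le> (LINT x|lborel. std_normal_density x * indicator ?I x)"
      using slab_pos[of k] by simp
    also have "\<dots> \<le> (LINT x|lborel. std_normal_density x)"
      by (intro integral_mono dens) (auto simp: indicator_def)
    also have "\<dots> = 1"
      by simp
    finally have *: "(LINT x|lborel. slab x * indicator ?I x) \<le> 1" .
    have "(\<integral>\<^sup>+x. ennreal (slab x) * indicator ?I x \<partial>lborel) = (\<integral>\<^sup>+x. ennreal (slab x * indicator ?I x) \<partial>lborel)"
      by (intro nn_integral_cong) (auto simp: indicator_def)
    also have "\<dots> = ennreal (LINT x|lborel. slab x * indicator ?I x)"
      using int slab_pos by (intro nn_integral_eq_integral) (auto simp: less_imp_le)
    also have "\<dots> \<le> 1"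
      using * by simp
    finally show ?thesis .
  qed
  have sup: "(SUP k. ennreal (slab x) * indicator {- real k..real k} x) = ennreal (slab x)" for x
  proof (rule antisym)
    show "(SUP k. ennreal (slab x) * indicator {- real k..real k} x) \<le> ennreal (slab x)"
      by (intro SUP_least) (auto simp: indicator_def)
    obtain k :: nat where "\<bar>x\<bar> \<le> real k"
      using real_arch_simple by blast
    then show "ennreal (slab x) \<le> (SUP k. ennreal (slab x) * indicator {- real k..real k} x)"
      by (intro SUP_upper2[of k]) (auto simp: indicator_def)
  qed
  have "(\<integral>\<^sup>+x. ennreal (slab x) \<partial>lborel) = (\<integral>\<^sup>+x. (SUP k. ennreal (slab x) * indicator {- real k..real k} x) \<partial>lborel)"
    by (simp only: sup)
  also have "\<dots> = (SUP k. \<integral>\<^sup>+x. ennreal (slab x) * indicator {- real k..real k} x \<partial>lborel)"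
    by (rule nn_integral_monotone_convergence_SUP) (auto simp: incseq_def le_fun_def indicator_def)
  also have "\<dots> \<le> 1"
    using le by (intro SUP_least)
  finally show ?thesis .
qed

lemma integrable_slab: "integrable lborel slab"
proof (rule integrableI_bounded)
  show "(\<integral>\<^sup>+x. ennreal (norm (slab x)) \<partial>lborel) < \<infinity>"
    using order_le_less_trans[OF nn_integral_slab_le, of top] slab_pos by (simp add: less_imp_le)
qed simp

lemma integral_slab_le: "(LINT x|lborel. slab x) \<le> 1"
proof -
  have "ennreal (LINT x|lborel. slab x) = (\<integral>\<^sup>+x. ennreal (slab x) \<partial>lborel)"
    using slab_pos by (intro nn_integral_eq_integral[symmetric] integrable_slab) (auto simp: less_imp_le)
  then show ?thesis
    using nn_integral_slab_le by (metis ennreal_le_1)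
qed

section \<open>The likelihood ratio of slab and noise density\<close>

lemma density_mult_beta: "std_normal_density x * beta x = slab x - std_normal_density x"
  by (simp add: beta_def field_simps normal_density_pos less_imp_neq[symmetric])

lemma integrable_beta: "integrable std_gaussian beta"
  using integrable_slab by (simp add: integrable_std_gaussian_iff density_mult_beta)

text \<open>Mass of the slab minus mass of the Gaussian density. It says that the null score does
  not drift upwards at weight 0, from which the negative drift at larger weights is derived.\<close>

lemma expectation_beta_le: "(LINT z|std_gaussian. beta z) \<le> 0"
  using integrable_slab integral_slab_le by (simp add: integral_std_gaussian density_mult_beta)

lemma beta_nonzero: "x \<noteq> 0 \<Longrightarrow> beta x = (exp (x\<^sup>2 / 2) - 1) / x\<^sup>2 - 1"
  by (simp add: beta_def slab_nonzero std_normal_density_def exp_minus field_simps)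

lemma beta_0: "beta 0 = - 1 / 2"
  by (simp add: beta_def slab_def std_normal_density_def)

lemma exp_quotient_strict_mono:
  fixes u v :: real
  assumes "0 < u" "u < v"
  shows "(exp u - 1) / u < (exp v - 1) / v"
proof (rule DERIV_pos_imp_increasing[OF assms(2)])
  fix t assume "u \<le> t" "t \<le> v"
  then have "0 < t"
    using assms by simp
  have "((\<lambda>t. (exp t - 1) / t) has_real_derivative (t * exp t - exp t + 1) / t\<^sup>2) (at t)"
    using \<open>0 < t\<close> by (auto intro!: derivative_eq_intros simp: power2_eq_square field_simps)
  \<comment> \<open>This is the positivity of the derivative's numerator after division by
    \<open>exp t\<close>. Squaring \<open>1 - t / 2 \<le> exp (- t / 2)\<close> makes it strict with
    slack \<open>(t / 2)\<^sup>2\<close>; squaring requires \<open>1 - t / 2\<close> to be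
    nonnegative, hence the case distinction at 2.\<close>
  moreover have "1 - t < exp (- t)"
  proof (cases "t < 2")
    case True
    then have "(1 - t / 2)\<^sup>2 \<le> (exp (- t / 2))\<^sup>2"
      using exp_ge_add_one_self[of "- t / 2"] by (intro power_mono) auto
    also have "\<dots> = exp (- t)"
      by (simp add: exp_double[symmetric])
    finally have "1 - t + (t / 2)\<^sup>2 \<le> exp (- t)"
      by (simp add: power2_eq_square algebra_simps)
    moreover have "0 < (t / 2)\<^sup>2"
      using \<open>0 < t\<close> by simp
    ultimately show ?thesis
      by linarith
  next
    case False
    then have "1 - t < 0"
      by simp
    then show ?thesis
      using exp_gt_zero[of "- t"] by linarith
  qed
  then have "(1 - t) * exp t < exp (- t) * exp t"
    by (intro mult_strict_right_mono) auto
  then have "0 < t * exp t - exp t + 1"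
    by (simp add: exp_minus algebra_simps)
  ultimately show "\<exists>y. ((\<lambda>t. (exp t - 1) / t) has_real_derivative y) (at t) \<and> 0 < y"
    using \<open>0 < t\<close> by (intro exI[of _ "(t * exp t - exp t + 1) / t\<^sup>2"]) simp
qed

lemma beta_strict_mono:
  assumes "\<bar>x\<bar> < \<bar>y\<bar>"
  shows "beta x < beta y"
proof -
  have "y \<noteq> 0"
    using assms by auto
  have two: "beta z = (exp (z\<^sup>2 / 2) - 1) / (z\<^sup>2 / 2) / 2 - 1" if "z \<noteq> 0" for z
    using that by (simp add: beta_nonzero field_simps)
  show ?thesis
  proof (cases "x = 0")
    case True
    have "exp (y\<^sup>2 / 2) = (exp (y\<^sup>2 / 4))\<^sup>2"
      by (simp add: exp_double[symmetric])
    moreover have "(1 + y\<^sup>2 / 4)\<^sup>2 \<le> (exp (y\<^sup>2 / 4))\<^sup>2"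
      by (intro power_mono exp_ge_add_one_self) auto
    moreover have "(1 + y\<^sup>2 / 4)\<^sup>2 = 1 + y\<^sup>2 / 2 + (y\<^sup>2 / 4)\<^sup>2"
      by (simp add: power2_eq_square algebra_simps)
    moreover have "0 < (y\<^sup>2 / 4)\<^sup>2"
      using \<open>y \<noteq> 0\<close> by simp
    ultimately have "y\<^sup>2 / 2 < exp (y\<^sup>2 / 2) - 1"
      by linarith
    then show ?thesis
      using True \<open>y \<noteq> 0\<close> by (simp add: beta_0 beta_nonzero field_simps)
  next
    case False
    have "x\<^sup>2 < y\<^sup>2"
      using assms by (metis abs_ge_zero power2_abs power_strict_mono zero_less_numeral)
    then have "(exp (x\<^sup>2 / 2) - 1) / (x\<^sup>2 / 2) < (exp (y\<^sup>2 / 2) - 1) / (y\<^sup>2 / 2)"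
      using False by (intro exp_quotient_strict_mono) auto
    then show ?thesis
      unfolding two[OF False] two[OF \<open>y \<noteq> 0\<close>]
      by (intro diff_strict_right_mono divide_strict_right_mono) auto
  qed
qed

lemma beta_mono:
  assumes "\<bar>x\<bar> \<le> \<bar>y\<bar>"
  shows "beta x \<le> beta y"
proof (cases "\<bar>x\<bar> = \<bar>y\<bar>")
  case True
  then have "x\<^sup>2 = y\<^sup>2"
    by (metis power2_abs)
  moreover have "x = 0 \<longleftrightarrow> y = 0"
    using True by auto
  ultimately show ?thesis
    by (simp add: beta_def slab_def std_normal_density_def)
next
  case False
  then have "\<bar>x\<bar> < \<bar>y\<bar>"
    using assms by simp
  then show ?thesis
    by (intro less_imp_le beta_strict_mono)
qed

lemma beta_ge: "- 1 / 2 \<le> beta x"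
  using beta_mono[of 0 x] by (simp add: beta_0)

lemma finite_beta_zeros: "finite {x. beta x = 0}"
proof (cases "\<exists>r. beta r = 0")
  case True
  then obtain r where "beta r = 0"
    by blast
  have "{x. beta x = 0} \<subseteq> {r, - r}"
  proof
    fix x assume "x \<in> {x. beta x = 0}"
    then have "\<not> \<bar>x\<bar> < \<bar>r\<bar>" "\<not> \<bar>r\<bar> < \<bar>x\<bar>"
      using beta_strict_mono[of x r] beta_strict_mono[of r x] \<open>beta r = 0\<close> by auto
    then show "x \<in> {r, - r}"
      by auto
  qed
  then show ?thesis
    by (rule finite_subset) simp
qed simp

text \<open>Keeps every logarithm and every denominator of the score well defined on the whole
  interval from 0 to 1, both ends included.\<close>

lemma beta_weight_pos:
  assumes "0 \<le> w" "w \<le> 1"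
  shows "1 / 2 \<le> 1 + w * beta x"
proof (cases "0 \<le> beta x")
  case True
  then have "0 \<le> w * beta x"
    using assms by simp
  then show ?thesis
    by linarith
next
  case False
  then have "1 * beta x \<le> w * beta x"
    using assms by (intro mult_right_mono_neg) auto
  then show ?thesis
    using beta_ge[of x] by simp
qed

section \<open>The score and the location of the maximiser\<close>

definition score :: "nat \<Rightarrow> (nat \<Rightarrow> real) \<Rightarrow> real \<Rightarrow> real" where
  "score n x w = (\<Sum>i=1..n. beta (x i) / (1 + w * beta (x i)))"

lemma DERIV_marginal_loglik:
  assumes "0 \<le> w" "w \<le> 1"
  shows "(marginal_loglik n x has_real_derivative score n x w) (at w)"
  unfolding marginal_loglik_def[abs_def] score_def
proof (rule DERIV_sum)
  fix i
  have "0 < 1 + w * beta (x i)"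
    using beta_weight_pos[OF assms, of "x i"] by linarith
  then show "((\<lambda>w. ln (1 + w * beta (x i))) has_real_derivative beta (x i) / (1 + w * beta (x i))) (at w)"
    by (auto intro!: derivative_eq_intros)
qed

lemma score_summand_diff:
  assumes "0 \<le> w" "w < w'" "w' \<le> 1"
  shows "beta z / (1 + w' * beta z) \<le> beta z / (1 + w * beta z)"
    and "beta z \<noteq> 0 \<Longrightarrow> beta z / (1 + w' * beta z) < beta z / (1 + w * beta z)"
proof -
  have pos: "0 < 1 + w * beta z" "0 < 1 + w' * beta z"
    using beta_weight_pos[of w z] beta_weight_pos[of w' z] assms by linarith+
  have eq: "beta z / (1 + w * beta z) - beta z / (1 + w' * beta z)
      = (w' - w) * (beta z)\<^sup>2 / ((1 + w * beta z) * (1 + w' * beta z))"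
    using pos by (subst diff_frac_eq) (auto simp: power2_eq_square algebra_simps)
  have "0 \<le> (w' - w) * (beta z)\<^sup>2 / ((1 + w * beta z) * (1 + w' * beta z))"
    using pos assms by (intro divide_nonneg_pos mult_nonneg_nonneg mult_pos_pos) auto
  then show "beta z / (1 + w' * beta z) \<le> beta z / (1 + w * beta z)"
    unfolding eq[symmetric] by simp
  assume "beta z \<noteq> 0"
  then have "0 < (w' - w) * (beta z)\<^sup>2 / ((1 + w * beta z) * (1 + w' * beta z))"
    using pos assms by (intro divide_pos_pos mult_pos_pos) auto
  then show "beta z / (1 + w' * beta z) < beta z / (1 + w * beta z)"
    unfolding eq[symmetric] by simp
qed

lemma score_antimono:
  assumes "0 \<le> w" "w \<le> w'" "w' \<le> 1"
  shows "score n x w' \<le> score n x w"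
  using assms score_summand_diff(1)[of w w'] unfolding score_def
  by (cases "w = w'") (auto intro!: sum_mono)

lemma score_strict_antimono:
  assumes "0 \<le> w" "w < w'" "w' \<le> 1" and i: "i \<in> {1..n}" "beta (x i) \<noteq> 0"
  shows "score n x w' < score n x w"
  unfolding score_def
proof (rule sum_strict_mono_ex1)
  show "\<exists>i\<in>{1..n}. beta (x i) / (1 + w' * beta (x i)) < beta (x i) / (1 + w * beta (x i))"
    using i by (intro bexI[of _ i] score_summand_diff(2) assms)
qed (use score_summand_diff(1)[OF assms(1-3)] in auto)

lemma mmle_weightD:
  assumes "mmle_weight what" "x \<in> space (sample_space n)"
  shows "1 / real n \<le> what n x" "what n x \<le> 1" "0 \<le> what n x"
    and "w \<in> {1 / real n..1} \<Longrightarrow> marginal_loglik n x w \<le> marginal_loglik n x (what n x)"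
proof -
  have *: "is_arg_max (marginal_loglik n x) (\<lambda>w. w \<in> {1 / real n..1}) (what n x)"
    using assms by (simp add: mmle_weight_def)
  then show "1 / real n \<le> what n x" "what n x \<le> 1"
    and "w \<in> {1 / real n..1} \<Longrightarrow> marginal_loglik n x w \<le> marginal_loglik n x (what n x)"
    by (auto simp: is_arg_max_def not_less)
  then show "0 \<le> what n x"
    by (meson order_trans zero_le_divide_1_iff of_nat_0_le_iff)
qed

text \<open>The likelihood strictly increases up to \<open>w\<close>, so no maximiser lies to the
  left. Positivity is asked only strictly below \<open>w\<close>, so that the lemma also covers a
  score vanishing at \<open>w\<close>, as \<open>what_ge_iff_score_nonneg\<close> requires.\<close>

lemma what_ge:
  assumes mm: "mmle_weight what" "x \<in> space (sample_space n)" and w: "1 / real n \<le> w" "w \<le> 1"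
    and pos: "\<And>w'. 0 \<le> w' \<Longrightarrow> w' < w \<Longrightarrow> 0 < score n x w'"
  shows "w \<le> what n x"
proof (rule ccontr)
  let ?w = "what n x"
  assume "\<not> w \<le> ?w"
  then have lt: "?w < w"
    by simp
  note W = mmle_weightD[OF mm]
  have "marginal_loglik n x ?w < marginal_loglik n x w"
  proof (rule DERIV_pos_imp_increasing_open[OF lt])
    fix v assume "?w < v" "v < w"
    then show "\<exists>y. (marginal_loglik n x has_real_derivative y) (at v) \<and> 0 < y"
      using W(3) w pos by (intro exI[of _ "score n x v"]) (auto intro!: DERIV_marginal_loglik)
  next
    show "continuous_on {?w..w} (marginal_loglik n x)"
      by (rule DERIV_continuous_on, rule has_field_derivative_at_within, rule DERIV_marginal_loglik)
        (use W(3) w in auto)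
  qed
  then show False
    using W(4)[of w] w by auto
qed

lemma what_le:
  assumes mm: "mmle_weight what" "x \<in> space (sample_space n)" and w: "1 / real n \<le> w" "w \<le> 1"
    and neg: "score n x w < 0"
  shows "what n x \<le> w"
proof (rule ccontr)
  let ?w = "what n x"
  assume "\<not> ?w \<le> w"
  then have lt: "w < ?w"
    by simp
  note W = mmle_weightD[OF mm]
  have "0 \<le> w"
    using w(1) by (meson order_trans zero_le_divide_1_iff of_nat_0_le_iff)
  have "marginal_loglik n x ?w < marginal_loglik n x w"
  proof (rule DERIV_neg_imp_decreasing[OF lt])
    fix v assume v: "w \<le> v" "v \<le> ?w"
    then have "score n x v < 0"
      using neg score_antimono[of w v n x] \<open>0 \<le> w\<close> W(2) by simp
    then show "\<exists>y. (marginal_loglik n x has_real_derivative y) (at v) \<and> y < 0"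
      using v \<open>0 \<le> w\<close> W(2) by (intro exI[of _ "score n x v"]) (auto intro!: DERIV_marginal_loglik)
  qed
  then show False
    using W(4)[of w] w by auto
qed

section \<open>The empirical Bayes weight\<close>

lemma measurable_score:
  "(\<lambda>x. score n x w) \<in> borel_measurable (sample_space n)"
  unfolding score_def
proof (rule borel_measurable_sum)
  fix i assume "i \<in> {1..n}"
  then have [measurable]: "(\<lambda>x. x i) \<in> sample_space n \<rightarrow>\<^sub>M borel"
    by (rule measurable_component_singleton)
  show "(\<lambda>x. beta (x i) / (1 + w * beta (x i))) \<in> borel_measurable (sample_space n)"
    by measurable
qed

text \<open>Turns a level set of the maximiser into one of the measurable score. The delicate case
  is a maximiser equal to \<open>w\<close> with negative score: a small step to the left would
  increase the likelihood, and it stays admissible because \<open>1 / n < w\<close> is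
  strict.\<close>

lemma what_ge_iff_score_nonneg:
  assumes mm: "mmle_weight what" "x \<in> space (sample_space n)" and w: "1 / real n < w" "w \<le> 1"
    and i: "i \<in> {1..n}" "beta (x i) \<noteq> 0"
  shows "w \<le> what n x \<longleftrightarrow> 0 \<le> score n x w"
proof
  assume *: "0 \<le> score n x w"
  show "w \<le> what n x"
  proof (rule what_ge[OF mm])
    fix w' assume "0 \<le> w'" "w' < w"
    then show "0 < score n x w'"
      using score_strict_antimono[of w' w i n x, OF _ _ w(2) i] * by simp
  qed (use w in auto)
next
  assume *: "w \<le> what n x"
  show "0 \<le> score n x w"
  proof (rule ccontr)
    assume "\<not> 0 \<le> score n x w"
    then have neg: "score n x w < 0"
      by simp
    have eq: "what n x = w"
      using what_le[OF mm _ w(2) neg] w(1) * by simp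
    have "0 \<le> w"
      using w(1) order_trans[of 0 "1 / real n" w] by simp
    obtain d where d: "0 < d" "\<And>h. 0 < h \<Longrightarrow> h < d \<Longrightarrow> marginal_loglik n x w < marginal_loglik n x (w - h)"
      using DERIV_neg_dec_left[OF DERIV_marginal_loglik[OF \<open>0 \<le> w\<close> w(2)] neg] by blast
    define h where "h = min (d / 2) (w - 1 / real n)"
    have h: "0 < h" "h < d" "1 / real n \<le> w - h"
      using d(1) w(1) by (auto simp: h_def)
    have "marginal_loglik n x (w - h) \<le> marginal_loglik n x (what n x)"
      by (rule mmle_weightD(4)[OF mm]) (use h w in auto)
    then show False
      using d(2)[OF h(1,2)] eq by simp
  qed
qed

text \<open>
  The maximiser is unique unless \<^term>\<open>beta\<close> vanishes at every coordinate, which happens at finitely many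
  points only; hence no measurable choice has to be assumed.
\<close>

lemma measurable_what:
  assumes mm: "mmle_weight what"
  shows "what n \<in> borel_measurable (sample_space n)"
  unfolding borel_measurable_iff_ge
proof
  fix w
  define Z where "Z = PiE {1..n} (\<lambda>_. {z. beta z = 0})"
  have Z: "finite Z"
    unfolding Z_def by (intro finite_PiE finite_beta_zeros) simp
  have Z_space: "Z \<subseteq> space (sample_space n)"
    by (auto simp: Z_def space_PiM)
  have Z_sub: "Y \<in> sets (sample_space n)" if "Y \<subseteq> Z" for Y
  proof -
    have "{x} \<in> sets (sample_space n)" if "x \<in> Y" for x
    proof -
      have "x \<in> extensional {1..n}"
        using \<open>x \<in> Y\<close> \<open>Y \<subseteq> Z\<close> by (auto simp: Z_def PiE_def)
      then have "{x} = PiE {1..n} (\<lambda>i. {x i})"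
        by (simp add: PiE_singleton)
      also have "\<dots> \<in> sets (sample_space n)"
        by (rule sets_PiM_I_finite) auto
      finally show ?thesis .
    qed
    moreover have "finite Y"
      using that Z by (rule finite_subset)
    ultimately have "(\<Union>x\<in>Y. {x}) \<in> sets (sample_space n)"
      by (intro sets.finite_UN)
    then show ?thesis
      by (simp only: UN_singleton)
  qed
  consider "w \<le> 1 / real n" | "1 < w" | "1 / real n < w" "w \<le> 1"
    by linarith
  then show "{x \<in> space (sample_space n). w \<le> what n x} \<in> sets (sample_space n)"
  proof cases
    case 1
    have "w \<le> what n x" if "x \<in> space (sample_space n)" for x
      using mmle_weightD(1)[OF mm that] 1 by linarith
    then have "{x \<in> space (sample_space n). w \<le> what n x} = space (sample_space n)"
      by blast
    then show ?thesis
      by (simp only: sets.top)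
  next
    case 2
    have "\<not> w \<le> what n x" if "x \<in> space (sample_space n)" for x
      using mmle_weightD(2)[OF mm that] 2 by linarith
    then have "{x \<in> space (sample_space n). w \<le> what n x} = {}"
      by blast
    then show ?thesis
      by (simp only: sets.empty_sets)
  next
    case 3
    let ?G = "{x \<in> space (sample_space n). 0 \<le> score n x w}"
      and ?W = "{x \<in> space (sample_space n). w \<le> what n x}"
    have "w \<le> what n x \<longleftrightarrow> 0 \<le> score n x w" if "x \<in> space (sample_space n)" "x \<notin> Z" for x
    proof -
      have "\<exists>i\<in>{1..n}. beta (x i) \<noteq> 0"
      proof (rule ccontr)
        assume "\<not> (\<exists>i\<in>{1..n}. beta (x i) \<noteq> 0)"
        then have "x \<in> Z"
          using that(1) by (simp add: Z_def space_PiM PiE_iff)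
        then show False
          using that(2) by blast
      qed
      then obtain i where "i \<in> {1..n}" "beta (x i) \<noteq> 0"
        by blast
      then show ?thesis
        by (rule what_ge_iff_score_nonneg[OF mm that(1) 3])
    qed
    then have W: "?W = (?G - Z) \<union> (?W \<inter> Z)"
      by auto
    moreover have "?G \<in> sets (sample_space n)"
      using measurable_score[of n w, measurable] by measurable
    moreover have "Z \<in> sets (sample_space n)"
      by (rule Z_sub[OF order_refl])
    moreover have "?W \<inter> Z \<in> sets (sample_space n)"
      by (rule Z_sub[OF Int_lower2])
    ultimately have "(?G - Z) \<union> (?W \<inter> Z) \<in> sets (sample_space n)"
      by (intro sets.Un sets.Diff)
    then show ?thesis
      by (subst W)
  qed
qed

lemma multiple_testing_procedureI:
  assumes "\<And>i. i \<in> {1..n} \<Longrightarrow> {x \<in> space (sample_space n). P x i} \<in> sets (sample_space n)"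
  shows "multiple_testing_procedure n (\<lambda>x. \<lambda>i\<in>{1..n}. of_bool (P x i))"
  unfolding multiple_testing_procedure_def
proof (rule measurable_restrict)
  fix i assume i: "i \<in> {1..n}"
  have "(\<lambda>x. of_bool (P x i) :: nat) -` {1} \<inter> space (sample_space n) = {x \<in> space (sample_space n). P x i}"
    "(\<lambda>x. of_bool (P x i) :: nat) -` {0} \<inter> space (sample_space n)
      = space (sample_space n) - {x \<in> space (sample_space n). P x i}"
    by auto
  then show "(\<lambda>x. of_bool (P x i) :: nat) \<in> sample_space n \<rightarrow>\<^sub>M count_space {0, 1}"
    using assms[OF i] by (subst measurable_count_space_eq2) (auto simp: of_bool_def)
qed

lemma measurable_l_value_procedure:
  assumes "mmle_weight what"
  shows "multiple_testing_procedure n (l_value_procedure what t n)"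
  unfolding l_value_procedure_def[abs_def]
proof (rule multiple_testing_procedureI)
  fix i assume "i \<in> {1..n}"
  then have [measurable]: "(\<lambda>x. x i) \<in> sample_space n \<rightarrow>\<^sub>M borel"
    by (rule measurable_component_singleton)
  note [measurable] = measurable_what[OF assms, of n]
  show "{x \<in> space (sample_space n). l_value (what n x) (x i) < t} \<in> sets (sample_space n)"
    unfolding l_value_def by measurable
qed

lemma ex_mmle_weight: "\<exists>what. mmle_weight what"
proof -
  have "\<exists>w. is_arg_max (marginal_loglik n x) (\<lambda>w. w \<in> {1 / real n..1}) w" for n and x :: "nat \<Rightarrow> real"
  proof -
    have "continuous_on {1 / real n..1} (marginal_loglik n x)"
      by (rule DERIV_continuous_on, rule has_field_derivative_at_within, rule DERIV_marginal_loglik)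
        (auto intro: order_trans[of 0 "1 / real n"])
    \<comment> \<open>For \<open>n = 0\<close> the left end is 0, as
      \<open>1 / 0 = 0\<close>.\<close>
    moreover have "{1 / real n..1} \<noteq> {}"
      by (cases "n = 0") auto
    ultimately obtain w where "w \<in> {1 / real n..1}" "\<forall>v\<in>{1 / real n..1}. marginal_loglik n x v \<le> marginal_loglik n x w"
      using continuous_attains_sup[of "{1 / real n..1}" "marginal_loglik n x"] by auto
    then show ?thesis
      by (intro exI[of _ w]) (auto simp: is_arg_max_def not_less)
  qed
  then show ?thesis
    unfolding mmle_weight_def by metis
qed

text \<open>Dividing by the Gaussian density leaves a condition on \<open>1 + beta x\<close>, which
  is monotone in the absolute value of \<open>x\<close>. The form without quotients also covers
  \<open>w = 1\<close>.\<close>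

lemma l_value_less_iff:
  assumes "0 \<le> w" "w \<le> 1"
  shows "l_value w x < t \<longleftrightarrow> (1 - w) * (1 - t) < t * w * (1 + beta x)"
proof -
  let ?f = "std_normal_density x" and ?g = "slab x"
  have f: "0 < ?f"
    by (simp add: normal_density_pos)
  have "0 < (1 - w) * ?f + w * ?g"
  proof (cases "w = 1")
    case False
    then show ?thesis
      using assms f slab_pos[of x] by (intro add_pos_nonneg mult_pos_pos mult_nonneg_nonneg) auto
  qed (simp add: slab_pos)
  then have "l_value w x < t \<longleftrightarrow> (1 - w) * ?f < t * ((1 - w) * ?f + w * ?g)"
    unfolding l_value_def by (rule pos_divide_less_eq)
  also have "?g = ?f * (1 + beta x)"
    using density_mult_beta[of x] by (simp add: algebra_simps)
  also have "(1 - w) * ?f < t * ((1 - w) * ?f + w * (?f * (1 + beta x)))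
      \<longleftrightarrow> ?f * ((1 - w) * (1 - t)) < ?f * (t * w * (1 + beta x))"
    by (simp add: algebra_simps)
  also have "\<dots> \<longleftrightarrow> (1 - w) * (1 - t) < t * w * (1 + beta x)"
    using f by (rule mult_less_cancel_left_pos)
  finally show ?thesis .
qed

text \<open>The bound \<open>1 / w\<close> serves for signals, \<open>- 1\<close> for coordinates
  that are not detected. The square is the product of the two bounds \<open>2 + beta z\<close> and
  \<open>1 / w\<close> on the absolute value; being linear in \<open>beta\<close>, it can be
  integrated by \<open>expectation_beta_le\<close>. If \<open>w * beta z\<close> is at least 1, the
  denominator lies between 2 and \<open>2 * w * beta z\<close>, which gives the last two
  bounds.\<close>

lemma score_summand_bounds:
  fixes z w :: real
  defines "\<psi> \<equiv> beta z / (1 + w * beta z)"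
  assumes "0 < w" "w \<le> 1"
  shows "- 1 \<le> \<psi>" "\<psi> \<le> 1 / w" "\<psi> \<le> beta z" "\<psi>\<^sup>2 \<le> (2 + beta z) / w"
    and "1 \<le> w * beta z \<Longrightarrow> \<psi> \<le> beta z / 2" "1 \<le> w * beta z \<Longrightarrow> 1 / (2 * w) \<le> \<psi>"
proof -
  have p: "1 / 2 \<le> 1 + w * beta z"
    using beta_weight_pos[of w z] assms by simp
  then have pos: "0 < 1 + w * beta z"
    by linarith
  have b: "- 1 / 2 \<le> beta z"
    by (rule beta_ge)
  have sq: "0 \<le> w * (beta z)\<^sup>2"
    using assms by simp
  show ge: "- 1 \<le> \<psi>"
  proof -
    have "- (1 + w * beta z) \<le> beta z"
      using p b by linarith
    then show ?thesis
      unfolding \<psi>_def using pos by (simp add: le_divide_eq)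
  qed
  show le: "\<psi> \<le> 1 / w"
    unfolding \<psi>_def using pos assms by (simp add: divide_simps mult.commute)
  show le_beta: "\<psi> \<le> beta z"
    unfolding \<psi>_def using pos sq by (simp add: divide_le_eq power2_eq_square algebra_simps)
  have "\<bar>\<psi>\<bar> \<le> 2 + beta z"
    using ge le_beta b by linarith
  moreover have "\<bar>\<psi>\<bar> \<le> 1 / w"
  proof -
    have "1 \<le> 1 / w"
      using assms by simp
    then show ?thesis
      using ge le by linarith
  qed
  ultimately have "\<bar>\<psi>\<bar> * \<bar>\<psi>\<bar> \<le> (2 + beta z) * (1 / w)"
    by (intro mult_mono) auto
  then show "\<psi>\<^sup>2 \<le> (2 + beta z) / w"
    by (simp add: power2_eq_square)
  assume large: "1 \<le> w * beta z"
  then have "0 < w * beta z"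
    by linarith
  then have "0 < beta z"
    using assms by (simp add: zero_less_mult_iff)
  then show "\<psi> \<le> beta z / 2"
    unfolding \<psi>_def using large by (intro divide_left_mono) auto
  show "1 / (2 * w) \<le> \<psi>"
    unfolding \<psi>_def using large pos assms by (simp add: divide_simps)
qed

section \<open>Null moments of the score and its sign with high probability\<close>

lemma slab_ge:
  assumes "1 \<le> a" "2 * a \<le> z" "z \<le> 4 * a"
  shows "1 / (32 * sqrt (2 * pi) * a\<^sup>2) \<le> slab z"
proof -
  have z: "0 < z" "2 \<le> z"
    using assms by linarith+
  have "z\<^sup>2 \<le> (4 * a)\<^sup>2"
    using assms z by (intro power_mono) auto
  then have z2: "z\<^sup>2 \<le> 16 * a\<^sup>2"
    by (simp add: power2_eq_square)
  have "2\<^sup>2 \<le> z\<^sup>2"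
    using z by (intro power_mono) auto
  then have "1 \<le> z\<^sup>2 / 2"
    by simp
  then have "2 \<le> exp (z\<^sup>2 / 2)"
    using exp_ge_add_one_self[of "z\<^sup>2 / 2"] by linarith
  then have e: "1 / 2 \<le> 1 - exp (- z\<^sup>2 / 2)"
    by (simp add: exp_minus field_simps)
  have "1 / (32 * sqrt (2 * pi) * a\<^sup>2) = 1 / sqrt (2 * pi) * (1 / 2) / (16 * a\<^sup>2)"
    by simp
  also have "\<dots> \<le> 1 / sqrt (2 * pi) * (1 - exp (- z\<^sup>2 / 2)) / z\<^sup>2"
    using e z2 z by (intro frac_le mult_left_mono) auto
  also have "\<dots> = slab z"
    using z by (simp add: slab_nonzero)
  finally show ?thesis .
qed

text \<open>The summand never exceeds \<open>beta\<close>, whose mean is at most 0, and on the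
  interval from \<open>2 * a\<close> to \<open>4 * a\<close> it is at most \<open>beta / 2\<close>.
  There \<open>beta\<close> times the Gaussian density is at least half the slab, so it integrates
  over length \<open>2 * a\<close> to at least 1 / (32 sqrt(2 pi) a); half of this is
  gained.\<close>

lemma expectation_score_summand_le:
  assumes a: "1 \<le> a" and w: "0 < w" "w \<le> 1" and large: "1 \<le> w * beta (2 * a)"
  shows "(LINT z|std_gaussian. beta z / (1 + w * beta z)) \<le> - (1 / (64 * sqrt (2 * pi)) / a)"
proof -
  let ?I = "{2 * a..4 * a}"
  have w_beta: "1 \<le> w * beta z" if "z \<in> ?I" for z
  proof -
    have "w * beta (2 * a) \<le> w * beta z"
      using that a w by (intro mult_left_mono beta_mono) auto
    then show ?thesis
      using large by linarith
  qed
  have dens: "1 / (64 * sqrt (2 * pi) * a\<^sup>2) \<le> slab z - std_normal_density z" if "z \<in> ?I" for z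
  proof -
    have "0 < beta z"
      using w_beta[OF that] w mult_nonneg_nonpos[of w "beta z"] by linarith
    then have "w * beta z \<le> 1 * beta z"
      using w by (intro mult_right_mono) auto
    then have "1 \<le> beta z"
      using w_beta[OF that] by simp
    then have "std_normal_density z * 1 \<le> std_normal_density z * beta z"
      by (intro mult_left_mono) auto
    then have "slab z / 2 \<le> slab z - std_normal_density z"
      using density_mult_beta[of z] by simp
    moreover have "1 / (32 * sqrt (2 * pi) * a\<^sup>2) \<le> slab z"
      using that a by (intro slab_ge) auto
    moreover have "1 / (32 * sqrt (2 * pi) * a\<^sup>2) / 2 = 1 / (64 * sqrt (2 * pi) * a\<^sup>2)"
      by simp
    ultimately show ?thesis
      by linarith
  qed
  have int_ind: "integrable std_gaussian (\<lambda>z. beta z * indicator ?I z)"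
    by (rule integrable_real_mult_indicator) (auto simp: integrable_beta)
  have "1 / (32 * sqrt (2 * pi) * a) = (LINT z|lborel. 1 / (64 * sqrt (2 * pi) * a\<^sup>2) * indicator ?I z)"
    using a by (simp add: power2_eq_square)
  also have "\<dots> \<le> (LINT z|lborel. std_normal_density z * (beta z * indicator ?I z))"
  proof (rule integral_mono)
    show "integrable lborel (\<lambda>z. std_normal_density z * (beta z * indicator ?I z))"
      using int_ind by (simp add: integrable_std_gaussian_iff)
    show "1 / (64 * sqrt (2 * pi) * a\<^sup>2) * indicator ?I z \<le> std_normal_density z * (beta z * indicator ?I z)" for z
      using dens[of z] density_mult_beta[of z] by (auto simp: indicator_def)
    show "integrable lborel (\<lambda>z. 1 / (64 * sqrt (2 * pi) * a\<^sup>2) * indicator ?I z)"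
      by (intro integrable_mult_right integrable_real_indicator) (auto simp: emeasure_lborel_Icc_eq)
  qed
  also have "\<dots> = (LINT z|std_gaussian. beta z * indicator ?I z)"
    by (simp add: integral_std_gaussian)
  finally have gain: "1 / (32 * sqrt (2 * pi) * a) \<le> (LINT z|std_gaussian. beta z * indicator ?I z)" .
  have "(LINT z|std_gaussian. beta z / (1 + w * beta z))
      \<le> (LINT z|std_gaussian. beta z - (beta z * indicator ?I z) / 2)"
  proof (rule integral_mono)
    have bdd: "\<bar>beta z / (1 + w * beta z)\<bar> \<le> 1 / w" for z
    proof -
      have "1 \<le> 1 / w"
        using w by simp
      then show ?thesis
        using score_summand_bounds(1,2)[OF w, of z] by linarith
    qed
    show "integrable std_gaussian (\<lambda>z. beta z / (1 + w * beta z))"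
      by (rule std_gaussian.integrable_const_bound[of _ "1 / w"]) (use bdd in auto)
    show "integrable std_gaussian (\<lambda>z. beta z - (beta z * indicator ?I z) / 2)"
      using integrable_beta int_ind by simp
    show "beta z / (1 + w * beta z) \<le> beta z - (beta z * indicator ?I z) / 2" for z
      using score_summand_bounds(3,5)[OF w, of z] w_beta[of z] by (auto simp: indicator_def)
  qed
  also have "\<dots> = (LINT z|std_gaussian. beta z) - (LINT z|std_gaussian. beta z * indicator ?I z) / 2"
    using integrable_beta int_ind by simp
  also have "\<dots> \<le> - (1 / (64 * sqrt (2 * pi)) / a)"
    using expectation_beta_le gain by simp
  finally show ?thesis .
qed

lemma expectation_score_summand_sq_le:
  assumes w: "0 < w" "w \<le> 1"
  shows "(LINT z|std_gaussian. (beta z / (1 + w * beta z))\<^sup>2) \<le> 2 / w"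
proof -
  have int: "integrable std_gaussian (\<lambda>z. (2 + beta z) / w)"
    using integrable_beta by simp
  have "(LINT z|std_gaussian. (beta z / (1 + w * beta z))\<^sup>2) \<le> (LINT z|std_gaussian. (2 + beta z) / w)"
  proof (rule integral_mono[OF _ int])
    show "integrable std_gaussian (\<lambda>z. (beta z / (1 + w * beta z))\<^sup>2)"
    proof (rule Bochner_Integration.integrable_bound[OF int])
      have "norm ((beta z / (1 + w * beta z))\<^sup>2) \<le> norm ((2 + beta z) / w)" for z
        using score_summand_bounds(4)[OF w, of z] by (simp only: real_norm_def abs_power2)
      then show "AE z in std_gaussian. norm ((beta z / (1 + w * beta z))\<^sup>2) \<le> norm ((2 + beta z) / w)"
        by simp
    qed simp
  qed (use score_summand_bounds(4)[OF w] in auto)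
  also have "\<dots> = (2 + (LINT z|std_gaussian. beta z)) / w"
    using integrable_beta std_gaussian.prob_space by simp
  also have "\<dots> \<le> 2 / w"
    using expectation_beta_le w by (intro divide_right_mono) auto
  finally show ?thesis .
qed

lemma score_neg_whp:
  fixes c a :: real
  defines "c \<equiv> 1 / (64 * sqrt (2 * pi))"
  assumes \<theta>: "\<theta> \<in> signal_class n s b" and s: "0 < s" "2 * s \<le> n"
    and a: "1 \<le> a" "4 / c \<le> a" and w_def: "w = a\<^sup>2 * (real s / real n)" and "w \<le> 1"
    and large: "1 \<le> w * beta (2 * a)"
  shows "1 - 32 / (c\<^sup>2 * real s) \<le> measure (obs_law n \<theta>) {x\<in>space (sample_space n). score n x w < 0}"
    (is "_ \<le> measure _ ?E")
proof -
  interpret prob_space "obs_law n \<theta>"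
    by (rule prob_space_obs_law)
  let ?S = "support n \<theta>" and ?N = "{1..n} - support n \<theta>"
  let ?\<psi> = "\<lambda>z. beta z / (1 + w * beta z)"
  define m where "m = real n - real s"
  define \<mu> where "\<mu> = (LINT z|std_gaussian. ?\<psi> z)"
  \<comment> \<open>At least \<open>n / 2\<close> nulls with drift \<open>- c / a\<close> have total
    mean at most \<open>- 2 * d\<close>; the signals add at most
    \<open>s / w = n / a\<^sup>2\<close>, which is at most \<open>d\<close> because
    \<open>4 / c \<le> a\<close>. So a nonnegative score forces a null deviation of at least
    \<open>d\<close>. In the Chebyshev ratio \<open>2 * n / (w * d\<^sup>2)\<close> the factor
    \<open>a\<^sup>2\<close> of \<open>w\<close> cancels, leaving
    \<open>32 / (c\<^sup>2 * s)\<close>.\<close>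
  define d where "d = c * real n / (4 * a)"
  let ?F = "{x\<in>space (sample_space n). d \<le> \<bar>(\<Sum>i\<in>?N. ?\<psi> (x i)) - (\<Sum>i\<in>?N. \<mu>)\<bar>}"
  have n: "0 < real n" "0 < real s" "real s \<le> real n / 2"
    using s by auto
  have c: "0 < c"
    by (simp add: c_def)
  have w: "0 < w"
    using a n by (simp add: w_def)
  note w1 = w \<open>w \<le> 1\<close>
  have d: "0 < d"
    using c n a by (simp add: d_def)
  have card_S: "card ?S = s"
    using \<theta> by (rule signal_classD)
  have card_N: "real (card ?N) = m"
    using card_Diff_subset[OF finite_support support_subset, of n \<theta>] s by (simp add: card_S m_def of_nat_diff)
  have m: "real n / 2 \<le> m" "m \<le> real n"
    using n by (simp_all add: m_def)
  have "\<mu> \<le> - (c / a)"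
    unfolding \<mu>_def c_def by (rule expectation_score_summand_le[OF a(1) w1 large])
  then have "m * \<mu> \<le> m * (- (c / a))"
    using m n by (intro mult_left_mono) auto
  also have "\<dots> \<le> real n / 2 * (- (c / a))"
    using m c a by (intro mult_right_mono_neg) auto
  also have "\<dots> = - 2 * d"
    by (simp add: d_def)
  finally have m\<mu>: "m * \<mu> \<le> - 2 * d" .
  have "s / w = real n / (a * a)"
    using a n by (simp add: w_def power2_eq_square)
  also have "\<dots> \<le> real n * c / (4 * a)"
  proof -
    have "4 \<le> c * a"
      using a(2) c by (simp add: field_simps)
    then have "real n * 4 \<le> real n * (c * a)"
      by (intro mult_left_mono) auto
    then show ?thesis
      using a(1) by (simp add: field_simps)
  qed
  finally have sw: "real s / w \<le> d"
    by (simp add: d_def mult.commute)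
  have sE: "?E \<in> events"
    using measurable_score[of n w, measurable] by measurable
  have N_meas: "(\<lambda>x. \<Sum>i\<in>?N. ?\<psi> (x i)) \<in> borel_measurable (sample_space n)"
  proof (rule borel_measurable_sum)
    fix i assume "i \<in> ?N"
    then have [measurable]: "(\<lambda>x. x i) \<in> sample_space n \<rightarrow>\<^sub>M borel"
      by (intro measurable_component_singleton) auto
    show "(\<lambda>x. ?\<psi> (x i)) \<in> borel_measurable (sample_space n)"
      by measurable
  qed
  have sF: "?F \<in> events"
    using N_meas[measurable] by measurable
  have sub: "space (obs_law n \<theta>) - ?E \<subseteq> ?F"
  proof
    fix x assume x: "x \<in> space (obs_law n \<theta>) - ?E"
    have "(\<Sum>i\<in>?S. ?\<psi> (x i)) \<le> (\<Sum>i\<in>?S. 1 / w)"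
      by (intro sum_mono score_summand_bounds(2)[OF w1])
    also have "\<dots> = real s / w"
      by (simp add: card_S)
    finally have "(\<Sum>i\<in>?S. ?\<psi> (x i)) \<le> d"
      using sw by linarith
    moreover have "0 \<le> score n x w"
      using x by auto
    moreover have "score n x w = (\<Sum>i\<in>?N. ?\<psi> (x i)) + (\<Sum>i\<in>?S. ?\<psi> (x i))"
      unfolding score_def by (rule sum.subset_diff[OF support_subset]) simp
    moreover have "(\<Sum>i\<in>?N. \<mu>) = m * \<mu>"
      using card_N by simp
    ultimately have "d \<le> (\<Sum>i\<in>?N. ?\<psi> (x i)) - (\<Sum>i\<in>?N. \<mu>)"
      using m\<mu> by linarith
    then have "d \<le> \<bar>(\<Sum>i\<in>?N. ?\<psi> (x i)) - (\<Sum>i\<in>?N. \<mu>)\<bar>"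
      by linarith
    then show "x \<in> ?F"
      using x by simp
  qed
  have "1 - prob ?E = prob (space (obs_law n \<theta>) - ?E)"
    using prob_compl[OF sE] by (rule sym)
  also have "\<dots> \<le> prob ?F"
    by (rule finite_measure_mono[OF sub sF])
  also have "\<dots> \<le> (\<Sum>i\<in>?N. 2 / w) / d\<^sup>2"
  proof (rule obs_law_Chebyshev[where f = "\<lambda>_. ?\<psi>" and B = "1 / w"])
    show "\<bar>?\<psi> z\<bar> \<le> 1 / w" for z
    proof -
      have "1 \<le> 1 / w"
        using w1 by simp
      then show ?thesis
        using score_summand_bounds(1,2)[OF w1, of z] by linarith
    qed
  next
    fix i assume "i \<in> ?N"
    then have "\<theta> i = 0"
      by (auto simp: support_def)
    then show "(LINT z|std_gaussian. ?\<psi> (\<theta> i + z)) = \<mu>"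
      and "(LINT z|std_gaussian. (?\<psi> (\<theta> i + z))\<^sup>2) \<le> 2 / w"
      using expectation_score_summand_sq_le[OF w1] by (simp_all add: \<mu>_def)
  qed (use d in auto)
  also have "(\<Sum>i\<in>?N. 2 / w) = m * (2 / w)"
    using card_N by simp
  also have "\<dots> / d\<^sup>2 \<le> real n * (2 / w) / d\<^sup>2"
    using m w by (intro divide_right_mono mult_right_mono) auto
  also have "\<dots> = 32 / (c\<^sup>2 * real s)"
    using n c a(1) by (simp add: d_def w_def power2_eq_square field_simps)
  finally show ?thesis
    by simp
qed

text \<open>Each hit contributes at least \<open>1 / (2 * w)\<close> and every other coordinate at
  least \<open>- 1\<close>, so more than \<open>2 * w * n\<close> hits make the score positive at
  \<open>w\<close>, hence also to its left. If \<open>w\<close> is below \<open>1 / n\<close>, the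
  range of the maximiser already gives the claim.\<close>

lemma what_ge_of_hits:
  assumes mm: "mmle_weight what" "x \<in> space (sample_space n)" and w: "0 < w" "w \<le> 1"
    and large: "1 \<le> w * beta v" "0 \<le> v" and hits: "2 * w * real n < hits I v x" and I: "I \<subseteq> {1..n}"
  shows "w \<le> what n x"
proof (cases "1 / real n \<le> w")
  case True
  have "1 / (2 * w) * of_bool (v \<le> \<bar>x i\<bar>) - 1 \<le> beta (x i) / (1 + w * beta (x i))" for i
  proof (cases "v \<le> \<bar>x i\<bar>")
    case True
    then have "w * beta v \<le> w * beta (x i)"
      using w large(2) by (intro mult_left_mono beta_mono) auto
    then have "1 \<le> w * beta (x i)"
      using large(1) by linarith
    then show ?thesis
      using score_summand_bounds(6)[OF w, of "x i"] True by simp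
  next
    case False
    then show ?thesis
      using score_summand_bounds(1)[OF w, of "x i"] by simp
  qed
  then have "(\<Sum>i=1..n. 1 / (2 * w) * of_bool (v \<le> \<bar>x i\<bar>) - 1) \<le> score n x w"
    unfolding score_def by (intro sum_mono)
  also have "(\<Sum>i=1..n. 1 / (2 * w) * of_bool (v \<le> \<bar>x i\<bar>) - 1) = 1 / (2 * w) * hits {1..n} v x - real n"
    by (simp only: sum_subtractf hits_def sum_distrib_left) simp
  finally have "1 / (2 * w) * hits {1..n} v x - real n \<le> score n x w" .
  moreover have "hits I v x \<le> hits {1..n} v x"
    unfolding hits_def using I by (intro sum_mono2) auto
  then have "2 * w * real n < hits {1..n} v x"
    using hits by linarith
  then have "real n < 1 / (2 * w) * hits {1..n} v x"
    using w by (simp add: field_simps)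
  ultimately have pos: "0 < score n x w"
    by linarith
  show ?thesis
  proof (rule what_ge[OF mm True w(2)])
    fix w' assume "0 \<le> w'" "w' < w"
    then show "0 < score n x w'"
      using score_antimono[of w' w n x] w pos by simp
  qed
next
  case False
  then show ?thesis
    using mmle_weightD(1)[OF mm] by linarith
qed

text \<open>Collects what is required of the boundary in one real variable \<open>a\<close>, with
  exp(- a^2/2) in place of \<open>s / n\<close>. Once \<open>beta\<close> is unfolded at the nonzero
  points \<open>2 * a\<close> and \<open>a + \<delta>\<close>, every item is an elementary
  limit.\<close>

lemma l_value_asymptotics:
  fixes \<delta> \<eta> \<kappa> M t :: real
  assumes "0 < \<delta>" "0 < \<eta>" "0 < \<kappa>" "0 < t" "t < 1"
  shows "eventually (\<lambda>a::real. 1 \<le> a \<and> C \<le> a \<and> 2 \<le> exp (a\<^sup>2 / 2) \<and>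
      a\<^sup>2 * exp (- a\<^sup>2 / 2) \<le> 1 / 2 \<and> 1 \<le> a\<^sup>2 * exp (- a\<^sup>2 / 2) * beta (2 * a) \<and>
      1 / t \<le> exp (- a\<^sup>2 / 2 - a * \<delta> / 2) * beta (a + \<delta>) \<and> 8 / \<kappa> \<le> exp (a * \<delta> / 2) \<and>
      0 < a\<^sup>2 - 2 * M \<and> a\<^sup>2 / (a\<^sup>2 - 2 * M) < 2 \<and> exp M / sqrt (a\<^sup>2 - 2 * M) \<le> \<eta>) at_top"
proof -
  have top: "eventually (\<lambda>a. K \<le> f a) at_top" if "filterlim f at_top at_top" for K :: real and f :: "real \<Rightarrow> real"
    using that by (simp add: filterlim_at_top)
  have "eventually (\<lambda>a::real. 1 \<le> a) at_top" "eventually (\<lambda>a::real. C \<le> a) at_top"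
    by (rule eventually_ge_at_top)+
  moreover have "eventually (\<lambda>a::real. 2 \<le> exp (a\<^sup>2 / 2)) at_top"
    by real_asymp
  moreover have "eventually (\<lambda>a::real. a\<^sup>2 * exp (- a\<^sup>2 / 2) \<le> 1 / 2) at_top"
    by real_asymp
  moreover have "filterlim (\<lambda>a::real. a\<^sup>2 * exp (- a\<^sup>2 / 2) * ((exp ((2 * a)\<^sup>2 / 2) - 1) / (2 * a)\<^sup>2 - 1)) at_top at_top"
    by real_asymp
  note top[OF this, of 1]
  moreover have "filterlim (\<lambda>a::real. exp (- a\<^sup>2 / 2 - a * \<delta> / 2) * ((exp ((a + \<delta>)\<^sup>2 / 2) - 1) / (a + \<delta>)\<^sup>2 - 1)) at_top at_top"
    using \<open>0 < \<delta>\<close> by real_asymp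
  note top[OF this, of "1 / t"]
  moreover have "filterlim (\<lambda>a::real. exp (a * \<delta> / 2)) at_top at_top"
    using \<open>0 < \<delta>\<close> by real_asymp
  note top[OF this, of "8 / \<kappa>"]
  moreover have "filterlim (\<lambda>a::real. a\<^sup>2 - 2 * M) at_top at_top"
    by real_asymp
  note top[OF this, of 1]
  moreover have "((\<lambda>a::real. a\<^sup>2 / (a\<^sup>2 - 2 * M)) \<longlongrightarrow> 1) at_top"
    by real_asymp
  then have "eventually (\<lambda>a::real. a\<^sup>2 / (a\<^sup>2 - 2 * M) < 2) at_top"
    by (rule order_tendstoD) simp
  moreover have "((\<lambda>a::real. exp M / sqrt (a\<^sup>2 - 2 * M)) \<longlongrightarrow> 0) at_top"
    by real_asymp
  then have "eventually (\<lambda>a::real. exp M / sqrt (a\<^sup>2 - 2 * M) < \<eta>) at_top"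
    using \<open>0 < \<eta>\<close> by (rule order_tendstoD)
  ultimately show ?thesis
  proof eventually_elim
    case (elim a)
    then have "2 * a \<noteq> 0" "a + \<delta> \<noteq> 0"
      using \<open>0 < \<delta>\<close> by auto
    note beta_nonzero[OF this(1)] beta_nonzero[OF this(2)]
    then show ?case
      using elim by (simp only:) (intro conjI; (assumption | linarith | simp))
  qed
qed

lemma concentrated_thresholds_l_value:
  assumes mm: "mmle_weight what" and t: "0 < t" "t < 1"
    and s: "sparse_regime s" and b: "boundary_regime b"
  shows "concentrated_thresholds (l_value_procedure what t) s b"
  unfolding concentrated_thresholds_def
proof (intro allI impI)
  fix \<delta> \<eta> :: real assume pos: "0 < \<delta>" "0 < \<eta>"
  obtain B where B: "eventually (\<lambda>n. B \<le> b n) sequentially"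
    using boundary_regime_bounded_below[OF b] .
  define \<kappa> where "\<kappa> = gauss_tail (ereal (\<delta> - B))"
  define c where "c = 1 / (64 * sqrt (2 * pi))"
  \<comment> \<open>The 4 absorbs two factors 2, from
    \<open>a\<^sup>2 / (a\<^sup>2 - 2 * M) < 2\<close> and from
    \<open>1 - what n x \<ge> 1 / 2\<close>; with it a rejection below \<open>u\<close> leads to a
    strict inequality between two sides bounded by \<open>(1 - t) / 2\<close> in opposite
    directions.\<close>
  define M where "M = ln (4 * t / (1 - t))"
  have \<kappa>: "0 < \<kappa>"
    by (simp add: \<kappa>_def gauss_tail_pos)
  have c: "0 < c"
    by (simp add: c_def)
  have exp_M: "exp (- M) = (1 - t) / (4 * t)"
    using t by (simp add: M_def exp_minus)
  have large_s: "eventually (\<lambda>n. K \<le> real (s n)) sequentially" for K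
    using sparse_regimeD(1)[OF s] by (simp add: filterlim_at_top)
  have "eventually (\<lambda>n. 4 / \<kappa>\<^sup>2 * 2 / \<eta> \<le> real (s n)) sequentially"
    "eventually (\<lambda>n. 32 / c\<^sup>2 * 2 / \<eta> \<le> real (s n)) sequentially"
    by (rule large_s)+
  then show "eventually (\<lambda>n. \<exists>u. real n * gauss_tail (ereal u) \<le> \<eta> * real (s n) \<and>
       (\<forall>\<theta>\<in>signal_class n (s n) (b n). \<exists>A.
          threshold_event n (l_value_procedure what t n) u (boundary n (s n) + \<delta>) A \<and>
          1 - \<eta> \<le> measure (obs_law n \<theta>) A)) sequentially"
    using B sparse_regimeD(4)[OF s]
      eventually_compose_filterlim[OF l_value_asymptotics[OF pos \<kappa> t, of "4 / c" M] sparse_regimeD(3)[OF s]]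
  proof eventually_elim
    case (elim n)
    define a where "a = boundary n (s n)"
    \<comment> \<open>Solves \<open>wp * exp (u\<^sup>2 / 2) = a\<^sup>2 * exp (- M)\<close>; the
      \<open>a\<^sup>2\<close> cancels asymptotically against the \<open>u\<^sup>2\<close> in
      \<open>1 + beta u \<le> exp (u\<^sup>2 / 2) / u\<^sup>2\<close>. As \<open>u\<^sup>2\<close>
      differs from \<open>a\<^sup>2\<close> by a constant, the Mills bound gives
      \<open>n / s\<close> times the tail at most \<open>exp M / u\<close>, which tends to
      0.\<close>
    define u where "u = sqrt (a\<^sup>2 - 2 * M)"
    define wp where "wp = a\<^sup>2 * (real (s n) / real n)"
    define wm where "wm = real (s n) / real n * exp (- a * \<delta> / 2)"
    note A = elim(5)[folded a_def]
    have sn: "0 < s n" "s n \<le> n" "0 < real (s n)" "0 < real n"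
      using elim(4) by auto
    have ea: "exp (a\<^sup>2 / 2) = real n / real (s n)"
      unfolding a_def using sn by (intro exp_boundary_sq)
    then have ea': "exp (- a\<^sup>2 / 2) = real (s n) / real n"
      using sn by (simp add: exp_minus)
    have u: "0 < u" "u\<^sup>2 = a\<^sup>2 - 2 * M"
      using A by (simp_all add: u_def)
    have eu: "exp (u\<^sup>2 / 2) = real n / real (s n) * exp (- M)"
    proof -
      have "u\<^sup>2 / 2 = a\<^sup>2 / 2 + - M"
        by (simp add: u(2) field_simps)
      then show ?thesis
        by (simp only: exp_add ea)
    qed
    have a1: "1 \<le> a" and aC: "4 / c \<le> a"
      using A by auto
    have wp: "wp \<le> 1 / 2" "1 \<le> wp * beta (2 * a)" "0 < wp"
      using A a1 sn unfolding wp_def ea' by auto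
    have wp_ge: "1 / real n \<le> wp"
    proof -
      have "1 * 1 \<le> a\<^sup>2 * real (s n)"
        using a1 sn by (intro mult_mono) auto
      then show ?thesis
        using sn by (simp add: wp_def divide_right_mono)
    qed
    have wm_eq: "wm = exp (- a\<^sup>2 / 2 - a * \<delta> / 2)"
    proof -
      have "- a\<^sup>2 / 2 - a * \<delta> / 2 = - a\<^sup>2 / 2 + - a * \<delta> / 2"
        by simp
      then show ?thesis
        by (simp only: wm_def exp_add ea')
    qed
    have wm: "0 < wm" "wm \<le> 1" "1 / t \<le> wm * beta (a + \<delta>)"
    proof -
      have "0 \<le> a * \<delta>"
        using a1 pos by simp
      then have "- a\<^sup>2 / 2 - a * \<delta> / 2 \<le> 0"
        using zero_le_power2[of a] by linarith
      then show "wm \<le> 1"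
        unfolding wm_eq by simp
    qed (use A in \<open>auto simp: wm_eq\<close>)
    have half: "2 * s n \<le> n"
    proof -
      have "2 \<le> real n / real (s n)"
        using A unfolding ea by auto
      then show ?thesis
        using sn by (simp add: field_simps)
    qed
    have tail: "real n * gauss_tail (ereal u) \<le> \<eta> * real (s n)"
    proof -
      have "gauss_tail (ereal u) \<le> std_normal_density u / u"
        by (rule gauss_tail_le_mills[OF u(1)])
      also have "\<dots> \<le> exp (- u\<^sup>2 / 2) / u"
        using u(1) by (intro divide_right_mono std_normal_density_le_exp) auto
      also have "exp (- u\<^sup>2 / 2) = real (s n) / real n * exp M"
        using eu sn by (simp add: exp_minus field_simps)
      finally have "gauss_tail (ereal u) \<le> real (s n) / real n * (exp M / u)"
        by simp
      also have "\<dots> \<le> real (s n) / real n * \<eta>"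
        using A unfolding u_def by (intro mult_left_mono) auto
      finally show ?thesis
        using sn by (simp add: field_simps)
    qed
    show ?case
    proof (intro exI[of _ u] conjI tail ballI)
      fix \<theta> assume \<theta>: "\<theta> \<in> signal_class n (s n) (b n)"
      interpret prob_space "obs_law n \<theta>"
        by (rule prob_space_obs_law)
      define D where "D = {x\<in>space (sample_space n). \<kappa> * real (s n) / 2 \<le> hits (support n \<theta>) (a + \<delta>) x}"
      define E where "E = {x\<in>space (sample_space n). score n x wp < 0}"
      have D: "1 - 4 / (\<kappa>\<^sup>2 * real (s n)) \<le> prob D"
        unfolding D_def a_def \<kappa>_def by (rule detections_whp[OF \<theta> elim(3) sn(1)])
      have E: "1 - 32 / (c\<^sup>2 * real (s n)) \<le> prob E"
        unfolding E_def c_def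
        by (rule score_neg_whp[OF \<theta> sn(1) half a1 aC[unfolded c_def] wp_def _ wp(2)]) (use wp(1) in simp)
      have sD: "D \<in> events"
        unfolding D_def using sets_hits_ge[OF support_subset[of n \<theta>], where c = "\<kappa> * real (s n) / 2" and u = "a + \<delta>"]
        by (simp only: sets_obs_law)
      have sE: "E \<in> events"
        unfolding E_def using measurable_score[of n wp, measurable] by measurable
      have "1 - prob (D \<inter> E) = prob (space (obs_law n \<theta>) - (D \<inter> E))"
        using sD sE by (intro prob_compl[symmetric]) auto
      also have "\<dots> = prob ((space (obs_law n \<theta>) - D) \<union> (space (obs_law n \<theta>) - E))"
        by (simp only: Diff_Int)
      also have "\<dots> \<le> prob (space (obs_law n \<theta>) - D) + prob (space (obs_law n \<theta>) - E)"
        using sD sE by (intro measure_Un_le) auto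
      also have "\<dots> = (1 - prob D) + (1 - prob E)"
        using prob_compl[OF sD] prob_compl[OF sE] by simp
      also have "\<dots> \<le> 4 / (\<kappa>\<^sup>2 * real (s n)) + 32 / (c\<^sup>2 * real (s n))"
        using D E by simp
      also have "4 / (\<kappa>\<^sup>2 * real (s n)) \<le> \<eta> / 2"
        using elim(1) \<kappa> pos sn by (simp add: field_simps)
      also have "32 / (c\<^sup>2 * real (s n)) \<le> \<eta> / 2"
        using elim(2) c pos sn by (simp add: field_simps)
      finally have prob: "1 - \<eta> \<le> prob (D \<inter> E)"
        by simp
      have event: "threshold_event n (l_value_procedure what t n) u (a + \<delta>) (D \<inter> E)"
        unfolding threshold_event_def
      proof (intro conjI ballI)
        show "D \<inter> E \<in> sets (sample_space n)"
          using sD sE by auto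
        fix x i assume x: "x \<in> D \<inter> E" and i: "i \<in> {1..n}"
        have xs: "x \<in> space (sample_space n)"
          using x by (auto simp: D_def)
        note W = mmle_weightD[OF mm xs]
        have reject: "l_value_procedure what t n x i = 1 \<longleftrightarrow>
            (1 - what n x) * (1 - t) < t * what n x * (1 + beta (x i))"
          using i l_value_less_iff[OF W(3,2)] by (simp add: l_value_procedure_def)
        show "a + \<delta> \<le> \<bar>x i\<bar> \<longrightarrow> l_value_procedure what t n x i = 1"
        proof
          assume hit: "a + \<delta> \<le> \<bar>x i\<bar>"
          \<comment> \<open>It makes \<open>2 * wm * n\<close>, which is
            \<open>2 * s * exp (- a * \<delta> / 2)\<close>, at most half of the guaranteed
            \<open>\<kappa> * s / 2\<close> detections.\<close>
          have "8 / \<kappa> \<le> exp (a * \<delta> / 2)"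
            using A by blast
          then have "8 \<le> \<kappa> * exp (a * \<delta> / 2)"
            using \<kappa> by (simp add: field_simps)
          then have "2 * wm * real n < \<kappa> * real (s n) / 2"
            using sn by (simp add: wm_def exp_minus field_simps)
          also have "\<dots> \<le> hits (support n \<theta>) (a + \<delta>) x"
            using x by (simp add: D_def)
          finally have "2 * wm * real n < hits (support n \<theta>) (a + \<delta>) x" .
          moreover have "1 \<le> wm * beta (a + \<delta>)"
          proof -
            have "1 \<le> 1 / t"
              using t by simp
            then show ?thesis
              using wm(3) by linarith
          qed
          ultimately have ge: "wm \<le> what n x"
            using a1 pos by (intro what_ge_of_hits[OF mm xs wm(1,2) _ _ _ support_subset]) auto
          have "beta (a + \<delta>) \<le> beta (x i)"
            using hit a1 pos by (intro beta_mono) auto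
          moreover have b_pos: "0 < beta (a + \<delta>)"
          proof -
            have "0 < 1 / t"
              using t by simp
            then have "0 < wm * beta (a + \<delta>)"
              using wm(3) by linarith
            then show ?thesis
              using wm(1) by (simp add: zero_less_mult_iff)
          qed
          ultimately have "wm * beta (a + \<delta>) \<le> what n x * (1 + beta (x i))"
            using ge wm(1) by (intro mult_mono) auto
          then have "t * (1 / t) \<le> t * (what n x * (1 + beta (x i)))"
            using wm(3) t by (intro mult_left_mono) auto
          then have "1 \<le> t * what n x * (1 + beta (x i))"
            using t by (simp add: mult.assoc)
          have "(1 - what n x) * (1 - t) \<le> 1 * (1 - t)"
            using W t by (intro mult_right_mono) auto
          also have "\<dots> < 1"
            using t by simp
          also note \<open>1 \<le> t * what n x * (1 + beta (x i))\<close>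
          finally show "l_value_procedure what t n x i = 1"
            unfolding reject .
        qed
        show "l_value_procedure what t n x i = 1 \<longrightarrow> u \<le> \<bar>x i\<bar>"
        proof (rule impI, rule ccontr)
          assume rej: "l_value_procedure what t n x i = 1" and "\<not> u \<le> \<bar>x i\<bar>"
          have le: "what n x \<le> wp"
            using x wp(1) by (intro what_le[OF mm xs wp_ge]) (auto simp: E_def)
          have "beta (x i) \<le> beta u"
            using \<open>\<not> u \<le> \<bar>x i\<bar>\<close> u(1) by (intro beta_mono) auto
          also have "1 + beta u \<le> exp (u\<^sup>2 / 2) / u\<^sup>2"
            using u(1) by (simp add: beta_nonzero divide_right_mono)
          finally have "1 + beta (x i) \<le> exp (u\<^sup>2 / 2) / u\<^sup>2"
            by linarith
          moreover have "0 \<le> 1 + beta (x i)"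
            using beta_ge[of "x i"] by linarith
          ultimately have "what n x * (1 + beta (x i)) \<le> wp * (exp (u\<^sup>2 / 2) / u\<^sup>2)"
            using le W(3) wp(3) by (intro mult_mono) auto
          also have "\<dots> = a\<^sup>2 / (a\<^sup>2 - 2 * M) * exp (- M)"
            using sn by (simp add: eu wp_def) (simp add: u(2))
          also have "\<dots> \<le> 2 * exp (- M)"
            using A by (intro mult_right_mono) auto
          finally have "t * (what n x * (1 + beta (x i))) \<le> t * (2 * exp (- M))"
            using t by (intro mult_left_mono) auto
          also have "\<dots> = (1 - t) / 2"
            using t by (simp add: exp_M)
          also have "\<dots> \<le> (1 - what n x) * (1 - t)"
          proof -
            have "1 / 2 * (1 - t) \<le> (1 - what n x) * (1 - t)"
              using le wp(1) t by (intro mult_right_mono) auto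
            then show ?thesis
              by simp
          qed
          finally show False
            using rej unfolding reject by (simp add: mult.assoc)
        qed
      qed
      show "\<exists>A. threshold_event n (l_value_procedure what t n) u (boundary n (s n) + \<delta>) A \<and> 1 - \<eta> \<le> prob A"
        using prob event unfolding a_def by blast
    qed
  qed
qed

section \<open>The Benjamini--Hochberg procedure\<close>

lemma gauss_tail_strict_antimono:
  assumes "x < y"
  shows "gauss_tail (ereal y) < gauss_tail (ereal x)"
proof -
  let ?c = "std_normal_density (max \<bar>x\<bar> \<bar>y\<bar>)"
  have "?c * (y - x) \<le> measure std_gaussian {x..y}"
  proof (rule measure_std_gaussian_interval_ge)
    fix z assume "z \<in> {x..y}"
    then have "z\<^sup>2 \<le> (max \<bar>x\<bar> \<bar>y\<bar>)\<^sup>2"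
      by (intro abs_le_square_iff[THEN iffD1]) auto
    then show "?c \<le> std_normal_density z"
      by (simp add: std_normal_density_def divide_right_mono)
  qed (use assms in auto)
  moreover have "0 < ?c * (y - x)"
    using assms by (simp add: normal_density_pos)
  moreover have "measure std_gaussian ({x..y} \<union> {y<..}) = measure std_gaussian {x..y} + measure std_gaussian {y<..}"
    by (rule std_gaussian.finite_measure_Union) auto
  moreover have "{x..y} \<union> {y<..} = {x..}"
    using assms by auto
  ultimately show ?thesis
    by (simp add: gauss_tail_atLeast[of x] gauss_tail_greaterThan[of y])
qed

lemma gauss_tail_le_iff: "gauss_tail (ereal x) \<le> gauss_tail (ereal y) \<longleftrightarrow> y \<le> x"
  using gauss_tail_strict_antimono[of x y] gauss_tail_antimono[of "ereal y" "ereal x"]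
  by (cases "y \<le> x") auto

section \<open>Quantiles and the step-up form of the BH threshold\<close>

definition upper_quantile :: "real \<Rightarrow> real" where
  "upper_quantile p = (SOME t. 0 < t \<and> gauss_tail (ereal t) = p)"

lemma gauss_tail_upper_quantile:
  assumes "0 < p" "p < 1 / 2"
  shows "gauss_tail (ereal (upper_quantile p)) = p"
  using someI_ex[of "\<lambda>t. 0 < t \<and> gauss_tail (ereal t) = p"] ex_gauss_tail_eq[OF assms]
  unfolding upper_quantile_def by blast

lemma hits_eq_card: "hits {1..n} r x = real (card {i\<in>{1..n}. ereal r \<le> ereal \<bar>x i\<bar>})"
  by (simp add: hits_def Int_def)

lemma hits_antimono: "r \<le> r' \<Longrightarrow> hits I r' x \<le> hits I r x"
  unfolding hits_def by (intro sum_mono) auto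

text \<open>
  The critical values of the step-up formulation: the BH threshold is the smallest
  \<^term>\<open>bh_critical n \<alpha> k\<close> that is exceeded by at least \<^term>\<open>k\<close> observations.
\<close>

definition bh_critical :: "nat \<Rightarrow> real \<Rightarrow> nat \<Rightarrow> real" where
  "bh_critical n \<alpha> k = upper_quantile (\<alpha> * real k / (2 * real n))"

lemma gauss_tail_bh_critical:
  assumes "0 < \<alpha>" "\<alpha> < 1" "k \<in> {1..n}"
  shows "gauss_tail (ereal (bh_critical n \<alpha> k)) = \<alpha> * real k / (2 * real n)"
  unfolding bh_critical_def
proof (rule gauss_tail_upper_quantile)
  have k: "0 < real k" "real k \<le> real n"
    using assms(3) by auto
  then show "0 < \<alpha> * real k / (2 * real n)"
    using assms(1) by simp
  have "\<alpha> * real k < 1 * real k"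
    using assms k by (intro mult_strict_right_mono) auto
  then have "\<alpha> * real k < real n"
    using k(2) by linarith
  then show "\<alpha> * real k / (2 * real n) < 1 / 2"
    using k by (simp add: field_simps)
qed

text \<open>A finite set containing the BH threshold, so that a least element over the extended
  reals becomes a \<open>Min\<close>, and statements about it become finite disjunctions.\<close>

definition bh_candidates :: "nat \<Rightarrow> real \<Rightarrow> (nat \<Rightarrow> real) \<Rightarrow> ereal set" where
  "bh_candidates n \<alpha> x = insert \<infinity> ((\<lambda>k. ereal (bh_critical n \<alpha> k)) `
     {k\<in>{1..n}. real k \<le> hits {1..n} (bh_critical n \<alpha> k) x})"

definition bh_admissible :: "nat \<Rightarrow> real \<Rightarrow> (nat \<Rightarrow> real) \<Rightarrow> ereal \<Rightarrow> bool" where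
  "bh_admissible n \<alpha> x t \<longleftrightarrow> t \<noteq> - \<infinity> \<and>
     2 * gauss_tail t / \<alpha> \<le> real (card {i\<in>{1..n}. t \<le> ereal \<bar>x i\<bar>}) / real n"

lemma bh_admissible_ereal:
  "bh_admissible n \<alpha> x (ereal r) \<longleftrightarrow> 2 * gauss_tail (ereal r) / \<alpha> \<le> hits {1..n} r x / real n"
  by (simp only: bh_admissible_def hits_eq_card) simp

lemma bh_candidates_admissible:
  assumes "0 < \<alpha>" "\<alpha> < 1" "t \<in> bh_candidates n \<alpha> x"
  shows "bh_admissible n \<alpha> x t"
proof (cases "t = \<infinity>")
  case True
  then show ?thesis
    by (simp add: bh_admissible_def)
next
  case False
  then obtain k where k: "k \<in> {1..n}" "real k \<le> hits {1..n} (bh_critical n \<alpha> k) x"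
    and t: "t = ereal (bh_critical n \<alpha> k)"
    using assms(3) by (auto simp: bh_candidates_def)
  have "2 * gauss_tail (ereal (bh_critical n \<alpha> k)) / \<alpha> = real k / real n"
    using gauss_tail_bh_critical[OF assms(1,2) k(1)] assms(1) by simp
  then show ?thesis
    unfolding t bh_admissible_ereal using k(2) by (simp add: divide_right_mono)
qed

text \<open>If an admissible real \<open>r\<close> is exceeded by \<open>k\<close> observations,
  positivity of the tail forces \<open>k\<close> to be at least 1, and admissibility puts
  \<open>r\<close> at or above the critical value of this \<open>k\<close>. Lowering
  \<open>r\<close> to that value can only add exceedances. The value infinity is itself a
  candidate.\<close>

lemma bh_candidates_below:
  assumes \<alpha>: "0 < \<alpha>" "\<alpha> < 1" and t: "bh_admissible n \<alpha> x t"
  shows "\<exists>t'\<in>bh_candidates n \<alpha> x. t' \<le> t"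
proof (cases t)
  case (real r)
  define k where "k = card {i\<in>{1..n}. ereal r \<le> ereal \<bar>x i\<bar>}"
  have adm: "2 * gauss_tail (ereal r) / \<alpha> \<le> real k / real n"
    using t unfolding real bh_admissible_def k_def by simp
  moreover have "0 < 2 * gauss_tail (ereal r) / \<alpha>"
    using \<alpha> gauss_tail_pos[of r] by simp
  ultimately have "0 < real k / real n"
    by linarith
  then have "0 < k" "0 < n"
    by (auto simp: zero_less_divide_iff)
  moreover have "k \<le> card {1..n}"
    unfolding k_def by (intro card_mono) auto
  ultimately have k: "k \<in> {1..n}"
    by simp
  have "gauss_tail (ereal r) \<le> \<alpha> * real k / (2 * real n)"
    using adm \<alpha> \<open>0 < n\<close> by (simp add: field_simps)
  then have "bh_critical n \<alpha> k \<le> r"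
    by (simp only: gauss_tail_bh_critical[OF \<alpha> k, symmetric] gauss_tail_le_iff)
  moreover from hits_antimono[OF this] have "real k \<le> hits {1..n} (bh_critical n \<alpha> k) x"
    unfolding k_def hits_eq_card[symmetric] .
  ultimately show ?thesis
    using k real unfolding bh_candidates_def by (intro bexI[of _ "ereal (bh_critical n \<alpha> k)"]) auto
qed (use t in \<open>auto simp: bh_candidates_def bh_admissible_def\<close>)

lemma BH_threshold_eq:
  assumes "0 < \<alpha>" "\<alpha> < 1"
  shows "BH_threshold n \<alpha> x = Min (bh_candidates n \<alpha> x)"
proof -
  have fin: "finite (bh_candidates n \<alpha> x)" "bh_candidates n \<alpha> x \<noteq> {}"
    by (auto simp: bh_candidates_def)
  have "BH_threshold n \<alpha> x = (LEAST t. bh_admissible n \<alpha> x t)"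
    by (simp only: BH_threshold_def bh_admissible_def)
  also have "\<dots> = Min (bh_candidates n \<alpha> x)"
  proof (rule Least_equality)
    show "bh_admissible n \<alpha> x (Min (bh_candidates n \<alpha> x))"
      by (rule bh_candidates_admissible[OF assms Min_in[OF fin]])
    fix t assume "bh_admissible n \<alpha> x t"
    then obtain t' where "t' \<in> bh_candidates n \<alpha> x" "t' \<le> t"
      using bh_candidates_below[OF assms] by blast
    then show "Min (bh_candidates n \<alpha> x) \<le> t"
      using Min_le[OF fin(1)] by (blast intro: order_trans)
  qed
  finally show ?thesis .
qed

text \<open>Serves twice: a finite union of events on exceedance counts yields measurability, and a
  rejection yields a critical value with enough exceedances.\<close>

lemma BH_threshold_le_iff:
  assumes "0 < \<alpha>" "\<alpha> < 1"
  shows "BH_threshold n \<alpha> x \<le> ereal r \<longleftrightarrow>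
      (\<exists>k\<in>{1..n}. real k \<le> hits {1..n} (bh_critical n \<alpha> k) x \<and> bh_critical n \<alpha> k \<le> r)"
proof -
  have fin: "finite (bh_candidates n \<alpha> x)" "bh_candidates n \<alpha> x \<noteq> {}"
    by (auto simp: bh_candidates_def)
  show ?thesis
    unfolding BH_threshold_eq[OF assms] Min_le_iff[OF fin] by (auto simp: bh_candidates_def)
qed

lemma BH_threshold_le:
  assumes "0 < \<alpha>" "\<alpha> < 1" "2 * gauss_tail (ereal r) / \<alpha> \<le> hits {1..n} r x / real n"
  shows "BH_threshold n \<alpha> x \<le> ereal r"
proof -
  obtain t' where "t' \<in> bh_candidates n \<alpha> x" "t' \<le> ereal r"
    using bh_candidates_below[OF assms(1,2)] assms(3) bh_admissible_ereal by blast
  moreover have "finite (bh_candidates n \<alpha> x)"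
    by (simp add: bh_candidates_def)
  ultimately show ?thesis
    unfolding BH_threshold_eq[OF assms(1,2)] using Min_le by (blast intro: order_trans)
qed

lemma measurable_BH_procedure:
  assumes "0 < \<alpha>" "\<alpha> < 1"
  shows "multiple_testing_procedure n (BH_procedure \<alpha> n)"
  unfolding BH_procedure_def[abs_def]
proof (rule multiple_testing_procedureI)
  fix i assume "i \<in> {1..n}"
  then have [measurable]: "(\<lambda>x. x i) \<in> sample_space n \<rightarrow>\<^sub>M borel"
    by (rule measurable_component_singleton)
  have [measurable]: "hits {1..n} r \<in> borel_measurable (sample_space n)" for r
    by (rule measurable_hits) simp
  show "{x \<in> space (sample_space n). BH_threshold n \<alpha> x \<le> ereal \<bar>x i\<bar>} \<in> sets (sample_space n)"
    unfolding BH_threshold_le_iff[OF assms] by measurable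
qed

text \<open>
  Union bound over a dyadic grid of levels; the failure probabilities decrease geometrically along the
  grid, so the number of levels does not matter.
\<close>

lemma BH_critical_exceedances_whp:
  fixes \<alpha> \<eta> :: real and s :: nat
  defines "k0 \<equiv> 2 * \<eta> * real s / \<alpha>"
  assumes \<theta>: "\<theta> \<in> signal_class n s b" and "0 < s" and \<alpha>: "0 < \<alpha>" "\<alpha> \<le> 1 / 8" "\<alpha> \<le> \<eta> / 2"
  shows "\<exists>A\<in>sets (sample_space n). 1 - 2 / k0 \<le> measure (obs_law n \<theta>) A \<and>
      (\<forall>x\<in>A. \<forall>k\<in>{1..n}. k0 \<le> real k \<longrightarrow> hits {1..n} (bh_critical n \<alpha> k) x < real k)"
proof -
  interpret prob_space "obs_law n \<theta>"
    by (rule prob_space_obs_law)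
  let ?S = "support n \<theta>" and ?N = "{1..n} - support n \<theta>"
  have "0 < \<eta>"
    using \<alpha> by linarith
  have k0: "0 < k0"
    using \<open>0 < \<eta>\<close> \<alpha> \<open>0 < s\<close> by (simp add: k0_def)
  \<comment> \<open>Equivalent to \<open>\<alpha> \<le> \<eta> / 2\<close>. All \<open>s\<close>
    signals together then account for at most a quarter of any count under consideration.\<close>
  have s_le: "4 * real s \<le> k0"
  proof -
    have "2 * \<alpha> * real s \<le> \<eta> * real s"
      using \<alpha> by (intro mult_right_mono) auto
    then show ?thesis
      unfolding k0_def using \<alpha> by (simp add: field_simps)
  qed
  have k0_ge: "1 \<le> k0"
    using s_le \<open>0 < s\<close> by linarith
  define K where "K j = 2 ^ j * k0" for j :: nat
  define J where "J = {j\<in>{..n}. K j \<le> real n}"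
  \<comment> \<open>The tail \<open>\<alpha> * K j / n\<close> belongs to the critical value of
    \<open>2 * K j\<close>, so \<open>G j\<close> lies below the critical value of every
    \<open>k\<close> in the block from \<open>K j\<close> up to \<open>2 * K j\<close>.\<close>
  define G where "G j = upper_quantile (\<alpha> * K j / real n)" for j
  define F where "F j = {x\<in>space (sample_space n). K j - real s \<le> hits ?N (G j) x}" for j
  have K: "0 < K j" "k0 \<le> K j" for j
    using k0 by (simp_all add: K_def)
  have N: "?N \<subseteq> {1..n}"
    by auto
  have G: "gauss_tail (ereal (G j)) = \<alpha> * K j / real n" if "j \<in> J" for j
    unfolding G_def
  proof (rule gauss_tail_upper_quantile)
    have n: "0 < real n" "K j \<le> real n"
      using that K(1)[of j] by (auto simp: J_def)
    then show "0 < \<alpha> * K j / real n"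
      using \<alpha> K(1)[of j] by simp
    have "\<alpha> * K j \<le> 1 / 8 * real n"
      using \<alpha> n K(1)[of j] by (intro mult_mono) auto
    then show "\<alpha> * K j / real n < 1 / 2"
      using n by (simp add: field_simps)
  qed
  have sF: "F j \<in> events" for j
    unfolding F_def using sets_hits_ge[OF N] by (simp only: sets_obs_law)
  have PF: "prob (F j) \<le> (1 / 2) ^ j / k0" if j: "j \<in> J" for j
  proof -
    define \<mu> where "\<mu> = (\<Sum>i\<in>?N. measure std_gaussian {z. G j \<le> \<bar>\<theta> i + z\<bar>})"
    have n: "0 < real n"
      using j K(1)[of j] by (auto simp: J_def)
    have "\<mu> \<le> (\<Sum>i\<in>?N. 2 * gauss_tail (ereal (G j)))"
      unfolding \<mu>_def
    proof (rule sum_mono)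
      fix i assume "i \<in> ?N"
      then have "\<theta> i = 0"
        by (auto simp: support_def)
      then show "measure std_gaussian {z. G j \<le> \<bar>\<theta> i + z\<bar>} \<le> 2 * gauss_tail (ereal (G j))"
        using gauss_tail_two_sided[of "G j"] by simp
    qed
    also have "\<dots> \<le> real n * (2 * gauss_tail (ereal (G j)))"
      using card_mono[OF _ N] by (simp add: mult_right_mono)
    also have "\<dots> = 2 * \<alpha> * K j"
      using n by (simp add: G[OF j])
    also have "\<dots> \<le> 1 / 4 * K j"
      using \<alpha> K(1)[of j] by (intro mult_right_mono) auto
    finally have \<mu>: "\<mu> \<le> K j / 4"
      by simp
    \<comment> \<open>On \<open>F j\<close> there are at least three quarters of \<open>K j\<close>
      null exceedances, while their mean is at most a quarter of \<open>K j\<close>.\<close>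
    have "prob (F j) \<le> prob {x\<in>space (sample_space n). K j / 2 \<le> \<bar>hits ?N (G j) x - \<mu>\<bar>}"
    proof (rule finite_measure_mono)
      show "F j \<subseteq> {x\<in>space (sample_space n). K j / 2 \<le> \<bar>hits ?N (G j) x - \<mu>\<bar>}"
      proof
        fix x assume x: "x \<in> F j"
        then have "K j - real s \<le> hits ?N (G j) x"
          by (simp add: F_def)
        then have "K j / 2 \<le> \<bar>hits ?N (G j) x - \<mu>\<bar>"
          using \<mu> s_le K(2)[of j] by linarith
        then show "x \<in> {x\<in>space (sample_space n). K j / 2 \<le> \<bar>hits ?N (G j) x - \<mu>\<bar>}"
          using x by (simp add: F_def)
      qed
      show "{x\<in>space (sample_space n). K j / 2 \<le> \<bar>hits ?N (G j) x - \<mu>\<bar>} \<in> events"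
        using measurable_hits[OF N, of "G j", measurable] by measurable
    qed
    also have "\<dots> \<le> \<mu> / (K j / 2)\<^sup>2"
      unfolding \<mu>_def by (rule hits_Chebyshev[OF N]) (use K(1)[of j] in simp)
    also have "\<dots> \<le> K j / 4 / (K j / 2)\<^sup>2"
      using \<mu> by (intro divide_right_mono) auto
    also have "\<dots> = 1 / K j"
      using K(1)[of j] by (simp add: power2_eq_square)
    also have "\<dots> = (1 / 2) ^ j / k0"
      by (simp add: K_def power_one_over field_simps)
    finally show ?thesis .
  qed
  define A where "A = space (obs_law n \<theta>) - (\<Union>j\<in>J. F j)"
  have fin: "finite J"
    by (simp add: J_def)
  have sU: "(\<Union>j\<in>J. F j) \<in> events"
    using fin sF by (intro sets.finite_UN) auto
  have sA: "A \<in> events"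
    unfolding A_def using sU by auto
  have "prob (\<Union>j\<in>J. F j) \<le> (\<Sum>j\<in>J. prob (F j))"
    using fin sF by (intro finite_measure_subadditive_finite) auto
  also have "\<dots> \<le> (\<Sum>j\<in>J. (1 / 2) ^ j / k0)"
    by (intro sum_mono PF)
  also have "\<dots> \<le> (\<Sum>j\<in>{..n}. (1 / 2) ^ j / k0)"
    using k0 by (intro sum_mono2) (auto simp: J_def)
  also have "\<dots> = (\<Sum>j\<in>{..n}. (1 / 2 :: real) ^ j) / k0"
    by (simp only: sum_divide_distrib)
  also have "\<dots> \<le> 2 / k0"
  proof (rule divide_right_mono)
    have "(\<Sum>j\<in>{..n}. (1 / 2 :: real) ^ j) \<le> suminf (\<lambda>j. (1 / 2 :: real) ^ j)"
      by (intro sum_le_suminf summable_geometric) auto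
    then show "(\<Sum>j\<in>{..n}. (1 / 2 :: real) ^ j) \<le> 2"
      by (simp add: suminf_geometric)
  qed (use k0 in simp)
  finally have "1 - 2 / k0 \<le> prob A"
    unfolding A_def using prob_compl[OF sU] by simp
  moreover have "hits {1..n} (bh_critical n \<alpha> k) x < real k"
    if x: "x \<in> A" and k: "k \<in> {1..n}" "k0 \<le> real k" for x k
  proof -
    obtain i where i: "real k < K i"
      using real_arch_pow[of 2 "real k / k0"] k0 by (auto simp: K_def field_simps)
    define l where "l = (LEAST l. real k < K l)"
    have l: "real k < K l" "\<And>m. m < l \<Longrightarrow> K m \<le> real k"
      unfolding l_def using i by (auto intro: LeastI dest: not_less_Least)
    have "l \<noteq> 0"
    proof
      assume "l = 0"
      then show False
        using l(1) k(2) by (simp add: K_def)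
    qed
    then obtain j where j: "l = Suc j"
      by (cases l) auto
    have Kj: "K j \<le> real k" "real k < 2 * K j"
      using l(2)[of j] l(1) by (simp_all add: j K_def)
    have "K j \<le> real n"
      using Kj(1) k(1) by auto
    \<comment> \<open>The index bound in \<open>J\<close> only secures finiteness; it holds
      automatically since \<open>1 \<le> k0\<close> gives
      \<open>2 ^ j \<le> K j \<le> n\<close>.\<close>
    moreover have "j \<le> n"
    proof -
      have "2 ^ j * 1 \<le> 2 ^ j * k0"
        using k0_ge by (intro mult_left_mono) auto
      then have "(2 :: real) ^ j \<le> real n"
        using \<open>K j \<le> real n\<close> unfolding K_def by linarith
      then have "2 ^ j \<le> n"
        by simp
      then show ?thesis
        using less_exp[of j] by linarith
    qed
    ultimately have jJ: "j \<in> J"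
      by (simp add: J_def)
    have "gauss_tail (ereal (bh_critical n \<alpha> k)) \<le> gauss_tail (ereal (G j))"
    proof -
      have "\<alpha> * real k \<le> \<alpha> * (2 * K j)"
        using Kj \<alpha> by (intro mult_left_mono) auto
      then have "\<alpha> * real k / (2 * real n) \<le> \<alpha> * (2 * K j) / (2 * real n)"
        by (rule divide_right_mono) simp
      then show ?thesis
        unfolding G[OF jJ] using gauss_tail_bh_critical[of \<alpha> k n] \<alpha> k(1) by simp
    qed
    then have "G j \<le> bh_critical n \<alpha> k"
      by (simp only: gauss_tail_le_iff)
    then have "hits {1..n} (bh_critical n \<alpha> k) x \<le> hits {1..n} (G j) x"
      by (rule hits_antimono)
    also have "\<dots> = hits ?N (G j) x + hits ?S (G j) x"
      unfolding hits_def by (rule sum.subset_diff[OF support_subset]) simp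
    also have "hits ?S (G j) x \<le> (\<Sum>i\<in>?S. 1)"
      unfolding hits_def by (intro sum_mono) simp
    also have "\<dots> = real s"
      using signal_classD(1)[OF \<theta>] by simp
    also have "hits ?N (G j) x + real s < K j"
      using x jJ by (auto simp: A_def F_def not_le)
    finally show ?thesis
      using Kj(1) by simp
  qed
  ultimately show ?thesis
    using sA by auto
qed

text \<open>From \<open>s \<le> C * n powr c\<close> the squared boundary is at least
  \<open>(1 - c) * ln n\<close> eventually, half of the available \<open>2 * (1 - c) * ln n\<close>
  being given up to absorb \<open>C\<close>. Applying the little-o hypothesis with constant
  \<open>sqrt (1 - c) * \<delta> / 2\<close> then compares the level with the boundary.\<close>

lemma BH_level_asymptotics:
  assumes \<alpha>: "slowly_vanishing_level \<alpha>" and s: "sparse_regime s"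
    and "c < 1" and O: "(\<lambda>n. real (s n)) \<in> O(\<lambda>n. real n powr c)" and "0 < \<delta>"
  shows "eventually (\<lambda>n. exp (- boundary n (s n) * \<delta> / 2) \<le> \<alpha> n) sequentially"
proof -
  obtain C where C: "0 < C" "eventually (\<lambda>n. norm (real (s n)) \<le> C * norm (real n powr c)) sequentially"
    using O by (rule landau_o.bigE)
  let ?r = "sqrt (1 - c)"
  have r: "0 < ?r"
    using \<open>c < 1\<close> by simp
  have "filterlim (\<lambda>x::real. (1 - c) / 2 * ln x - ln C) at_top at_top"
    using \<open>c < 1\<close> by real_asymp
  then have "filterlim (\<lambda>n. (1 - c) / 2 * ln (real n) - ln C) at_top sequentially"
    using filterlim_real_sequentially by (rule filterlim_compose)
  then have "eventually (\<lambda>n. 0 < (1 - c) / 2 * ln (real n) - ln C) sequentially"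
    by (rule filterlim_at_top_dense[THEN iffD1, rule_format])
  moreover have "(\<lambda>n. - ln (\<alpha> n)) \<in> o(\<lambda>n. sqrt (ln (real n)))"
    using \<alpha> by (simp add: slowly_vanishing_level_def)
  then have "eventually (\<lambda>n. norm (- ln (\<alpha> n)) \<le> ?r * \<delta> / 2 * norm (sqrt (ln (real n)))) sequentially"
    by (rule landau_o.smallD) (use r \<open>0 < \<delta>\<close> in simp)
  ultimately show ?thesis
    using C(2) sparse_regimeD(4)[OF s] eventually_gt_at_top[of 1]
  proof eventually_elim
    case (elim n)
    have n: "0 < real (s n)" "1 < real n" "0 < ln (real n)"
      using elim by auto
    have "real (s n) \<le> C * real n powr c"
      using elim by simp
    then have "ln (real (s n)) \<le> ln (C * real n powr c)"
      using n by (intro ln_mono) auto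
    also have "\<dots> = ln C + c * ln (real n)"
      using n C(1) by (simp add: ln_mult ln_powr)
    finally have "(1 - c) * ln (real n) - ln C \<le> ln (real n / real (s n))"
      using n by (simp add: ln_div algebra_simps)
    then have "(1 - c) * ln (real n) \<le> 2 * ln (real n / real (s n))"
      using elim(1) by linarith
    then have "sqrt ((1 - c) * ln (real n)) \<le> boundary n (s n)"
      by (rule real_sqrt_le_mono)
    then have "?r * sqrt (ln (real n)) * (\<delta> / 2) \<le> boundary n (s n) * (\<delta> / 2)"
      using \<open>0 < \<delta>\<close> by (intro mult_right_mono) (auto simp: real_sqrt_mult)
    moreover have "- ln (\<alpha> n) \<le> ?r * \<delta> / 2 * sqrt (ln (real n))"
      using elim(2) n by simp
    ultimately have "- boundary n (s n) * \<delta> / 2 \<le> ln (\<alpha> n)"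
      by (simp add: mult_ac)
    moreover have "0 < \<alpha> n"
      using \<alpha> by (simp add: slowly_vanishing_level_def)
    ultimately show ?case
      by (metis exp_le_cancel_iff exp_ln)
  qed
qed

lemma concentrated_thresholds_BH:
  assumes \<alpha>: "slowly_vanishing_level \<alpha>" and s: "sparse_regime s" and b: "boundary_regime b"
    and c: "c < 1" "(\<lambda>n. real (s n)) \<in> O(\<lambda>n. real n powr c)"
  shows "concentrated_thresholds (\<lambda>n. BH_procedure (\<alpha> n) n) s b"
  unfolding concentrated_thresholds_def
proof (intro allI impI)
  fix \<delta> \<eta> :: real assume pos: "0 < \<delta>" "0 < \<eta>"
  obtain B where B: "eventually (\<lambda>n. B \<le> b n) sequentially"
    using boundary_regime_bounded_below[OF b] .
  define \<kappa> where "\<kappa> = gauss_tail (ereal (\<delta> - B))"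
  have \<kappa>: "0 < \<kappa>"
    by (simp add: \<kappa>_def gauss_tail_pos)
  have \<alpha>_pos: "0 < \<alpha> n" "\<alpha> n < 1" for n
    using \<alpha> by (auto simp: slowly_vanishing_level_def)
  have \<alpha>_small: "eventually (\<lambda>n. \<alpha> n < p) sequentially" if "0 < p" for p
    using \<alpha> that by (auto simp: slowly_vanishing_level_def intro: order_tendstoD)
  have large_s: "eventually (\<lambda>n. K \<le> real (s n)) sequentially" for K
    using sparse_regimeD(1)[OF s] by (simp add: filterlim_at_top)
  have "((\<lambda>a::real. 4 * exp (- a * \<delta> / 2)) \<longlongrightarrow> 0) at_top"
    using pos(1) by real_asymp
  then have "(\<lambda>n. 4 * exp (- boundary n (s n) * \<delta> / 2)) \<longlonglongrightarrow> 0"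
    using sparse_regimeD(3)[OF s] by (rule filterlim_compose)
  then have lim: "eventually (\<lambda>n. 4 * exp (- boundary n (s n) * \<delta> / 2) < \<kappa>) sequentially"
    using \<kappa> by (rule order_tendstoD)
  have "eventually (\<lambda>n. \<alpha> n < 1 / 8) sequentially" "eventually (\<lambda>n. \<alpha> n < \<eta> / 2) sequentially"
    by (rule \<alpha>_small, use pos in simp)+
  moreover have "eventually (\<lambda>n. 4 / \<kappa>\<^sup>2 * 2 / \<eta> \<le> real (s n)) sequentially"
    "eventually (\<lambda>n. 2 / \<eta> \<le> real (s n)) sequentially"
    by (rule large_s)+
  moreover have "eventually (\<lambda>n. 2 * \<eta> < real n / real (s n)) sequentially"
    using sparse_regimeD(2)[OF s] by (rule filterlim_at_top_dense[THEN iffD1, rule_format])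
  moreover have "eventually (\<lambda>n. 1 < boundary n (s n)) sequentially"
    using sparse_regimeD(3)[OF s] by (rule filterlim_at_top_dense[THEN iffD1, rule_format])
  ultimately show "eventually (\<lambda>n. \<exists>u. real n * gauss_tail (ereal u) \<le> \<eta> * real (s n) \<and>
       (\<forall>\<theta>\<in>signal_class n (s n) (b n). \<exists>A.
          threshold_event n (BH_procedure (\<alpha> n) n) u (boundary n (s n) + \<delta>) A \<and>
          1 - \<eta> \<le> measure (obs_law n \<theta>) A)) sequentially"
    using B sparse_regimeD(4)[OF s] BH_level_asymptotics[OF \<alpha> s c pos(1)] lim
  proof eventually_elim
    case (elim n)
    define a where "a = boundary n (s n)"
    define u where "u = upper_quantile (\<eta> * real (s n) / real n)"
    \<comment> \<open>Solves \<open>\<alpha> n * k0 / (2 * n) = \<eta> * s n / n\<close>, the tail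
      at \<open>u\<close>: critical values below \<open>u\<close> are exactly those of some
      \<open>k\<close> above \<open>k0\<close>.\<close>
    define k0 where "k0 = 2 * \<eta> * real (s n) / \<alpha> n"
    have sn: "0 < s n" "s n \<le> n" "0 < real (s n)" "0 < real n"
      using elim(8) by auto
    have a1: "1 < a"
      using elim(6) by (simp add: a_def)
    have Qu: "gauss_tail (ereal u) = \<eta> * real (s n) / real n"
      unfolding u_def
    proof (rule gauss_tail_upper_quantile)
      show "\<eta> * real (s n) / real n < 1 / 2"
        using elim(5) sn by (simp add: field_simps)
    qed (use sn pos in simp)
    have tail: "real n * gauss_tail (ereal u) \<le> \<eta> * real (s n)"
      using sn by (simp add: Qu)
    \<comment> \<open>The tail at \<open>a + \<delta>\<close> is at most
      \<open>exp (- a * \<delta>) * s / n\<close>; dividing by the level uses up half of the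
      exponent, and the rest is eventually below \<open>\<kappa> / 4\<close>. Hence
      \<open>\<kappa> * s / 2\<close> detections make \<open>a + \<delta>\<close>
      admissible.\<close>
    have level: "2 * gauss_tail (ereal (a + \<delta>)) / \<alpha> n \<le> \<kappa> * real (s n) / 2 / real n"
    proof -
      have "gauss_tail (ereal (a + \<delta>)) \<le> std_normal_density (a + \<delta>) / (a + \<delta>)"
        using a1 pos by (intro gauss_tail_le_mills) simp
      also have "\<dots> \<le> std_normal_density (a + \<delta>) / 1"
        using a1 pos by (intro divide_left_mono) auto
      also have "\<dots> \<le> exp (- (a + \<delta>)\<^sup>2 / 2)"
        using std_normal_density_le_exp by simp
      also have "\<dots> \<le> exp (- (a\<^sup>2 / 2) + - a * \<delta>)"
      proof -
        have "- (a + \<delta>)\<^sup>2 / 2 = - (a\<^sup>2 / 2) + - a * \<delta> - \<delta>\<^sup>2 / 2"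
          by (simp add: power2_eq_square field_simps)
        then have "- (a + \<delta>)\<^sup>2 / 2 \<le> - (a\<^sup>2 / 2) + - a * \<delta>"
          using zero_le_power2[of \<delta>] by linarith
        then show ?thesis
          by (simp only: exp_le_cancel_iff)
      qed
      also have "\<dots> = real (s n) / real n * exp (- a * \<delta>)"
        using exp_boundary_sq[OF sn(1,2)] by (simp only: exp_add a_def) (simp add: exp_minus)
      finally have "2 * gauss_tail (ereal (a + \<delta>)) / \<alpha> n \<le> 2 * (real (s n) / real n * exp (- a * \<delta>)) / \<alpha> n"
        using \<alpha>_pos[of n] by (intro divide_right_mono mult_left_mono) auto
      also have "\<dots> \<le> 2 * (real (s n) / real n * exp (- a * \<delta>)) / exp (- a * \<delta> / 2)"
        using elim(9) \<alpha>_pos[of n] by (intro divide_left_mono) (auto simp: a_def)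
      also have "\<dots> = real (s n) / real n / 2 * (4 * exp (- a * \<delta> / 2))"
      proof -
        have "exp (- a * \<delta>) = exp (- a * \<delta> / 2) * exp (- a * \<delta> / 2)"
          by (simp flip: exp_add)
        then show ?thesis
          by simp
      qed
      also have "\<dots> \<le> real (s n) / real n / 2 * \<kappa>"
        using elim(10) by (intro mult_left_mono) (auto simp: a_def)
      finally show ?thesis
        by (simp add: mult_ac)
    qed
    show ?case
    proof (intro exI[of _ u] conjI tail ballI)
      fix \<theta> assume \<theta>: "\<theta> \<in> signal_class n (s n) (b n)"
      interpret prob_space "obs_law n \<theta>"
        by (rule prob_space_obs_law)
      define D where "D = {x\<in>space (sample_space n). \<kappa> * real (s n) / 2 \<le> hits (support n \<theta>) (a + \<delta>) x}"
      have D: "1 - 4 / (\<kappa>\<^sup>2 * real (s n)) \<le> prob D"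
        unfolding D_def a_def \<kappa>_def by (rule detections_whp[OF \<theta> elim(7) sn(1)])
      obtain E where sE: "E \<in> events" and E: "1 - 2 / k0 \<le> prob E"
        and E_hits: "\<And>x k. x \<in> E \<Longrightarrow> k \<in> {1..n} \<Longrightarrow> k0 \<le> real k \<Longrightarrow> hits {1..n} (bh_critical n (\<alpha> n) k) x < real k"
        using BH_critical_exceedances_whp[OF \<theta> sn(1), of "\<alpha> n" \<eta>] elim(1,2) \<alpha>_pos[of n]
        unfolding k0_def by auto
      have sD: "D \<in> events"
        unfolding D_def using sets_hits_ge[OF support_subset[of n \<theta>], where c = "\<kappa> * real (s n) / 2" and u = "a + \<delta>"]
        by (simp only: sets_obs_law)
      have "1 - prob (D \<inter> E) = prob (space (obs_law n \<theta>) - (D \<inter> E))"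
        using sD sE by (intro prob_compl[symmetric]) auto
      also have "\<dots> = prob ((space (obs_law n \<theta>) - D) \<union> (space (obs_law n \<theta>) - E))"
        by (simp only: Diff_Int)
      also have "\<dots> \<le> prob (space (obs_law n \<theta>) - D) + prob (space (obs_law n \<theta>) - E)"
        using sD sE by (intro measure_Un_le) auto
      also have "\<dots> = (1 - prob D) + (1 - prob E)"
        using prob_compl[OF sD] prob_compl[OF sE] by simp
      also have "\<dots> \<le> 4 / (\<kappa>\<^sup>2 * real (s n)) + 2 / k0"
        using D E by simp
      also have "4 / (\<kappa>\<^sup>2 * real (s n)) \<le> \<eta> / 2"
        using elim(3) \<kappa> pos sn by (simp add: field_simps)
      also have "2 / k0 \<le> \<eta> / 2"
      proof -
        have "2 / k0 = \<alpha> n / (\<eta> * real (s n))"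
          using \<alpha>_pos[of n] pos sn by (simp add: k0_def)
        also have "\<dots> \<le> (\<eta> / 2) / (\<eta> * real (s n))"
          using elim(2) pos sn by (intro divide_right_mono) auto
        also have "\<dots> = 1 / 2 / real (s n)"
          using pos by simp
        also have "\<dots> \<le> \<eta> / 2"
          using elim(4) pos sn by (simp add: field_simps)
        finally show ?thesis .
      qed
      finally have prob: "1 - \<eta> \<le> prob (D \<inter> E)"
        by simp
      have event: "threshold_event n (BH_procedure (\<alpha> n) n) u (a + \<delta>) (D \<inter> E)"
        unfolding threshold_event_def
      proof (intro conjI ballI)
        show "D \<inter> E \<in> sets (sample_space n)"
          using sD sE by auto
        fix x i assume x: "x \<in> D \<inter> E" and i: "i \<in> {1..n}"
        have reject: "BH_procedure (\<alpha> n) n x i = 1 \<longleftrightarrow> BH_threshold n (\<alpha> n) x \<le> ereal \<bar>x i\<bar>"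
          using i by (simp add: BH_procedure_def)
        show "a + \<delta> \<le> \<bar>x i\<bar> \<longrightarrow> BH_procedure (\<alpha> n) n x i = 1"
        proof
          assume hit: "a + \<delta> \<le> \<bar>x i\<bar>"
          have "\<kappa> * real (s n) / 2 \<le> hits (support n \<theta>) (a + \<delta>) x"
            using x by (simp add: D_def)
          also have "\<dots> \<le> hits {1..n} (a + \<delta>) x"
            unfolding hits_def using support_subset by (intro sum_mono2) auto
          finally have "\<kappa> * real (s n) / 2 / real n \<le> hits {1..n} (a + \<delta>) x / real n"
            by (rule divide_right_mono) simp
          then have "BH_threshold n (\<alpha> n) x \<le> ereal (a + \<delta>)"
            using level by (intro BH_threshold_le \<alpha>_pos) linarith
          also have "\<dots> \<le> ereal \<bar>x i\<bar>"
            using hit by simp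
          finally show "BH_procedure (\<alpha> n) n x i = 1"
            unfolding reject .
        qed
        show "BH_procedure (\<alpha> n) n x i = 1 \<longrightarrow> u \<le> \<bar>x i\<bar>"
        proof
          assume "BH_procedure (\<alpha> n) n x i = 1"
          then obtain k where k: "k \<in> {1..n}" "real k \<le> hits {1..n} (bh_critical n (\<alpha> n) k) x"
            and le: "bh_critical n (\<alpha> n) k \<le> \<bar>x i\<bar>"
            unfolding reject BH_threshold_le_iff[OF \<alpha>_pos] by blast
          have "real k < k0"
            using E_hits[of x k] x k by (cases "real k < k0") auto
          then have "\<alpha> n * real k < 2 * \<eta> * real (s n)"
            unfolding k0_def using \<alpha>_pos[of n] by (simp add: field_simps)
          then have "gauss_tail (ereal (bh_critical n (\<alpha> n) k)) \<le> gauss_tail (ereal u)"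
            unfolding Qu gauss_tail_bh_critical[OF \<alpha>_pos k(1)] using sn by (simp add: field_simps)
          then have "u \<le> bh_critical n (\<alpha> n) k"
            by (simp only: gauss_tail_le_iff)
          then show "u \<le> \<bar>x i\<bar>"
            using le by linarith
        qed
      qed
      show "\<exists>A. threshold_event n (BH_procedure (\<alpha> n) n) u (boundary n (s n) + \<delta>) A \<and> 1 - \<eta> \<le> prob A"
        using prob event unfolding a_def by blast
    qed
  qed
qed

theorem theorem2:
  shows "(\<exists>\<phi> :: nat \<Rightarrow> testing_procedure.
            (\<forall>n. multiple_testing_procedure n (\<phi> n)) \<and>
            (\<forall>s b. sparse_regime s \<longrightarrow> boundary_regime b \<longrightarrow> achieves_boundary_risk \<phi> s b))
       \<and> (\<forall>what t. mmle_weight what \<longrightarrow> 0 < t \<longrightarrow> t < 1 \<longrightarrow>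
            (\<forall>n. multiple_testing_procedure n (l_value_procedure what t n)) \<and>
            (\<forall>s b. sparse_regime s \<longrightarrow> boundary_regime b \<longrightarrow>
                achieves_boundary_risk (l_value_procedure what t) s b))
       \<and> (\<forall>\<alpha>. slowly_vanishing_level \<alpha> \<longrightarrow>
            (\<forall>n. multiple_testing_procedure n (BH_procedure (\<alpha> n) n)) \<and>
            (\<forall>s b (c::real). sparse_regime s \<longrightarrow> boundary_regime b \<longrightarrow>
                c < 1 \<longrightarrow> (\<lambda>n. real (s n)) \<in> O(\<lambda>n. real n powr c) \<longrightarrow>
                achieves_boundary_risk (\<lambda>n. BH_procedure (\<alpha> n) n) s b))"
proof (intro conjI allI impI)
  have l_value: "achieves_boundary_risk (l_value_procedure what t) s b"
    if "mmle_weight what" "0 < t" "t < 1" "sparse_regime s" "boundary_regime b" for what t s b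
    using that by (intro achieves_boundary_riskI measurable_l_value_procedure concentrated_thresholds_l_value)
  obtain what where what: "mmle_weight what"
    using ex_mmle_weight by blast
  \<comment> \<open>The adaptive procedure is the \<open>l_value_procedure\<close> at
    \<open>t = 1 / 2\<close>, for a maximiser that exists by compactness.\<close>
  show "\<exists>\<phi> :: nat \<Rightarrow> testing_procedure. (\<forall>n. multiple_testing_procedure n (\<phi> n)) \<and>
      (\<forall>s b. sparse_regime s \<longrightarrow> boundary_regime b \<longrightarrow> achieves_boundary_risk \<phi> s b)"
    using l_value[OF what, of "1 / 2"] measurable_l_value_procedure[OF what]
    by (intro exI[of _ "l_value_procedure what (1 / 2)"]) auto
  show "achieves_boundary_risk (l_value_procedure what t) s b"
    if "mmle_weight what" "0 < t" "t < 1" "sparse_regime s" "boundary_regime b" for what t s b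
    using that by (rule l_value)
  show "multiple_testing_procedure n (l_value_procedure what t n)" if "mmle_weight what" for what t n
    using that by (rule measurable_l_value_procedure)
next
  fix \<alpha> n assume "slowly_vanishing_level \<alpha>"
  then show "multiple_testing_procedure n (BH_procedure (\<alpha> n) n)"
    by (intro measurable_BH_procedure) (auto simp: slowly_vanishing_level_def)
next
  fix \<alpha> s b and c :: real
  assume *: "slowly_vanishing_level \<alpha>" "sparse_regime s" "boundary_regime b" "c < 1"
    "(\<lambda>n. real (s n)) \<in> O(\<lambda>n. real n powr c)"
  then show "achieves_boundary_risk (\<lambda>n. BH_procedure (\<alpha> n) n) s b"
    by (intro achieves_boundary_riskI measurable_BH_procedure concentrated_thresholds_BH)
      (auto simp: slowly_vanishing_level_def)
qed

end
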